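(* Let $\lambda\in\mathbb C$, $\ell\in\mathbb Z$, $N\in\mathbb Z_{>0}$ with $4\mid N$ if $\ell$ is odd, and $\chi$ a Dirichlet character mod $N$. Let $T$ be a distribution on $\mathcal V^\infty_{\lambda,\ell}$ which is automorphic for $\widetilde\Gamma_0(N)$ with character $\chi$. Then its Poisson transform $(\mathcal P_{\lambda,\ell}T)(z)=T(p_{\lambda,\ell,z})$ is a Maass form for $\widetilde\Gamma_0(N)$ of weight $\ell/2$ with character $\chi^{-1}$ and eigenvalue $(\lambda-\frac\ell4)(1-\lambda-\frac\ell4)$.
   Context: Complex powers principal values. $f_\infty(x)=(\operatorname{sgn}x)^{\ell/2}|x|^{-2\lambda}f(-1/x)$ with $(\operatorname{sgn}x)^{\ell/2}=1$ ($x>0$), $i^\ell$ ($x<0$); $\mathcal V^\infty_{\lambda,\ell}$ is the space of $C^\infty$ $f$ on $\mathbb R$ such that $f_\infty$ extends smoothly to $\mathbb R$, with Fréchet topology from seminorms $\nu_{M,\lambda}(f)=\sup_x(1+x^2)^{\operatorname{Re}\lambda}\sum_{j\le M}|D_\lambda^jf(x)|$, $D_\lambda=(1+x^2)\frac d{dx}+2\lambda x$; distributions are continuous linear functionals. Poisson kernel: $p_{\lambda,\ell,z}(u)=\frac{y^{\lambda-\ell/4}}{|z-u|^{2\lambda-\ell/2}(z-u)^{\ell/2}}$ for $z=x+iy\in\mathcal H$, $u\in\mathbb R$ (an element of $\mathcal V^\infty_{\lambda,\ell}$ in $u$). Group $\widetilde G$: pairs $(g,\varphi)$, $g=\begin{pmatrix}a&b\\c&d\end{pmatrix}\in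 SL_2(\mathbb R)$, $\varphi$ holomorphic on $\mathcal H$ with $\varphi(z)^4=(cz+d)^2$, product $(g_1,\varphi_1)(g_2,\varphi_2)=(g_1g_2,\varphi_1(g_2z)\varphi_2(z))$; $[g,\xi]=(g,\xi(cz+d)^{1/2})$, $\xi^4=1$. Action $\pi_{\lambda,\ell}$: for $\tilde g=[g,\xi]$, $(\pi_{\lambda,\ell}(\tilde g)f)(x)=|-cx+a|^{-2\lambda}f(\frac{dx-b}{-cx+a})\epsilon$ if $-cx+a\ne0$, with $\epsilon=\xi^{-\ell}$ ($-cx+a>0$), $(i\xi)^{-\ell}$ ($-cx+a<0,c\ge0$), $(-i\xi)^{-\ell}$ ($-cx+a<0,c<0$); and $|c|^{2\lambda}f_\infty(0)\epsilon$ if $-cx+a=0$, $\epsilon=\xi^{-\ell}$ ($c<0$), $(i\xi)^{-\ell}$ ($c>0$); $(\pi^*_{\lambda,\ell}(\tilde g)T)(f)=T(\pi_{\lambda,\ell}(\tilde g^{-1})f)$. $\widetilde\Gamma_0(N)$: $\ell$ even: $\{[\gamma,\pm1]:\gamma\in\Gamma_0(N)\}$; $\ell$ odd: $\{[\gamma,\varepsilon_d^{-1}(\frac cd)]:\gamma\in\Gamma_0(N)\}$, $\varepsilon_d=1$ ($d\equiv1\ (4)$), $i$ ($d\equiv3\ (4)$), $(\frac cd)$ Shimura's quadratic residue symbol; $\chi([\gamma,\xi])=\chi(d)$. $T$ automorphic with character $\chi$: $\pi^*_{\lambda,\ell}(\tilde\gamma)T=\chi(\tilde\gamma)T$ for all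 $\tilde\gamma\in\widetilde\Gamma_0(N)$. Maass forms: slash $(F|_\ell(g,\varphi))(z)=F(gz)\varphi(z)^{-\ell}$; $\Delta_{\ell/2}=-y^2(\partial_x^2+\partial_y^2)+\frac{i\ell y}2(\partial_x+i\partial_y)$; a Maass form for $\widetilde\Gamma_0(N)$ of weight $\ell/2$, character $\chi'$, eigenvalue $\Lambda$ is a $C^\infty$ $F$ on $\mathcal H$ with $F|_\ell\tilde\gamma=\chi'(\tilde\gamma)F$ ($\tilde\gamma\in\widetilde\Gamma_0(N)$), $\Delta_{\ell/2}F=\Lambda F$, and for each $A\in SL_2(\mathbb Z)$ constants $C,K,\nu>0$ with $|(F|_\ell[A,1])(z)|<Cy^\nu$ for $\operatorname{Im}z>K$. *)

theory Defs
  imports "HOL-Analysis.Analysis" "HOL-Number_Theory.Number_Theory"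
begin

section \<open>Smooth functions\<close>

text \<open>Used for open \<open>S\<close> only.  On \<open>complex\<close>, \<open>Basis = {1, \<i>}\<close>, so the directional
  derivatives are the partial derivatives in \<open>x\<close> and \<open>y\<close> and differentiability is in the real sense.\<close>

primrec C_k_on :: "nat \<Rightarrow> ('a::euclidean_space \<Rightarrow> 'b::real_normed_vector) \<Rightarrow> 'a set \<Rightarrow> bool" where
  "C_k_on 0 f S \<longleftrightarrow> continuous_on S f"
| "C_k_on (Suc k) f S \<longleftrightarrow> f differentiable_on S \<and>
     (\<forall>b\<in>Basis. C_k_on k (\<lambda>x. frechet_derivative f (at x) b) S)"

definition smooth_on :: "'a set \<Rightarrow> ('a::euclidean_space \<Rightarrow> 'b::real_normed_vector) \<Rightarrow> bool" where
  "smooth_on S f \<longleftrightarrow> (\<forall>k. C_k_on k f S)"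

section \<open>The space of test functions and its distributions\<close>

text \<open>The function $f_\infty$ on $\mathbb R\setminus\{0\}$; its value at 0 is irrelevant.\<close>

definition f_inf :: "complex \<Rightarrow> int \<Rightarrow> (real \<Rightarrow> complex) \<Rightarrow> real \<Rightarrow> complex" where
  "f_inf lam l f x =
     (if x > 0 then 1 else \<i> powi l) * of_real \<bar>x\<bar> powr (- 2 * lam) * f (- 1 / x)"

definition smooth_ext_f_inf :: "complex \<Rightarrow> int \<Rightarrow> (real \<Rightarrow> complex) \<Rightarrow> (real \<Rightarrow> complex) \<Rightarrow> bool" where
  "smooth_ext_f_inf lam l f h \<longleftrightarrow> smooth_on UNIV h \<and> (\<forall>x. x \<noteq> 0 \<longrightarrow> h x = f_inf lam l f x)"

definition test_space :: "complex \<Rightarrow> int \<Rightarrow> (real \<Rightarrow> complex) set" where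
  "test_space lam l = {f. smooth_on UNIV f \<and> (\<exists>h. smooth_ext_f_inf lam l f h)}"

definition f_inf_ext :: "complex \<Rightarrow> int \<Rightarrow> (real \<Rightarrow> complex) \<Rightarrow> real \<Rightarrow> complex" where
  "f_inf_ext lam l f = (THE h. smooth_ext_f_inf lam l f h)"

definition D_op :: "complex \<Rightarrow> (real \<Rightarrow> complex) \<Rightarrow> real \<Rightarrow> complex" where
  "D_op lam f x = (1 + (of_real x)\<^sup>2) * vector_derivative f (at x) + 2 * lam * of_real x * f x"

definition seminorm :: "nat \<Rightarrow> complex \<Rightarrow> (real \<Rightarrow> complex) \<Rightarrow> real" where
  "seminorm M lam f =
     (SUP x. (1 + x\<^sup>2) powr Re lam * (\<Sum>j\<le>M. cmod ((D_op lam ^^ j) f x)))"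

definition test_topology :: "complex \<Rightarrow> int \<Rightarrow> (real \<Rightarrow> complex) topology" where
  "test_topology lam l = topology_generated_by
     {{g \<in> test_space lam l. seminorm M lam (\<lambda>x. g x - f x) < r} | f M r.
        f \<in> test_space lam l \<and> r > 0}"

text \<open>Only the values on \<open>test_space lam l\<close> of a functional are constrained.\<close>

definition distribution_on :: "complex \<Rightarrow> int \<Rightarrow> ((real \<Rightarrow> complex) \<Rightarrow> complex) \<Rightarrow> bool" where
  "distribution_on lam l T \<longleftrightarrow>
     (\<forall>f\<in>test_space lam l. \<forall>g\<in>test_space lam l. T (\<lambda>x. f x + g x) = T f + T g) \<and>
     (\<forall>f\<in>test_space lam l. \<forall>a. T (\<lambda>x. a * f x) = a * T f) \<and>
     continuous_map (test_topology lam l) euclidean T"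

section \<open>The upper half-plane and the metaplectic group\<close>

definition uhp :: "complex set" where
  "uhp = {z. Im z > 0}"

definition aut_factor :: "real^2^2 \<Rightarrow> complex \<Rightarrow> complex" where
  "aut_factor g z = of_real (g$2$1) * z + of_real (g$2$2)"

definition moebius_act :: "real^2^2 \<Rightarrow> complex \<Rightarrow> complex" where
  "moebius_act g z = (of_real (g$1$1) * z + of_real (g$1$2)) / aut_factor g z"

type_synonym metaplectic = "(real^2^2) \<times> (complex \<Rightarrow> complex)"

text \<open>The second components are functions on the upper half-plane, hence extensional.\<close>

definition Gtilde :: "metaplectic monoid" where
  "Gtilde =
     \<lparr>carrier = {(g, \<phi>). det g = 1 \<and> \<phi> \<in> extensional uhp \<and> \<phi> holomorphic_on uhp \<and>
                   (\<forall>z\<in>uhp. \<phi> z ^ 4 = (aut_factor g z)\<^sup>2)},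
      monoid.mult = (\<lambda>(g1, \<phi>1) (g2, \<phi>2).
        (g1 ** g2, restrict (\<lambda>z. \<phi>1 (moebius_act g2 z) * \<phi>2 z) uhp)),
      one = (mat 1, restrict (\<lambda>z. 1) uhp)\<rparr>"

definition mp_elt :: "real^2^2 \<Rightarrow> complex \<Rightarrow> metaplectic" where
  "mp_elt g \<xi> = (g, restrict (\<lambda>z. \<xi> * csqrt (aut_factor g z)) uhp)"

text \<open>Every element of \<open>Gtilde\<close> is $[g,\xi]$ for a unique fourth root of unity $\xi$.\<close>

definition mp_root :: "metaplectic \<Rightarrow> complex" where
  "mp_root gt = (THE \<xi>. \<xi> ^ 4 = 1 \<and> gt = mp_elt (fst gt) \<xi>)"

definition pi_act ::
  "complex \<Rightarrow> int \<Rightarrow> metaplectic \<Rightarrow> (real \<Rightarrow> complex) \<Rightarrow> real \<Rightarrow> complex" where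
  "pi_act lam l gt f x =
     (let g = fst gt; \<xi> = mp_root gt;
          a = g$1$1; b = g$1$2; c = g$2$1; d = g$2$2; t = - c * x + a
      in if t \<noteq> 0 then
           of_real \<bar>t\<bar> powr (- 2 * lam) * f ((d * x - b) / t) *
           (if t > 0 then \<xi> else if c \<ge> 0 then \<i> * \<xi> else - \<i> * \<xi>) powi (- l)
         else
           of_real \<bar>c\<bar> powr (2 * lam) * f_inf_ext lam l f 0 *
           (if c < 0 then \<xi> else \<i> * \<xi>) powi (- l))"

definition pi_star ::
  "complex \<Rightarrow> int \<Rightarrow> metaplectic \<Rightarrow>
   ((real \<Rightarrow> complex) \<Rightarrow> complex) \<Rightarrow> (real \<Rightarrow> complex) \<Rightarrow> complex" where
  "pi_star lam l gt T f = T (pi_act lam l (inv\<^bsub>Gtilde\<^esub> gt) f)"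

section \<open>Congruence subgroups and characters\<close>

definition real_mat :: "int^2^2 \<Rightarrow> real^2^2" where
  "real_mat A = (\<chi> i j. of_int (A$i$j))"

definition Gamma0 :: "nat \<Rightarrow> (int^2^2) set" where
  "Gamma0 N = {A. det A = 1 \<and> int N dvd A$2$1}"

text \<open>Shimura's extension of the Jacobi symbol to odd \<open>d\<close> of either sign: for $d<0$ and $c\neq 0$
  it is $\mathrm{sgn}(c)$ times the Jacobi symbol at $|d|$, and its value at $c=0$, $d=\pm1$ is 1.\<close>

definition shimura_symbol :: "int \<Rightarrow> int \<Rightarrow> int" where
  "shimura_symbol c d =
     (if c < 0 \<and> d < 0 then - 1 else 1) * (\<Prod>p\<in>#prime_factorization \<bar>d\<bar>. Legendre c p)"

text \<open>Used for odd \<open>d\<close> only.\<close>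

definition eps :: "int \<Rightarrow> complex" where
  "eps d = (if d mod 4 = 1 then 1 else \<i>)"

definition Gamma0_tilde :: "int \<Rightarrow> nat \<Rightarrow> metaplectic set" where
  "Gamma0_tilde l N =
     (if even l then {mp_elt (real_mat A) \<xi> | A \<xi>. A \<in> Gamma0 N \<and> \<xi> \<in> {1, - 1}}
      else {mp_elt (real_mat A) (inverse (eps (A$2$2)) * of_int (shimura_symbol (A$2$1) (A$2$2)))
             | A. A \<in> Gamma0 N})"

definition dirichlet_char :: "nat \<Rightarrow> (int \<Rightarrow> complex) \<Rightarrow> bool" where
  "dirichlet_char N chi \<longleftrightarrow>
     chi 1 = 1 \<and> (\<forall>m n. chi (m * n) = chi m * chi n) \<and>
     (\<forall>m n. [m = n] (mod int N) \<longrightarrow> chi m = chi n) \<and>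
     (\<forall>n. chi n = 0 \<longleftrightarrow> \<not> coprime n (int N))"

text \<open>The entry \<open>d\<close> is an integer on \<open>Gamma0_tilde l N\<close>; the floor only changes its type.\<close>

definition char_tilde :: "(int \<Rightarrow> complex) \<Rightarrow> metaplectic \<Rightarrow> complex" where
  "char_tilde chi gt = chi \<lfloor>fst gt$2$2\<rfloor>"

definition automorphic_dist ::
  "complex \<Rightarrow> int \<Rightarrow> nat \<Rightarrow> (int \<Rightarrow> complex) \<Rightarrow> ((real \<Rightarrow> complex) \<Rightarrow> complex) \<Rightarrow> bool" where
  "automorphic_dist lam l N chi T \<longleftrightarrow>
     (\<forall>\<gamma>\<in>Gamma0_tilde l N. \<forall>f\<in>test_space lam l.
        pi_star lam l \<gamma> T f = char_tilde chi \<gamma> * T f)"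

section \<open>Maass forms\<close>

definition slash ::
  "int \<Rightarrow> (complex \<Rightarrow> complex) \<Rightarrow> metaplectic \<Rightarrow> complex \<Rightarrow> complex" where
  "slash l F gt z = F (moebius_act (fst gt) z) * snd gt z powi (- l)"

definition deriv_x :: "(complex \<Rightarrow> complex) \<Rightarrow> complex \<Rightarrow> complex" where
  "deriv_x F z = frechet_derivative F (at z) 1"

definition deriv_y :: "(complex \<Rightarrow> complex) \<Rightarrow> complex \<Rightarrow> complex" where
  "deriv_y F z = frechet_derivative F (at z) \<i>"

text \<open>The operator $\Delta_{\ell/2}$.\<close>

definition Laplacian :: "int \<Rightarrow> (complex \<Rightarrow> complex) \<Rightarrow> complex \<Rightarrow> complex" where
  "Laplacian l F z =
     - (of_real (Im z))\<^sup>2 * (deriv_x (deriv_x F) z + deriv_y (deriv_y F) z)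
     + \<i> * of_int l * of_real (Im z) / 2 * (deriv_x F z + \<i> * deriv_y F z)"

text \<open>Maass forms of weight \<open>l/2\<close> for \<open>Gamma0_tilde l N\<close>.\<close>

definition Maass_form ::
  "int \<Rightarrow> nat \<Rightarrow> (int \<Rightarrow> complex) \<Rightarrow> complex \<Rightarrow> (complex \<Rightarrow> complex) \<Rightarrow> bool" where
  "Maass_form l N chi \<Lambda> F \<longleftrightarrow>
     smooth_on uhp F \<and>
     (\<forall>\<gamma>\<in>Gamma0_tilde l N. \<forall>z\<in>uhp. slash l F \<gamma> z = char_tilde chi \<gamma> * F z) \<and>
     (\<forall>z\<in>uhp. Laplacian l F z = \<Lambda> * F z) \<and>
     (\<forall>A::int^2^2. det A = 1 \<longrightarrow>
        (\<exists>C K \<nu>::real. C > 0 \<and> K > 0 \<and> \<nu> > 0 \<and>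
           (\<forall>z. Im z > K \<longrightarrow> cmod (slash l F (mp_elt (real_mat A) 1) z) < C * Im z powr \<nu>)))"

section \<open>The Poisson transform\<close>

definition poisson_kernel :: "complex \<Rightarrow> int \<Rightarrow> complex \<Rightarrow> real \<Rightarrow> complex" where
  "poisson_kernel lam l z u =
     of_real (Im z) powr (lam - of_int l / 4) /
     (of_real (cmod (z - of_real u)) powr (2 * lam - of_int l / 2) *
      (z - of_real u) powr (of_int l / 2))"

definition poisson_transform ::
  "complex \<Rightarrow> int \<Rightarrow> ((real \<Rightarrow> complex) \<Rightarrow> complex) \<Rightarrow> complex \<Rightarrow> complex" where
  "poisson_transform lam l T z = T (poisson_kernel lam l z)"

end

theory Submission
  imports Defs
begin

text \<open>On the upper half-plane the Poisson kernel is $y^b(z-u)^{-a}(\bar z-u)^{-b}$ with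
  $a=\lambda+\ell/4$, $b=\lambda-\ell/4$.  The operator $D_\lambda$ in \<open>u\<close>
  acts on $(z-u)^{-a}(\bar z-u)^{-b}$ as the infinitesimal rotation in \<open>z\<close>, so all seminorms of its
  derivatives $\partial_z^p\partial_{\bar z}^q$ grow at most polynomially in $|z|$ and $1/y$.  As \<open>T\<close> is
  bounded by one seminorm, it may be interchanged with $\partial_z$ and $\partial_{\bar z}$, which gives smoothness,
  and the Laplace equation follows from the one for the kernel.  The equivariance of the kernel under $\widetilde G$ gives
  automorphy; each cusp then has a period strip, where the polynomial bound suffices.\<close>

section \<open>Smooth functions\<close>

text \<open>The exponents a and b arise because |z-u|^(2b) = (z-u)^b (conj z - u)^b for principal
  powers. Their difference l/2 carries the weight of the form, and their sum 2 lam is what balances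
  the factor (1+u^2)^(Re lam) in the seminorms. Two obstacles shape the proof. First,
  \<open>T\<close> can be differentiated only through a seminorm, so Taylor remainders of the kernel
  in z must be small together with their \<open>D_op\<close>-iterates in u, uniformly on the
  noncompact line. This is why each \<open>D_op\<close> is traded for an operator in z with
  coefficients free of u: the iterates become explicit functions of z, and by linearity those of a
  remainder are again Taylor remainders. Second, for odd \<open>l\<close> the equivariance hinges on
  signs of square roots. The kernel is therefore rewritten with integer powers of
  \<open>csqrt\<close>, which multiply freely, and each sign is settled by the quadrant in which a
  product of roots lies. At a cusp only the modulus of the slashed transform is shown to be
  periodic, so the multipliers of the conjugated translations never have to be computed.\<close>

lemma C_k_on_cong:
  assumes "open S" "\<And>x. x \<in> S \<Longrightarrow> f x = g x"
  shows "C_k_on k f S \<longleftrightarrow> C_k_on k g S"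
  using assms(2)
proof (induction k arbitrary: f g)
  case 0
  then show ?case by (simp cong: continuous_on_cong)
next
  case (Suc k)
  have hd: "(f has_derivative D) (at x) \<longleftrightarrow> (g has_derivative D) (at x)" if "x \<in> S" for x D
    using has_derivative_transform_within_open[OF _ \<open>open S\<close> that] Suc.prems by metis
  then have "f differentiable_on S \<longleftrightarrow> g differentiable_on S"
    unfolding differentiable_on_eq_differentiable_at[OF \<open>open S\<close>] differentiable_def by blast
  moreover have "frechet_derivative f (at x) = frechet_derivative g (at x)" if "x \<in> S" for x
    unfolding frechet_derivative_def using hd[OF that] by presburger
  ultimately show ?case
    using Suc.IH[of "\<lambda>x. frechet_derivative f (at x) b" "\<lambda>x. frechet_derivative g (at x) b" for b]
    by simp
qed

text \<open>The linear span. The families used below differentiate into sums of their members with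
  constant coefficients, so closure under derivatives holds only for the span.\<close>

inductive lincomb :: "('a \<Rightarrow> complex) set \<Rightarrow> ('a \<Rightarrow> complex) \<Rightarrow> bool" for B where
  lincomb_base: "f \<in> B \<Longrightarrow> lincomb B f"
| lincomb_add: "lincomb B f \<Longrightarrow> lincomb B g \<Longrightarrow> lincomb B (\<lambda>x. f x + g x)"
| lincomb_scale: "lincomb B f \<Longrightarrow> lincomb B (\<lambda>x. c * f x)"

text \<open>Derivatives of members of the span stay in the span, so the induction on
  \<open>k\<close> runs over the whole span at once. Smoothness of a concrete family then needs
  nothing but a formula for first derivatives.\<close>

lemma smooth_on_lincomb:
  fixes B :: "('a::euclidean_space \<Rightarrow> complex) set"
  assumes "open S"
    and B: "\<And>f. f \<in> B \<Longrightarrow> \<exists>D. (\<forall>x\<in>S. (f has_derivative D x) (at x)) \<and>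
                     (\<forall>b\<in>Basis. lincomb B (\<lambda>x. D x b))"
    and "lincomb B f"
  shows "smooth_on S f"
proof -
  have step: "\<exists>D. (\<forall>x\<in>S. (f has_derivative D x) (at x)) \<and> (\<forall>b\<in>Basis. lincomb B (\<lambda>x. D x b))"
    if "lincomb B f" for f
    using that
  proof (induction rule: lincomb.induct)
    case (lincomb_base f)
    then show ?case by (rule B)
  next
    case (lincomb_add f g)
    then obtain D E where "\<forall>x\<in>S. (f has_derivative D x) (at x)" "\<forall>b\<in>Basis. lincomb B (\<lambda>x. D x b)"
      "\<forall>x\<in>S. (g has_derivative E x) (at x)" "\<forall>b\<in>Basis. lincomb B (\<lambda>x. E x b)" by blast
    then show ?case
      by (intro exI[of _ "\<lambda>x b. D x b + E x b"])
         (auto intro: lincomb.lincomb_add has_derivative_add)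
  next
    case (lincomb_scale f c)
    then obtain D where "\<forall>x\<in>S. (f has_derivative D x) (at x)" "\<forall>b\<in>Basis. lincomb B (\<lambda>x. D x b)"
      by blast
    then show ?case
      by (intro exI[of _ "\<lambda>x b. c * D x b"])
         (auto intro: lincomb.lincomb_scale has_derivative_mult_right)
  qed
  have "C_k_on k f S" if "lincomb B f" for k f
    using that
  proof (induction k arbitrary: f)
    case 0
    obtain D where "\<forall>x\<in>S. (f has_derivative D x) (at x)" using step[OF 0] by blast
    then have "f differentiable_on S"
      unfolding differentiable_on_def differentiable_def using has_derivative_at_withinI by blast
    then show ?case by (simp add: differentiable_imp_continuous_on)
  next
    case (Suc k)
    obtain D where D: "\<forall>x\<in>S. (f has_derivative D x) (at x)" "\<forall>b\<in>Basis. lincomb B (\<lambda>x. D x b)"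
      using step[OF Suc.prems] by blast
    then have "f differentiable_on S"
      unfolding differentiable_on_def differentiable_def using has_derivative_at_withinI by blast
    moreover have "C_k_on k (\<lambda>x. frechet_derivative f (at x) b) S" if "b \<in> Basis" for b
    proof -
      have "frechet_derivative f (at x) b = D x b" if "x \<in> S" for x
        using D(1) that frechet_derivative_at by metis
      then have "C_k_on k (\<lambda>x. frechet_derivative f (at x) b) S \<longleftrightarrow> C_k_on k (\<lambda>x. D x b) S"
        by (rule C_k_on_cong[OF \<open>open S\<close>])
      then show ?thesis using Suc.IH D(2) \<open>b \<in> Basis\<close> by simp
    qed
    ultimately show ?case by simp
  qed
  then show ?thesis using assms(3) by (simp add: smooth_on_def)
qed

lemma smooth_on_UNIV_lincomb:
  fixes B :: "(real \<Rightarrow> complex) set"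
  assumes B: "\<And>f. f \<in> B \<Longrightarrow> \<exists>g. (\<forall>x. (f has_vector_derivative g x) (at x)) \<and> lincomb B g"
    and "lincomb B f"
  shows "smooth_on UNIV f"
proof (rule smooth_on_lincomb[OF open_UNIV _ assms(2)])
  fix f assume "f \<in> B"
  then obtain g where g: "\<forall>x. (f has_vector_derivative g x) (at x)" "lincomb B g" using B by blast
  then show "\<exists>D. (\<forall>x\<in>UNIV. (f has_derivative D x) (at x)) \<and> (\<forall>b\<in>Basis. lincomb B (\<lambda>x. D x b))"
    by (intro exI[of _ "\<lambda>x h. h *\<^sub>R g x"]) (auto simp: has_vector_derivative_def)
qed

lemma smooth_on_has_vector_derivative:
  fixes f :: "real \<Rightarrow> complex"
  assumes "smooth_on UNIV f"
  shows "(f has_vector_derivative vector_derivative f (at x)) (at x)"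
    and "smooth_on UNIV (\<lambda>x. vector_derivative f (at x))"
proof -
  have C: "C_k_on (Suc k) f UNIV" for k using assms by (simp add: smooth_on_def)
  then have d: "f differentiable (at x)" for x
    by (auto simp: differentiable_on_def)
  then show "(f has_vector_derivative vector_derivative f (at x)) (at x)"
    by (simp add: vector_derivative_works)
  have "frechet_derivative f (at x) 1 = vector_derivative f (at x)" for x
    by (metis d vector_derivative_works frechet_derivative_at has_vector_derivative_def scaleR_one)
  then show "smooth_on UNIV (\<lambda>x. vector_derivative f (at x))"
    using C by (auto simp: smooth_on_def)
qed

text \<open>Presents the iterated derivatives of an arbitrary smooth function as a family to which
  the span criterion applies; sums and products follow by linearity and the Leibniz rule.\<close>

lemma smooth_on_derivative_sequence:
  fixes f :: "real \<Rightarrow> complex"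
  assumes "smooth_on UNIV f"
  obtains F where "F 0 = f" "\<And>n x. (F n has_vector_derivative F (Suc n) x) (at x)"
proof
  define F where "F n = ((\<lambda>g x. vector_derivative g (at x)) ^^ n) f" for n
  show "F 0 = f" by (simp add: F_def)
  have "smooth_on UNIV (F n)" for n
    by (induction n) (auto simp: F_def assms smooth_on_has_vector_derivative(2))
  then show "(F n has_vector_derivative F (Suc n) x) (at x)" for n x
    using smooth_on_has_vector_derivative(1)[of "F n" x] by (simp add: F_def)
qed

lemma smooth_on_imp_continuous_on: "smooth_on S f \<Longrightarrow> continuous_on S f"
  unfolding smooth_on_def by (metis C_k_on.simps(1))

lemma smooth_on_add:
  fixes f g :: "real \<Rightarrow> complex"
  assumes "smooth_on UNIV f" "smooth_on UNIV g"
  shows "smooth_on UNIV (\<lambda>x. f x + g x)"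
proof -
  obtain F where F: "F 0 = f" "\<And>n x. (F n has_vector_derivative F (Suc n) x) (at x)"
    using smooth_on_derivative_sequence[OF assms(1)] by metis
  obtain G where G: "G 0 = g" "\<And>n x. (G n has_vector_derivative G (Suc n) x) (at x)"
    using smooth_on_derivative_sequence[OF assms(2)] by metis
  show ?thesis
  proof (rule smooth_on_UNIV_lincomb[where B = "range F \<union> range G"])
    show "lincomb (range F \<union> range G) (\<lambda>x. f x + g x)"
      using F(1) G(1) by (intro lincomb_add lincomb_base) auto
    fix h assume "h \<in> range F \<union> range G"
    then obtain n where "h = F n \<or> h = G n" by blast
    then show "\<exists>g. (\<forall>x. (h has_vector_derivative g x) (at x)) \<and> lincomb (range F \<union> range G) g"
      using F(2)[of n] G(2)[of n] lincomb_base[of _ "range F \<union> range G"] by blast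
  qed
qed

lemma smooth_on_mult:
  fixes f g :: "real \<Rightarrow> complex"
  assumes "smooth_on UNIV f" "smooth_on UNIV g"
  shows "smooth_on UNIV (\<lambda>x. f x * g x)"
proof -
  obtain F where F: "F 0 = f" "\<And>n x. (F n has_vector_derivative F (Suc n) x) (at x)"
    using smooth_on_derivative_sequence[OF assms(1)] by metis
  obtain G where G: "G 0 = g" "\<And>n x. (G n has_vector_derivative G (Suc n) x) (at x)"
    using smooth_on_derivative_sequence[OF assms(2)] by metis
  let ?B = "{\<lambda>x. F m x * G n x | m n. True}"
  show ?thesis
  proof (rule smooth_on_UNIV_lincomb[where B = ?B])
    show "lincomb ?B (\<lambda>x. f x * g x)"
      using F(1) G(1) by (intro lincomb_base) auto
    fix h assume "h \<in> ?B"
    then obtain m n where h: "h = (\<lambda>x. F m x * G n x)" by auto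
    show "\<exists>g. (\<forall>x. (h has_vector_derivative g x) (at x)) \<and> lincomb ?B g"
    proof (intro exI conjI allI)
      show "(h has_vector_derivative (F m x * G (Suc n) x + F (Suc m) x * G n x)) (at x)" for x
        unfolding h by (intro has_vector_derivative_mult F G)
      show "lincomb ?B (\<lambda>x. F m x * G (Suc n) x + F (Suc m) x * G n x)"
        by (intro lincomb_add lincomb_base) blast+
    qed
  qed
qed

lemma smooth_on_const: "smooth_on UNIV (\<lambda>x::real. c::complex)"
proof (rule smooth_on_UNIV_lincomb[where B = "range (\<lambda>c x. c)"])
  fix f :: "real \<Rightarrow> complex" assume "f \<in> range (\<lambda>c x. c)"
  then show "\<exists>g. (\<forall>x. (f has_vector_derivative g x) (at x)) \<and> lincomb (range (\<lambda>c x. c)) g"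
    by (intro exI[of _ "\<lambda>x. 0"]) (auto intro!: lincomb_base)
qed (auto intro!: lincomb_base)

lemma smooth_on_of_real: "smooth_on UNIV (\<lambda>x::real. of_real x :: complex)"
proof (rule smooth_on_UNIV_lincomb[where B = "insert of_real (range (\<lambda>c x. c))"])
  fix f :: "real \<Rightarrow> complex" assume f: "f \<in> insert of_real (range (\<lambda>c x. c))"
  show "\<exists>g. (\<forall>x. (f has_vector_derivative g x) (at x)) \<and>
        lincomb (insert of_real (range (\<lambda>c x. c))) g"
  proof (cases "f = of_real")
    case True
    have "(of_real has_vector_derivative (1::complex)) (at x)" for x :: real
      using has_vector_derivative_of_real[OF DERIV_ident, of "at x"] by simp
    then show ?thesis unfolding True
      by (intro exI[of _ "\<lambda>x. 1"]) (auto intro!: lincomb_base)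
  next
    case False
    then show ?thesis using f
      by (intro exI[of _ "\<lambda>x. 0"]) (auto intro!: lincomb_base)
  qed
qed (auto intro!: lincomb_base)

section \<open>The test space and the operator \<open>D_op\<close>\<close>

lemma smooth_on_D_op:
  assumes "smooth_on UNIV f"
  shows "smooth_on UNIV (D_op lam f)"
proof -
  have "D_op lam f = (\<lambda>x. (1 + of_real x * of_real x) * vector_derivative f (at x) + 2 * lam * of_real x * f x)"
    by (auto simp: D_op_def power2_eq_square)
  then show ?thesis
    by (simp add: smooth_on_add smooth_on_mult smooth_on_const smooth_on_of_real assms
        smooth_on_has_vector_derivative(2))
qed

lemma f_inf_add: "f_inf lam l (\<lambda>x. f x + g x) x = f_inf lam l f x + f_inf lam l g x"
  and f_inf_cmult: "f_inf lam l (\<lambda>x. c * f x) x = c * f_inf lam l f x"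
  by (simp_all add: f_inf_def algebra_simps)

lemma test_space_add:
  assumes "f \<in> test_space lam l" "g \<in> test_space lam l"
  shows "(\<lambda>x. f x + g x) \<in> test_space lam l"
proof -
  obtain h k where "smooth_ext_f_inf lam l f h" "smooth_ext_f_inf lam l g k"
    using assms by (auto simp: test_space_def)
  then have "smooth_ext_f_inf lam l (\<lambda>x. f x + g x) (\<lambda>x. h x + k x)"
    by (auto simp: smooth_ext_f_inf_def f_inf_add smooth_on_add)
  then show ?thesis using assms by (auto simp: test_space_def smooth_on_add)
qed

lemma test_space_cmult:
  assumes "f \<in> test_space lam l"
  shows "(\<lambda>x. c * f x) \<in> test_space lam l"
proof -
  obtain h where "smooth_ext_f_inf lam l f h"
    using assms by (auto simp: test_space_def)
  then have "smooth_ext_f_inf lam l (\<lambda>x. c * f x) (\<lambda>x. c * h x)"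
    by (auto simp: smooth_ext_f_inf_def f_inf_cmult smooth_on_mult smooth_on_const)
  then show ?thesis using assms by (auto simp: test_space_def smooth_on_mult smooth_on_const)
qed

text \<open>Justifies the definite description in \<open>f_inf_ext\<close>: two extensions agree off
  0 and are continuous there, hence agree at 0.\<close>

lemma f_inf_ext_eq:
  assumes "smooth_ext_f_inf lam l f h"
  shows "f_inf_ext lam l f = h"
  unfolding f_inf_ext_def
proof (rule the_equality, rule assms)
  fix k assume k: "smooth_ext_f_inf lam l f k"
  have "isCont h 0" "isCont k 0"
    using assms k smooth_on_imp_continuous_on[of UNIV] continuous_on_eq_continuous_at[OF open_UNIV]
    unfolding smooth_ext_f_inf_def by blast+
  moreover have "\<forall>\<^sub>F x in at 0. h x = k x"
    using assms k by (auto simp: smooth_ext_f_inf_def eventually_at_filter)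
  ultimately have "(h \<longlongrightarrow> h 0) (at 0)" "(h \<longlongrightarrow> k 0) (at 0)"
    unfolding isCont_def using tendsto_cong[of h k "at 0"] by blast+
  then have "h 0 = k 0" by (rule tendsto_unique[OF at_neq_bot])
  then have "k x = h x" for x
    using assms k by (cases "x = 0") (auto simp: smooth_ext_f_inf_def)
  then show "k = h" by blast
qed

lemma vector_derivative_abs_powr:
  assumes "x \<noteq> 0"
  shows "((\<lambda>x. complex_of_real \<bar>x\<bar> powr s) has_vector_derivative
            s * of_real \<bar>x\<bar> powr s / of_real x) (at x)"
proof -
  have pos: "((\<lambda>x. complex_of_real x powr s) has_vector_derivative s * of_real x powr (s - 1)) (at x)"
    if "x > 0" for x :: real
  proof -
    have "((\<lambda>w. w powr s) has_field_derivative s * of_real x powr (s - 1)) (at (complex_of_real x))"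
      using that by (intro has_field_derivative_powr) (simp add: complex_nonpos_Reals_iff)
    moreover have "(complex_of_real has_vector_derivative 1) (at x)"
      using has_vector_derivative_of_real[OF DERIV_ident, of "at x"] by simp
    ultimately show ?thesis
      using field_vector_diff_chain_at[of complex_of_real 1 x "\<lambda>w. w powr s" "s * of_real x powr (s - 1)"]
      by (simp add: o_def)
  qed
  show ?thesis
  proof (cases "x > 0")
    case True
    have "((\<lambda>x. complex_of_real \<bar>x\<bar> powr s) has_vector_derivative s * of_real x powr (s - 1)) (at x)"
      by (rule has_vector_derivative_transform_within_open[OF pos[OF True], of "{0<..}"]) (use True in auto)
    then show ?thesis using True by (simp add: powr_diff)
  next
    case False
    then have "x < 0" using assms by simp
    have "((\<lambda>x. complex_of_real x powr s) \<circ> uminus has_vector_derivative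
        (-1) *\<^sub>R (s * of_real (-x) powr (s - 1))) (at x)"
      using \<open>x < 0\<close> by (intro vector_diff_chain_at pos) (auto intro!: derivative_eq_intros)
    then have "((\<lambda>x. complex_of_real \<bar>x\<bar> powr s) has_vector_derivative
        (-1) *\<^sub>R (s * of_real (-x) powr (s - 1))) (at x)"
      by (rule has_vector_derivative_transform_within_open[of _ _ _ "{..<0}"]) (use \<open>x < 0\<close> in auto)
    then show ?thesis using \<open>x < 0\<close> by (simp add: powr_diff)
  qed
qed

text \<open>\<open>D_op\<close> is the infinitesimal rotation, and passing from \<open>f\<close> to
  \<open>f_inf\<close> is the action of the quarter turn x -> -1/x, so the two commute. This is what
  keeps the test space stable under \<open>D_op\<close>.\<close>

lemma D_op_f_inf:
  assumes "smooth_ext_f_inf lam l f h" "smooth_on UNIV f" "x \<noteq> 0"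
  shows "D_op lam h x = f_inf lam l (D_op lam f) x"
proof -
  define S where "S = (if x > 0 then {0<..} else {..<0::real})"
  define c where "c = (if x > 0 then 1 else \<i> powi l)"
  define P where "P = complex_of_real \<bar>x\<bar> powr (- 2 * lam)"
  have S: "open S" "x \<in> S" "\<And>y. y \<in> S \<Longrightarrow> y \<noteq> 0 \<and> (y > 0 \<longleftrightarrow> x > 0)"
    using \<open>x \<noteq> 0\<close> by (auto simp: S_def split: if_splits)
  let ?f' = "vector_derivative f (at (-1/x))"
  have *: "((\<lambda>y. f (-1/y)) has_vector_derivative (1/x\<^sup>2) *\<^sub>R ?f') (at x)"
  proof -
    have "((\<lambda>y. -1/y) has_vector_derivative 1/x\<^sup>2) (at x)"
      using \<open>x \<noteq> 0\<close> unfolding has_real_derivative_iff_has_vector_derivative[symmetric]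
      by (auto intro!: derivative_eq_intros simp: power2_eq_square)
    from vector_diff_chain_at[OF this smooth_on_has_vector_derivative(1)[OF assms(2)]]
    show ?thesis by (simp add: o_def)
  qed
  have "((\<lambda>y. c * (of_real \<bar>y\<bar> powr (- 2 * lam) * f (-1/y))) has_vector_derivative
     c * (P * ((1/x\<^sup>2) *\<^sub>R ?f') + (- 2 * lam * P / of_real x) * f (-1/x))) (at x)"
    unfolding P_def
    by (intro has_vector_derivative_mult_right has_vector_derivative_mult
        vector_derivative_abs_powr * \<open>x \<noteq> 0\<close>)
  then have "(h has_vector_derivative
     c * (P * ((1/x\<^sup>2) *\<^sub>R ?f') + (- 2 * lam * P / of_real x) * f (-1/x))) (at x)"
  proof (rule has_vector_derivative_transform_within_open[OF _ S(1,2)])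
    fix y assume "y \<in> S"
    then show "c * (of_real \<bar>y\<bar> powr (- 2 * lam) * f (-1/y)) = h y"
      using S(3)[of y] assms(1) by (simp add: c_def smooth_ext_f_inf_def f_inf_def)
  qed
  then have d: "vector_derivative h (at x) =
     c * (P * ((1/x\<^sup>2) *\<^sub>R ?f') + (- 2 * lam * P / of_real x) * f (-1/x))"
    by (rule vector_derivative_at)
  have hx: "h x = c * P * f (-1/x)"
    using assms(1,3) by (simp add: c_def P_def smooth_ext_f_inf_def f_inf_def)
  have "D_op lam h x = c * P * ((1 + 1 / of_real x ^ 2) * ?f' - 2 * lam / of_real x * f (-1/x))"
    unfolding D_op_def d hx using \<open>x \<noteq> 0\<close>
    by (simp add: scaleR_conv_of_real field_simps) (simp add: power2_eq_square power4_eq_xxxx)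
  also have "\<dots> = f_inf lam l (D_op lam f) x"
    using \<open>x \<noteq> 0\<close> by (simp add: f_inf_def c_def P_def D_op_def power2_eq_square)
  finally show ?thesis .
qed

lemma D_op_test_space:
  assumes "f \<in> test_space lam l"
  shows "D_op lam f \<in> test_space lam l"
proof -
  obtain h where h: "smooth_ext_f_inf lam l f h" and f: "smooth_on UNIV f"
    using assms by (auto simp: test_space_def)
  have "smooth_ext_f_inf lam l (D_op lam f) (D_op lam h)"
    using D_op_f_inf[OF h f] h smooth_on_D_op by (auto simp: smooth_ext_f_inf_def)
  then show ?thesis using smooth_on_D_op[OF f] by (auto simp: test_space_def)
qed

lemma D_op_funpow_test_space:
  "f \<in> test_space lam l \<Longrightarrow> (D_op lam ^^ j) f \<in> test_space lam l"
  by (induction j) (auto intro: D_op_test_space)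

lemma D_op_add:
  assumes "f \<in> test_space lam l" "g \<in> test_space lam l"
  shows "D_op lam (\<lambda>x. f x + g x) = (\<lambda>x. D_op lam f x + D_op lam g x)"
proof
  fix x
  have "((\<lambda>x. f x + g x) has_vector_derivative vector_derivative f (at x) + vector_derivative g (at x)) (at x)"
    using assms by (intro has_vector_derivative_add smooth_on_has_vector_derivative(1))
      (auto simp: test_space_def)
  from vector_derivative_at[OF this]
  show "D_op lam (\<lambda>x. f x + g x) x = D_op lam f x + D_op lam g x"
    by (simp add: D_op_def algebra_simps)
qed

lemma D_op_cmult:
  assumes "f \<in> test_space lam l"
  shows "D_op lam (\<lambda>x. c * f x) = (\<lambda>x. c * D_op lam f x)"
proof
  fix x
  have "((\<lambda>x. c * f x) has_vector_derivative c * vector_derivative f (at x)) (at x)"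
    using assms by (intro has_vector_derivative_mult_right smooth_on_has_vector_derivative(1))
      (auto simp: test_space_def)
  from vector_derivative_at[OF this]
  show "D_op lam (\<lambda>x. c * f x) x = c * D_op lam f x"
    by (simp add: D_op_def algebra_simps)
qed

lemma D_op_funpow_add:
  assumes "f \<in> test_space lam l" "g \<in> test_space lam l"
  shows "(D_op lam ^^ j) (\<lambda>x. f x + g x) = (\<lambda>x. (D_op lam ^^ j) f x + (D_op lam ^^ j) g x)"
  by (induction j) (use assms in \<open>simp_all add: D_op_add[OF D_op_funpow_test_space D_op_funpow_test_space]\<close>)

lemma D_op_funpow_cmult:
  assumes "f \<in> test_space lam l"
  shows "(D_op lam ^^ j) (\<lambda>x. c * f x) = (\<lambda>x. c * (D_op lam ^^ j) f x)"
  by (induction j) (use assms in \<open>simp_all add: D_op_cmult[OF D_op_funpow_test_space]\<close>)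

text \<open>The weight is invariant under y = -1/x: 1 + x^2 = (1 + y^2) |y|^(-2), and the surplus
  power of |y| is the one in \<open>f_inf\<close>. So the part |x| > 1 of the line is folded onto a
  compact interval, where the extension \<open>h\<close> takes the place of
  \<open>f\<close>.\<close>

lemma test_space_weighted_bound:
  assumes "f \<in> test_space lam l"
  obtains B where "\<And>x. (1 + x\<^sup>2) powr Re lam * cmod (f x) \<le> B"
proof -
  obtain h where h: "smooth_ext_f_inf lam l f h" and f: "smooth_on UNIV f"
    using assms by (auto simp: test_space_def)
  have bd: "\<exists>B. \<forall>x\<in>{-1..1}. (1 + x\<^sup>2) powr Re lam * cmod (k x) \<le> B"
    if "smooth_on UNIV k" for k :: "real \<Rightarrow> complex"
  proof -
    have "continuous_on {-1..1} k"
      using smooth_on_imp_continuous_on[OF that] continuous_on_subset by blast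
    moreover have "1 + x\<^sup>2 \<noteq> 0" for x :: real
      using zero_le_power2[of x] by linarith
    ultimately have "continuous_on {-1..1} (\<lambda>x. (1 + x\<^sup>2) powr Re lam * cmod (k x))"
      by (intro continuous_intros) auto
    then have "compact ((\<lambda>x. (1 + x\<^sup>2) powr Re lam * cmod (k x)) ` {-1..1})"
      by (intro compact_continuous_image) auto
    then have "bdd_above ((\<lambda>x. (1 + x\<^sup>2) powr Re lam * cmod (k x)) ` {-1..1})"
      by (intro bounded_imp_bdd_above compact_imp_bounded)
    then show ?thesis by (auto simp: bdd_above_def)
  qed
  obtain B1 where B1: "\<forall>x\<in>{-1..1}. (1 + x\<^sup>2) powr Re lam * cmod (f x) \<le> B1"
    using bd[OF f] by blast
  obtain B2 where B2: "\<forall>x\<in>{-1..1}. (1 + x\<^sup>2) powr Re lam * cmod (h x) \<le> B2"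
    using bd[of h] h by (auto simp: smooth_ext_f_inf_def)
  have "(1 + x\<^sup>2) powr Re lam * cmod (f x) \<le> max B1 B2" for x
  proof (cases "\<bar>x\<bar> \<le> 1")
    case True
    then show ?thesis using B1 by (force simp: abs_le_iff)
  next
    case False
    define y where "y = -1/x"
    have y: "y \<noteq> 0" "x = -1/y" "y \<in> {-1..1}"
      using False by (auto simp: y_def field_simps abs_if split: if_splits)
    have "cmod (h y) = \<bar>y\<bar> powr (- 2 * Re lam) * cmod (f x)"
      using h y by (auto simp: smooth_ext_f_inf_def f_inf_def norm_mult norm_powr_real_powr norm_power_int)
    moreover have "(1 + x\<^sup>2) powr Re lam = (1 + y\<^sup>2) powr Re lam * \<bar>y\<bar> powr (- 2 * Re lam)"
    proof -
      have "1 + x\<^sup>2 = (1 + y\<^sup>2) * \<bar>y\<bar> powr (-2)"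
        using y by (simp add: powr_minus power2_eq_square field_simps)
      then have "(1 + x\<^sup>2) powr Re lam = (1 + y\<^sup>2) powr Re lam * (\<bar>y\<bar> powr (-2)) powr Re lam"
        by (simp add: powr_mult)
      then show ?thesis by (simp add: powr_powr)
    qed
    ultimately have "(1 + x\<^sup>2) powr Re lam * cmod (f x) = (1 + y\<^sup>2) powr Re lam * cmod (h y)"
      by simp
    then show ?thesis using B2 y(3) by (metis max.coboundedI2)
  qed
  then show ?thesis using that by blast
qed

text \<open>The expression whose supremum is \<open>seminorm\<close>. Estimates are kept pointwise,
  because a real \<open>SUP\<close> says nothing before boundedness is known.\<close>

definition weighted_jet :: "nat \<Rightarrow> complex \<Rightarrow> (real \<Rightarrow> complex) \<Rightarrow> real \<Rightarrow> real" where
  "weighted_jet M lam f x = (1 + x\<^sup>2) powr Re lam * (\<Sum>j\<le>M. cmod ((D_op lam ^^ j) f x))"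

lemma weighted_jet_bdd_above:
  assumes "f \<in> test_space lam l"
  shows "bdd_above (range (weighted_jet M lam f))"
proof -
  have "\<exists>B. \<forall>x. (1 + x\<^sup>2) powr Re lam * cmod ((D_op lam ^^ j) f x) \<le> B" for j
    using test_space_weighted_bound[OF D_op_funpow_test_space[OF assms]] by metis
  then obtain B where B: "\<And>j x. (1 + x\<^sup>2) powr Re lam * cmod ((D_op lam ^^ j) f x) \<le> B j"
    by metis
  then have "weighted_jet M lam f x \<le> (\<Sum>j\<le>M. B j)" for x
    by (simp add: weighted_jet_def sum_distrib_left sum_mono)
  then show ?thesis by (auto simp: bdd_above_def)
qed

lemma weighted_jet_mono: "M \<le> M' \<Longrightarrow> weighted_jet M lam f x \<le> weighted_jet M' lam f x"
  unfolding weighted_jet_def by (intro mult_left_mono sum_mono2) auto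

lemma weighted_jet_add:
  assumes "f \<in> test_space lam l" "g \<in> test_space lam l"
  shows "weighted_jet M lam (\<lambda>x. f x + g x) x \<le> weighted_jet M lam f x + weighted_jet M lam g x"
  unfolding weighted_jet_def D_op_funpow_add[OF assms] distrib_left[symmetric] sum.distrib[symmetric]
  by (intro mult_left_mono sum_mono norm_triangle_ineq) auto

lemma weighted_jet_cmult:
  assumes "f \<in> test_space lam l"
  shows "weighted_jet M lam (\<lambda>x. c * f x) x = cmod c * weighted_jet M lam f x"
  unfolding weighted_jet_def D_op_funpow_cmult[OF assms]
  by (simp add: norm_mult sum_distrib_left[symmetric])

section \<open>Continuity of a distribution as a bound by one seminorm\<close>

lemma seminorm_eq: "seminorm M lam f = (SUP x. weighted_jet M lam f x)"
  by (simp add: seminorm_def weighted_jet_def)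

lemma zero_in_test_space: "(\<lambda>x. 0) \<in> test_space lam l"
proof -
  have "smooth_ext_f_inf lam l (\<lambda>x. 0) (\<lambda>x. 0)"
    by (simp add: smooth_ext_f_inf_def f_inf_def smooth_on_const)
  then show ?thesis by (auto simp: test_space_def smooth_on_const)
qed

text \<open>The generating sets form only a subbasis and are centred at arbitrary \<open>f\<close>,
  so a ball about 0 is extracted by induction on the generation. Finite intersections take the
  larger \<open>M\<close> and the smaller \<open>r\<close>, as jets grow with
  \<open>M\<close>.\<close>

lemma test_topology_nhd_zero:
  assumes "openin (test_topology lam l) U" "(\<lambda>x. 0) \<in> U"
  shows "\<exists>M r. r > 0 \<and> (\<forall>g\<in>test_space lam l. (\<forall>x. weighted_jet M lam g x \<le> r) \<longrightarrow> g \<in> U)"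
proof -
  have "generate_topology_on {{g \<in> test_space lam l. seminorm M lam (\<lambda>x. g x - f x) < r} | f M r.
        f \<in> test_space lam l \<and> r > 0} U"
    using assms(1) by (simp add: test_topology_def openin_topology_generated_by_iff)
  then show ?thesis using assms(2)
  proof (induction rule: generate_topology_on.induct)
    case Empty
    then show ?case by simp
  next
    case (Int a b)
    obtain M r where Mr: "r > 0" "\<And>g. g\<in>test_space lam l \<Longrightarrow> (\<forall>x. weighted_jet M lam g x \<le> r) \<Longrightarrow> g \<in> a"
      using Int by blast
    obtain M' r' where Mr': "r' > 0" "\<And>g. g\<in>test_space lam l \<Longrightarrow> (\<forall>x. weighted_jet M' lam g x \<le> r') \<Longrightarrow> g \<in> b"
      using Int by blast
    have "g \<in> a \<inter> b" if "g \<in> test_space lam l" "\<forall>x. weighted_jet (max M M') lam g x \<le> min r r'" for g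
    proof
      show "g \<in> a" using that weighted_jet_mono[of M "max M M'" lam g]
        by (intro Mr) (auto intro: order_trans)
      show "g \<in> b" using that weighted_jet_mono[of M' "max M M'" lam g]
        by (intro Mr') (auto intro: order_trans)
    qed
    then show ?case using Mr(1) Mr'(1) by (intro exI[of _ "max M M'"] exI[of _ "min r r'"]) auto
  next
    case (UN K)
    then obtain k where k: "k \<in> K" "(\<lambda>x. 0) \<in> k" by blast
    from UN.IH[OF k] k(1) show ?case by blast
  next
    case (Basis s)
    then obtain f M r where s: "s = {g \<in> test_space lam l. seminorm M lam (\<lambda>x. g x - f x) < r}"
      and f: "f \<in> test_space lam l" by blast
    have nf: "(\<lambda>x. - f x) \<in> test_space lam l" using test_space_cmult[OF f, of "-1"] by simp
    \<comment> \<open>The ball of radius \<open>r\<close> about \<open>f\<close> contains 0, so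
      \<open>q\<close> < \<open>r\<close>. Giving \<open>g\<close> half of the slack
      \<open>r - q\<close> leaves room for the strict inequality.\<close>
    define q where "q = seminorm M lam (\<lambda>x. - f x)"
    have q: "q < r" using Basis.prems by (simp add: s q_def)
    have "g \<in> s" if g: "g \<in> test_space lam l" and b: "\<forall>x. weighted_jet M lam g x \<le> (r - q) / 2" for g
    proof -
      have "weighted_jet M lam (\<lambda>x. g x - f x) x \<le> (r - q) / 2 + q" for x
      proof -
        have "weighted_jet M lam (\<lambda>x. - f x) x \<le> q"
          unfolding q_def seminorm_eq by (intro cSUP_upper weighted_jet_bdd_above[OF nf]) auto
        moreover have "weighted_jet M lam (\<lambda>x. g x - f x) x \<le> weighted_jet M lam g x + weighted_jet M lam (\<lambda>x. - f x) x"
          using weighted_jet_add[OF g nf, of M x] by simp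
        ultimately show ?thesis using b[rule_format, of x] by linarith
      qed
      then have "seminorm M lam (\<lambda>x. g x - f x) \<le> (r - q) / 2 + q"
        unfolding seminorm_eq by (intro cSUP_least) auto
      with q have "seminorm M lam (\<lambda>x. g x - f x) < r" by (simp add: field_simps)
      then show ?thesis using g by (simp add: s)
    qed
    then show ?case using q by (intro exI[of _ M] exI[of _ "(r - q) / 2"]) auto
  qed
qed

lemma topspace_test_topology: "topspace (test_topology lam l) = test_space lam l"
proof -
  \<comment> \<open>A radius of the shape s + |s| + 1 is positive and exceeds s, so \<open>f\<close>
    lies in its own ball without any evaluation of the seminorm s of \<open>f - f\<close>.\<close>
  have "f \<in> {g \<in> test_space lam l. seminorm 0 lam (\<lambda>x. g x - f x) < seminorm 0 lam (\<lambda>x. f x - f x) + \<bar>seminorm 0 lam (\<lambda>x. f x - f x)\<bar> + 1}"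
    if "f \<in> test_space lam l" for f
    using that by simp
  moreover have "seminorm 0 lam (\<lambda>x. f x - f x) + \<bar>seminorm 0 lam (\<lambda>x. f x - f x)\<bar> + 1 > 0" for f
    by linarith
  ultimately show ?thesis
    unfolding test_topology_def topology_generated_by_topspace by blast
qed

text \<open>Continuity at 0 gives |T g| < 1 on a ball of jets at most \<open>r\<close>; scaling
  \<open>f\<close> by r/B places it in that ball, and homogeneity yields the constant 1/r.\<close>

lemma distribution_bound:
  assumes "distribution_on lam l T"
  shows "\<exists>M C. C \<ge> 0 \<and>
    (\<forall>f\<in>test_space lam l. \<forall>B. (\<forall>x. weighted_jet M lam f x \<le> B) \<longrightarrow> cmod (T f) \<le> C * B)"
proof -
  have scale: "T (\<lambda>x. a * f x) = a * T f" if "f \<in> test_space lam l" for a f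
    using assms that by (auto simp: distribution_on_def)
  have T0: "T (\<lambda>x. 0) = 0" using scale[OF zero_in_test_space, of 0] by simp
  define U where "U = {f \<in> test_space lam l. T f \<in> ball 0 1}"
  have "openin (test_topology lam l) U"
    using assms openin_continuous_map_preimage[of "test_topology lam l" euclidean T "ball 0 1"]
    by (auto simp: distribution_on_def U_def topspace_test_topology)
  moreover have "(\<lambda>x. 0) \<in> U" by (simp add: U_def T0 zero_in_test_space)
  ultimately obtain M r where r: "r > 0"
    and U: "\<And>g. g \<in> test_space lam l \<Longrightarrow> (\<forall>x. weighted_jet M lam g x \<le> r) \<Longrightarrow> g \<in> U"
    using test_topology_nhd_zero by meson
  have pos: "cmod (T f) \<le> 1 / r * B" if f: "f \<in> test_space lam l" and B: "\<And>x. weighted_jet M lam f x \<le> B"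
    and "B > 0" for f B
  proof -
    have "weighted_jet M lam (\<lambda>x. of_real (r / B) * f x) x \<le> r" for x
      unfolding weighted_jet_cmult[OF f] norm_of_real using r \<open>B > 0\<close> B[of x]
      by (simp add: field_simps)
    then have "(\<lambda>x. of_real (r / B) * f x) \<in> U" by (intro U test_space_cmult f) auto
    then have "cmod (T (\<lambda>x. of_real (r / B) * f x)) < 1" by (simp add: U_def)
    then show ?thesis unfolding scale[OF f] norm_mult norm_of_real using r \<open>B > 0\<close>
      by (simp add: field_simps)
  qed
  show ?thesis
  proof (intro exI[of _ M] exI[of _ "1 / r"] conjI ballI allI impI)
    show "1 / r \<ge> 0" using r by simp
    fix f B assume f: "f \<in> test_space lam l" and "\<forall>x. weighted_jet M lam f x \<le> B"
    then have B: "weighted_jet M lam f x \<le> B" for x by blast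
    have "0 \<le> weighted_jet M lam f 0" unfolding weighted_jet_def by (simp add: sum_nonneg)
    with B[of 0] have "B \<ge> 0" by linarith
    \<comment> \<open>\<open>B\<close> may be 0, which forbids the scaling by r/B. The estimate is
      therefore applied to the positive bound \<open>B + r * e\<close> for every
      \<open>e > 0\<close>.\<close>
    show "cmod (T f) \<le> 1 / r * B"
    proof (rule field_le_epsilon)
      fix e :: real assume "e > 0"
      have "cmod (T f) \<le> 1 / r * (B + r * e)"
        using B \<open>B \<ge> 0\<close> r \<open>e > 0\<close> by (intro pos f) (auto intro: order_trans[OF B] add_nonneg_pos)
      then show "cmod (T f) \<le> 1 / r * B + e" using r by (simp add: field_simps)
    qed
  qed
qed

section \<open>Mixed derivatives of the kernel\<close>

lemma has_derivative_complex_powr: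
  fixes f :: "'a::real_normed_vector \<Rightarrow> complex"
  assumes "(f has_derivative f') (at x)" "f x \<notin> \<real>\<^sub>\<le>\<^sub>0"
  shows "((\<lambda>x. f x powr s) has_derivative (\<lambda>h. s * f x powr (s - 1) * f' h)) (at x)"
  using has_derivative_compose[OF assms(1), of "\<lambda>w. w powr s" "\<lambda>h. s * f x powr (s - 1) * h"]
    has_field_derivative_powr[OF assms(2), of s]
  by (simp add: has_field_derivative_def)

lemma has_vector_derivative_complex_powr:
  fixes f :: "real \<Rightarrow> complex"
  assumes "(f has_vector_derivative f') (at x)" "f x \<notin> \<real>\<^sub>\<le>\<^sub>0"
  shows "((\<lambda>x. f x powr s) has_vector_derivative s * f x powr (s - 1) * f') (at x)"
  using has_derivative_complex_powr[of f "\<lambda>h. h *\<^sub>R f'" x s] assms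
  by (simp add: has_vector_derivative_def)

lemma not_nonpos_Reals_if_Im: "Im w \<noteq> 0 \<Longrightarrow> w \<notin> \<real>\<^sub>\<le>\<^sub>0"
  by (auto simp: complex_nonpos_Reals_iff)

text \<open>The derivative $\partial_z^p\partial_{\bar z}^q$ of $(z-u)^{-a}(\bar z-u)^{-b}$.\<close>

definition mixed_kernel :: "complex \<Rightarrow> complex \<Rightarrow> nat \<Rightarrow> nat \<Rightarrow> complex \<Rightarrow> real \<Rightarrow> complex" where
  "mixed_kernel a b p q z u = (-1) ^ (p + q) * pochhammer a p * pochhammer b q *
     ((z - of_real u) powr (- (a + of_nat p)) * (cnj z - of_real u) powr (- (b + of_nat q)))"

lemma mixed_kernel_Suc:
  "mixed_kernel a b (Suc p) q z u = - (a + of_nat p) * ((-1) ^ (p + q) * pochhammer a p * pochhammer b q *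
     ((z - of_real u) powr (- (a + of_nat p) - 1) * (cnj z - of_real u) powr (- (b + of_nat q))))"
  "mixed_kernel a b p (Suc q) z u = - (b + of_nat q) * ((-1) ^ (p + q) * pochhammer a p * pochhammer b q *
     ((z - of_real u) powr (- (a + of_nat p)) * (cnj z - of_real u) powr (- (b + of_nat q) - 1)))"
proof -
  have e: "- (s + of_nat (Suc n)) = - (s + of_nat n) - 1" for s :: complex and n by simp
  show "mixed_kernel a b (Suc p) q z u = - (a + of_nat p) * ((-1) ^ (p + q) * pochhammer a p * pochhammer b q *
     ((z - of_real u) powr (- (a + of_nat p) - 1) * (cnj z - of_real u) powr (- (b + of_nat q))))"
    unfolding mixed_kernel_def pochhammer_Suc e add_Suc power_Suc by (simp only: mult_ac minus_mult_left[symmetric] mult_minus_right mult_1_left)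
  show "mixed_kernel a b p (Suc q) z u = - (b + of_nat q) * ((-1) ^ (p + q) * pochhammer a p * pochhammer b q *
     ((z - of_real u) powr (- (a + of_nat p)) * (cnj z - of_real u) powr (- (b + of_nat q) - 1)))"
    unfolding mixed_kernel_def pochhammer_Suc e add_Suc_right power_Suc by (simp only: mult_ac minus_mult_left[symmetric] mult_minus_right mult_1_left)
qed

text \<open>A factor z - u or conj z - u undoes one derivative. This rule eliminates
  \<open>u\<close> from coefficients, and it is also the source of the differential equation for the
  kernel.\<close>

lemma mixed_kernel_shift:
  assumes "Im z \<noteq> 0"
  shows "(z - of_real u) * mixed_kernel a b (Suc p) q z u = - (a + of_nat p) * mixed_kernel a b p q z u"
    and "(cnj z - of_real u) * mixed_kernel a b p (Suc q) z u = - (b + of_nat q) * mixed_kernel a b p q z u"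
proof -
  have w: "z - of_real u \<noteq> 0" "cnj z - of_real u \<noteq> 0" using assms by (auto simp: complex_eq_iff)
  show "(z - of_real u) * mixed_kernel a b (Suc p) q z u = - (a + of_nat p) * mixed_kernel a b p q z u"
    unfolding mixed_kernel_Suc unfolding mixed_kernel_def powr_diff using w(1) by simp
  show "(cnj z - of_real u) * mixed_kernel a b p (Suc q) z u = - (b + of_nat q) * mixed_kernel a b p q z u"
    unfolding mixed_kernel_Suc unfolding mixed_kernel_def powr_diff using w(2) by simp
qed

lemma mixed_kernel_has_derivative:
  assumes "Im z \<noteq> 0"
  shows "((\<lambda>z. mixed_kernel a b p q z u) has_derivative
     (\<lambda>h. mixed_kernel a b (Suc p) q z u * h + mixed_kernel a b p (Suc q) z u * cnj h)) (at z)"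
proof -
  define A where "A = - (a + of_nat p)"
  define B where "B = - (b + of_nat q)"
  define c where "c = (-1) ^ (p + q) * pochhammer a p * pochhammer b q"
  let ?w = "z - of_real u" and ?v = "cnj z - of_real u"
  have "((\<lambda>z. z - of_real u) has_derivative (\<lambda>h. h)) (at z)"
    by (auto intro!: derivative_eq_intros)
  then have 1: "((\<lambda>z. (z - of_real u) powr A) has_derivative (\<lambda>h. A * ?w powr (A - 1) * h)) (at z)"
    by (rule has_derivative_complex_powr) (use assms in \<open>simp add: not_nonpos_Reals_if_Im\<close>)
  have "((\<lambda>z. cnj z - of_real u) has_derivative (\<lambda>h. cnj h)) (at z)"
    by (auto intro!: derivative_eq_intros)
  then have 2: "((\<lambda>z. (cnj z - of_real u) powr B) has_derivative (\<lambda>h. B * ?v powr (B - 1) * cnj h)) (at z)"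
    by (rule has_derivative_complex_powr) (use assms in \<open>simp add: not_nonpos_Reals_if_Im\<close>)
  have "((\<lambda>z. c * ((z - of_real u) powr A * (cnj z - of_real u) powr B)) has_derivative
     (\<lambda>h. c * (?w powr A * (B * ?v powr (B - 1) * cnj h) + A * ?w powr (A - 1) * h * ?v powr B))) (at z)"
    by (intro has_derivative_mult_right has_derivative_mult 1 2)
  moreover have "mixed_kernel a b (Suc p) q z u = c * A * ?w powr (A - 1) * ?v powr B"
    "mixed_kernel a b p (Suc q) z u = c * B * ?w powr A * ?v powr (B - 1)"
    unfolding mixed_kernel_Suc c_def A_def B_def by (simp_all only: mult_ac)
  ultimately show ?thesis
    unfolding mixed_kernel_def c_def[symmetric] A_def[symmetric] B_def[symmetric]
    by (simp add: algebra_simps)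
qed

text \<open>The kernel depends on z - u and its conjugate only, so d/du is minus the sum of the two
  Wirtinger derivatives.\<close>

lemma mixed_kernel_has_vector_derivative:
  assumes "Im z \<noteq> 0"
  shows "(mixed_kernel a b p q z has_vector_derivative
     - (mixed_kernel a b (Suc p) q z u + mixed_kernel a b p (Suc q) z u)) (at u)"
proof -
  have eq: "mixed_kernel a b p q z = (\<lambda>u. mixed_kernel a b p q (z - of_real u) 0)"
    by (auto simp: mixed_kernel_def)
  have eq': "mixed_kernel a b r s z u = mixed_kernel a b r s (z - of_real u) 0" for r s
    by (auto simp: mixed_kernel_def)
  have "((\<lambda>u. z - of_real u) has_derivative (\<lambda>h. - of_real h)) (at u)"
    by (auto intro!: derivative_eq_intros)
  from has_derivative_compose[OF this mixed_kernel_has_derivative]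
  show ?thesis unfolding has_vector_derivative_def eq eq'
    using assms by (simp add: scaleR_conv_of_real algebra_simps)
qed

text \<open>For p = q = 0 this is minus the infinitesimal rotation (1+z^2) d/dz + a z plus its
  conjugate counterpart with b. The other terms are what the Leibniz rule produces when p
  derivatives in z pass it: 2 p z from the first derivative of 1 + z^2, p (p-1) from its second
  derivative, and p a from the derivative of a z.\<close>

lemma D_op_mixed_kernel:
  assumes "Im z \<noteq> 0" "a + b = 2 * lam"
  shows "D_op lam (mixed_kernel a b p q z) u =
      - (1 + z\<^sup>2) * mixed_kernel a b (Suc p) q z u - (1 + (cnj z)\<^sup>2) * mixed_kernel a b p (Suc q) z u
      - ((a + 2 * of_nat p) * z + (b + 2 * of_nat q) * cnj z) * mixed_kernel a b p q z u
      - of_nat p * (a + of_nat p - 1) * mixed_kernel a b (p - 1) q z u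
      - of_nat q * (b + of_nat q - 1) * mixed_kernel a b p (q - 1) z u"
proof -
  define w where "w = z - of_real u"
  define v where "v = cnj z - of_real u"
  define X where "X = mixed_kernel a b p q z u"
  define X1 where "X1 = mixed_kernel a b (Suc p) q z u"
  define X2 where "X2 = mixed_kernel a b p (Suc q) z u"
  define Y1 where "Y1 = mixed_kernel a b (p - 1) q z u"
  define Y2 where "Y2 = mixed_kernel a b p (q - 1) z u"
  have 1: "w * X1 = - (a + of_nat p) * X" "v * X2 = - (b + of_nat q) * X"
    using mixed_kernel_shift[OF assms(1)] by (auto simp: w_def v_def X_def X1_def X2_def)
  \<comment> \<open>At p = 0 the truncated index \<open>p - 1\<close> is meaningless, but the factor
    p removes the term.\<close>
  have 2: "of_nat p * (a + of_nat p - 1) * Y1 = - of_nat p * (w * X)"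
  proof (cases p)
    case (Suc n)
    have "(a + of_nat p - 1) * Y1 = - (w * X)"
      unfolding w_def X_def Y1_def Suc mixed_kernel_shift(1)[OF assms(1)] diff_Suc_1 by (simp add: algebra_simps)
    then show ?thesis by (simp only: mult.assoc) simp
  qed simp
  have 3: "of_nat q * (b + of_nat q - 1) * Y2 = - of_nat q * (v * X)"
  proof (cases q)
    case (Suc n)
    have "(b + of_nat q - 1) * Y2 = - (v * X)"
      unfolding v_def X_def Y2_def Suc mixed_kernel_shift(2)[OF assms(1)] diff_Suc_1 by (simp add: algebra_simps)
    then show ?thesis by (simp only: mult.assoc) simp
  qed simp
  \<comment> \<open>Expansion of 1 + u^2 about z with u = z - w; every factor w is then absorbed
    into a derivative by the shift rule.\<close>
  have 4: "(1 + (of_real u)\<^sup>2) * X1 = (1 + z\<^sup>2) * X1 - 2 * z * (w * X1) + w * (w * X1)"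
    by (simp add: w_def algebra_simps power2_eq_square)
  have 5: "(1 + (of_real u)\<^sup>2) * X2 = (1 + (cnj z)\<^sup>2) * X2 - 2 * cnj z * (v * X2) + v * (v * X2)"
    by (simp add: v_def algebra_simps power2_eq_square)
  have 6: "2 * lam * of_real u * X = a * (z - w) * X + b * (cnj z - v) * X"
    unfolding assms(2)[symmetric] w_def v_def by (simp add: algebra_simps)
  have "D_op lam (mixed_kernel a b p q z) u = - ((1 + (of_real u)\<^sup>2) * X1) - (1 + (of_real u)\<^sup>2) * X2 + 2 * lam * of_real u * X"
    unfolding D_op_def X_def X1_def X2_def vector_derivative_at[OF mixed_kernel_has_vector_derivative[OF assms(1)]]
    by (simp add: algebra_simps)
  also have "\<dots> = - (1 + z\<^sup>2) * X1 - (1 + (cnj z)\<^sup>2) * X2 - ((a + 2 * of_nat p) * z + (b + 2 * of_nat q) * cnj z) * X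
      - of_nat p * (a + of_nat p - 1) * Y1 - of_nat q * (b + of_nat q - 1) * Y2"
    unfolding 2 3 4 5 6 1 by (simp add: algebra_simps)
  finally show ?thesis unfolding X_def X1_def X2_def Y1_def Y2_def .
qed

section \<open>The kernel as a test function: smoothness and behaviour at infinity\<close>

lemma smooth_on_mixed_kernel:
  assumes "Im z \<noteq> 0"
  shows "smooth_on UNIV (mixed_kernel a b p q z)"
proof (rule smooth_on_UNIV_lincomb[where B = "{mixed_kernel a b p q z | p q. True}"])
  fix f assume "f \<in> {mixed_kernel a b p q z | p q. True}"
  then obtain p q where f: "f = mixed_kernel a b p q z" by auto
  show "\<exists>g. (\<forall>x. (f has_vector_derivative g x) (at x)) \<and> lincomb {mixed_kernel a b p q z | p q. True} g"
  proof (intro exI conjI allI)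
    show "(f has_vector_derivative (-1) * (mixed_kernel a b (Suc p) q z u + mixed_kernel a b p (Suc q) z u)) (at u)" for u
      using mixed_kernel_has_vector_derivative[OF assms, of a b p q u] by (simp add: f)
    show "lincomb {mixed_kernel a b p q z | p q. True}
        (\<lambda>u. (-1) * (mixed_kernel a b (Suc p) q z u + mixed_kernel a b p (Suc q) z u))"
      by (intro lincomb_scale lincomb_add lincomb_base) blast+
  qed
qed (auto intro: lincomb_base)

text \<open>For nonreal z the number z x + 1 is real only at x = 0, where it equals 1. Neither base
  meets the branch cut, so the principal powers are smooth across 0.\<close>

lemma smooth_on_power_powr_powr:
  assumes "Im z \<noteq> 0"
  shows "smooth_on UNIV (\<lambda>x. of_real x ^ n * ((z * of_real x + 1) powr s * (cnj z * of_real x + 1) powr t))"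
proof -
  define g where "g = (\<lambda>n s t x. complex_of_real x ^ n * ((z * of_real x + 1) powr s * (cnj z * of_real x + 1) powr t))"
  let ?B = "{g n s t | n s t. True}"
  have nz: "w * of_real x + 1 \<notin> \<real>\<^sub>\<le>\<^sub>0" if "Im w \<noteq> 0" for x w
    using that by (cases "x = 0") (auto simp: complex_nonpos_Reals_iff)
  have lin: "((\<lambda>x. w * complex_of_real x + 1) has_vector_derivative w) (at x)" for x w
    unfolding has_vector_derivative_def by (auto intro!: derivative_eq_intros simp: scaleR_conv_of_real)
  have pw: "((\<lambda>x. complex_of_real x ^ n) has_vector_derivative of_nat n * of_real x ^ (n - 1)) (at x)" for x n
    unfolding has_vector_derivative_def by (auto intro!: derivative_eq_intros simp: scaleR_conv_of_real)
  have "smooth_on UNIV (g n s t)"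
  proof (rule smooth_on_UNIV_lincomb[where B = ?B])
    fix f assume "f \<in> ?B"
    then obtain n s t where f: "f = g n s t" by auto
    show "\<exists>h. (\<forall>x. (f has_vector_derivative h x) (at x)) \<and> lincomb ?B h"
    proof (intro exI conjI allI)
      show "(f has_vector_derivative ((t * cnj z) * g n s (t - 1) x + (s * z) * g n (s - 1) t x)
               + of_nat n * g (n - 1) s t x) (at x)" for x
        unfolding f g_def
        by (rule has_vector_derivative_eq_rhs[OF has_vector_derivative_mult[OF pw has_vector_derivative_mult[OF
              has_vector_derivative_complex_powr[OF lin nz] has_vector_derivative_complex_powr[OF lin nz]]]])
          (use assms in \<open>simp_all add: algebra_simps\<close>)
      show "lincomb ?B (\<lambda>x. ((t * cnj z) * g n s (t - 1) x + (s * z) * g n (s - 1) t x)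
               + of_nat n * g (n - 1) s t x)"
        by (intro lincomb_scale lincomb_add lincomb_base) blast+
    qed
  qed (auto intro: lincomb_base)
  then show ?thesis by (simp add: g_def)
qed

text \<open>The smooth extension of \<open>f_inf\<close> for the kernel: substituting u = -1/x turns
  z - u into (z x + 1)/x, and the powers of x are collected in front.\<close>

definition mixed_kernel_inf :: "complex \<Rightarrow> complex \<Rightarrow> nat \<Rightarrow> nat \<Rightarrow> complex \<Rightarrow> real \<Rightarrow> complex" where
  "mixed_kernel_inf a b p q z x = ((-1) ^ (p + q) * pochhammer a p * pochhammer b q) *
     (of_real x ^ (p + q) *
      ((z * of_real x + 1) powr (- (a + of_nat p)) * (cnj z * of_real x + 1) powr (- (b + of_nat q))))"

lemma powr_uminus_lower: "Im v < 0 \<Longrightarrow> (- v) powr s = v powr s * exp (\<i> * of_real pi * s)"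
  by (auto simp: powr_def Ln_minus algebra_simps exp_add)

lemma powr_uminus_upper: "Im v > 0 \<Longrightarrow> (- v) powr s = v powr s * exp (- (\<i> * of_real pi * s))"
  by (auto simp: powr_def Ln_minus algebra_simps exp_diff exp_minus field_simps)

lemma exp_neg_half_pi_i: "exp (- (\<i> * of_real pi * (of_int l / 2))) = (- \<i>) powi l"
proof -
  have "exp (- (\<i> * of_real pi / 2)) = - \<i>"
    by (simp add: exp_eq_polar[symmetric] complex_eq_iff Re_exp Im_exp)
  then show ?thesis using exp_power_int[of "- (\<i> * of_real pi / 2)" l] by (simp add: algebra_simps)
qed

lemma f_inf_mixed_kernel:
  assumes z: "Im z > 0" and "x \<noteq> 0"
    and a_def: "a = lam + of_int l / 4" and b_def: "b = lam - of_int l / 4"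
  shows "f_inf lam l (mixed_kernel a b p q z) x = mixed_kernel_inf a b p q z x"
proof -
  define A where "A = - (a + of_nat p)"
  define B where "B = - (b + of_nat q)"
  define v where "v = z * of_real x + 1"
  define c where "c = (-1) ^ (p + q) * pochhammer a p * pochhammer b q"
  define r where "r = complex_of_real \<bar>x\<bar>"
  have cv: "cnj v = cnj z * of_real x + 1" by (simp add: v_def)
  have r0: "r \<noteq> 0" "r \<in> \<real>" "Re r \<ge> 0" "inverse r \<in> \<real>" "Re (inverse r) \<ge> 0" "r \<notin> \<real>\<^sub>\<le>\<^sub>0"
    using \<open>x \<noteq> 0\<close> by (auto simp: r_def complex_nonpos_Reals_iff simp flip: of_real_inverse)
  \<comment> \<open>The power of |x| from \<open>f_inf\<close> cancels the part 2 lam of these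
    exponents, so only the natural exponent p + q survives.\<close>
  have AB: "- A - B = 2 * lam + of_nat (p + q)" by (simp add: A_def B_def a_def b_def)
  have inv: "inverse r powr s = r powr (- s)" for s
    using r0 by (simp add: powr_def Ln_inverse)
  have rp: "r powr (- 2 * lam) * (inverse r powr A * inverse r powr B) = r ^ (p + q)"
  proof -
    have "r powr (- 2 * lam) * (inverse r powr A * inverse r powr B) = r powr (- 2 * lam + (- A - B))"
      unfolding inv by (simp add: powr_add powr_diff powr_minus field_simps)
    also have "\<dots> = r powr of_nat (p + q)" unfolding AB by simp
    also have "\<dots> = r ^ (p + q)" using r0(1) by (simp only: powr_nat if_False)
    finally show ?thesis .
  qed
  show ?thesis
  proof (cases "x > 0")
    case True
    then have w: "z - of_real (-1/x) = inverse r * v" "cnj z - of_real (-1/x) = inverse r * cnj v"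
      by (auto simp: r_def v_def field_simps)
    have "f_inf lam l (mixed_kernel a b p q z) x
        = r powr (- 2 * lam) * (c * ((inverse r * v) powr A * (inverse r * cnj v) powr B))"
      unfolding f_inf_def mixed_kernel_def A_def[symmetric] B_def[symmetric] c_def[symmetric] w r_def[symmetric]
      using True by simp
    also have "\<dots> = c * (r powr (- 2 * lam) * (inverse r powr A * inverse r powr B)) * (v powr A * cnj v powr B)"
      unfolding powr_times_real_left[OF r0(4,5)] by simp
    also have "\<dots> = mixed_kernel_inf a b p q z x"
      unfolding rp mixed_kernel_inf_def A_def[symmetric] B_def[symmetric] c_def[symmetric] v_def[symmetric]
        cv[symmetric] using True by (simp add: r_def)
    finally show ?thesis .
  next
    case False
    then have "x < 0" using \<open>x \<noteq> 0\<close> by simp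
    then have w: "z - of_real (-1/x) = inverse r * (- v)" "cnj z - of_real (-1/x) = inverse r * (- cnj v)"
      by (auto simp: r_def v_def field_simps)
    have vi: "Im v < 0" "Im (cnj v) > 0" using \<open>x < 0\<close> z by (auto simp: v_def mult_pos_neg)
    have AmB: "A - B = - (of_int l / 2) - of_nat p + of_nat q"
      by (simp add: A_def B_def a_def b_def)
    have AB': "\<i> * of_real pi * (A - B) =
       - (\<i> * of_real pi * (of_int l / 2)) - of_nat p * (\<i> * of_real pi) + of_nat q * (\<i> * of_real pi)"
      unfolding AmB by (simp add: algebra_simps)
    \<comment> \<open>For x < 0 the passage from -v to v costs phases of opposite orientation for v
      and conj v, so only A - B enters. Its part -l/2 gives (-i)^l, which cancels the factor i^l of
      \<open>f_inf\<close>; the integral part gives the sign that turns |x|^(p+q) into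
      x^(p+q).\<close>
    have "exp (\<i> * of_real pi * A) * exp (- (\<i> * of_real pi * B)) = exp (\<i> * of_real pi * (A - B))"
      by (simp add: mult_exp_exp right_diff_distrib)
    also have "\<dots> =
       exp (- (\<i> * of_real pi * (of_int l / 2)) - of_nat p * (\<i> * of_real pi) + of_nat q * (\<i> * of_real pi))"
      unfolding AB' ..
    also have "\<dots> = (- \<i>) powi l * (-1) ^ (p + q)"
      unfolding exp_add exp_diff exp_neg_half_pi_i exp_of_nat_mult exp_pi_i' by (simp add: minus_one_power_iff)
    finally have e: "exp (\<i> * of_real pi * A) * exp (- (\<i> * of_real pi * B)) = (- \<i>) powi l * (-1) ^ (p + q)" .
    have ii: "\<i> powi l * (- \<i>) powi l = 1" by (simp flip: power_int_mult_distrib)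
    have "f_inf lam l (mixed_kernel a b p q z) x
        = \<i> powi l * r powr (- 2 * lam) * (c * ((inverse r * (- v)) powr A * (inverse r * (- cnj v)) powr B))"
      unfolding f_inf_def mixed_kernel_def A_def[symmetric] B_def[symmetric] c_def[symmetric] w r_def[symmetric]
      using False by simp
    also have "\<dots> = \<i> powi l * c * (r powr (- 2 * lam) * (inverse r powr A * inverse r powr B)) * (v powr A * cnj v powr B)
         * (exp (\<i> * of_real pi * A) * exp (- (\<i> * of_real pi * B)))"
      unfolding powr_times_real_left[OF r0(4,5)] powr_uminus_lower[OF vi(1)] powr_uminus_upper[OF vi(2)] by (simp only: mult_ac)
    also have "\<dots> = (\<i> powi l * (- \<i>) powi l) * (c * ((-1) ^ (p + q) * r ^ (p + q)) * (v powr A * cnj v powr B))"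
      unfolding rp e by (simp only: mult_ac)
    also have "\<dots> = c * ((-1) ^ (p + q) * r ^ (p + q)) * (v powr A * cnj v powr B)"
      unfolding ii by simp
    also have "(-1) ^ (p + q) * r ^ (p + q) = of_real x ^ (p + q)"
      unfolding power_mult_distrib[symmetric] using \<open>x < 0\<close> by (simp add: r_def)
    also have "c * of_real x ^ (p + q) * (v powr A * cnj v powr B) = mixed_kernel_inf a b p q z x"
      unfolding mixed_kernel_inf_def A_def[symmetric] B_def[symmetric] c_def[symmetric] v_def[symmetric]
        cv[symmetric] by simp
    finally show ?thesis .
  qed
qed

lemma smooth_ext_mixed_kernel:
  assumes "Im z > 0"
  shows "smooth_ext_f_inf lam l (mixed_kernel (lam + of_int l / 4) (lam - of_int l / 4) p q z)
     (mixed_kernel_inf (lam + of_int l / 4) (lam - of_int l / 4) p q z)"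
  unfolding smooth_ext_f_inf_def
proof (intro conjI allI impI)
  show "smooth_on UNIV (mixed_kernel_inf (lam + of_int l / 4) (lam - of_int l / 4) p q z)"
    unfolding mixed_kernel_inf_def using assms
    by (intro smooth_on_mult[OF smooth_on_const] smooth_on_power_powr_powr) simp
qed (simp add: f_inf_mixed_kernel[OF assms])

lemma mixed_kernel_test_space:
  assumes "Im z > 0"
  shows "mixed_kernel (lam + of_int l / 4) (lam - of_int l / 4) p q z \<in> test_space lam l"
  using smooth_ext_mixed_kernel[OF assms] smooth_on_mixed_kernel assms
  by (fastforce simp: test_space_def)

section \<open>Estimates for the kernel\<close>

text \<open>The recursion expresses \<open>D_op\<close> through the operators $\partial_z$, $\partial_{\bar z}$; its coefficients
  do not involve the variable \<open>u\<close>.\<close>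

primrec mixed_kernel_D :: "complex \<Rightarrow> complex \<Rightarrow> nat \<Rightarrow> nat \<Rightarrow> nat \<Rightarrow> complex \<Rightarrow> real \<Rightarrow> complex" where
  "mixed_kernel_D a b 0 p q z u = mixed_kernel a b p q z u"
| "mixed_kernel_D a b (Suc j) p q z u =
      - (1 + z\<^sup>2) * mixed_kernel_D a b j (Suc p) q z u - (1 + (cnj z)\<^sup>2) * mixed_kernel_D a b j p (Suc q) z u
      - ((a + 2 * of_nat p) * z + (b + 2 * of_nat q) * cnj z) * mixed_kernel_D a b j p q z u
      - of_nat p * (a + of_nat p - 1) * mixed_kernel_D a b j (p - 1) q z u
      - of_nat q * (b + of_nat q - 1) * mixed_kernel_D a b j p (q - 1) z u"

lemma D_op_funpow_mixed_kernel:
  assumes "Im z > 0" and ab: "a = lam + of_int l / 4" "b = lam - of_int l / 4"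
  shows "(D_op lam ^^ j) (mixed_kernel a b p q z) = mixed_kernel_D a b j p q z"
proof (induction j arbitrary: p q)
  case 0
  then show ?case by auto
next
  case (Suc j)
  note mem = mixed_kernel_test_space[OF assms(1), of lam l, folded ab]
  have "D_op lam (mixed_kernel a b p q z) = (\<lambda>u.
      (- (1 + z\<^sup>2)) * mixed_kernel a b (Suc p) q z u + ((- (1 + (cnj z)\<^sup>2)) * mixed_kernel a b p (Suc q) z u
      + ((- ((a + 2 * of_nat p) * z + (b + 2 * of_nat q) * cnj z)) * mixed_kernel a b p q z u
      + ((- (of_nat p * (a + of_nat p - 1))) * mixed_kernel a b (p - 1) q z u
      + (- (of_nat q * (b + of_nat q - 1))) * mixed_kernel a b p (q - 1) z u))))"
    (is "_ = ?S")
  proof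
    have "a + b = 2 * lam" by (simp add: ab)
    then show "D_op lam (mixed_kernel a b p q z) u = ?S u" for u
      using D_op_mixed_kernel[of z a b lam p q u] assms(1) by (simp add: algebra_simps)
  qed
  \<comment> \<open>The innermost \<open>D_op\<close> is expanded first: its coefficients are
    constant in \<open>u\<close>, so the remaining \<open>j\<close> copies act on the kernels
    alone.\<close>
  then have "(D_op lam ^^ Suc j) (mixed_kernel a b p q z) = (D_op lam ^^ j) (\<lambda>u.
      (- (1 + z\<^sup>2)) * mixed_kernel a b (Suc p) q z u + ((- (1 + (cnj z)\<^sup>2)) * mixed_kernel a b p (Suc q) z u
      + ((- ((a + 2 * of_nat p) * z + (b + 2 * of_nat q) * cnj z)) * mixed_kernel a b p q z u
      + ((- (of_nat p * (a + of_nat p - 1))) * mixed_kernel a b (p - 1) q z u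
      + (- (of_nat q * (b + of_nat q - 1))) * mixed_kernel a b p (q - 1) z u))))"
    by (simp only: funpow_Suc_right o_apply)
  also have "\<dots> = mixed_kernel_D a b (Suc j) p q z"
    by (simp only: D_op_funpow_add[where l = l] D_op_funpow_cmult[where l = l] test_space_add
        test_space_cmult mem Suc.IH) (auto simp: algebra_simps)
  finally show ?case .
qed

text \<open>Differentiation in \<open>z\<close> commutes with \<open>D_op\<close> in
  \<open>u\<close>, so the iterates obey the same derivative rule as the kernel. In the recursion,
  the derivatives of the coefficients supply exactly the increments from p to p + 1 and from q to q
  + 1.\<close>

lemma mixed_kernel_D_has_derivative:
  assumes "Im z \<noteq> 0"
  shows "((\<lambda>z. mixed_kernel_D a b j p q z u) has_derivative
     (\<lambda>h. mixed_kernel_D a b j (Suc p) q z u * h + mixed_kernel_D a b j p (Suc q) z u * cnj h)) (at z)"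
proof (induction j arbitrary: p q)
  case 0
  then show ?case using mixed_kernel_has_derivative[OF assms] by simp
next
  case (Suc j)
  \<comment> \<open>The next fact repairs \<open>Suc (p - 1)\<close>, which differs from
    \<open>p\<close> only where the factor \<open>p\<close> vanishes; likewise for
    \<open>q\<close>.\<close>
  let ?X = "\<lambda>p q. mixed_kernel_D a b j p q z u"
  have pm: "of_nat p * ?X (Suc (p - Suc 0)) q = of_nat p * ?X p q"
    "of_nat q * ?X p (Suc (q - Suc 0)) = of_nat q * ?X p q"
    by (cases p; simp; fail) (cases q; simp; fail)
  show ?case unfolding mixed_kernel_D.simps(2)
    by (rule has_derivative_eq_rhs, (rule derivative_eq_intros Suc.IH refl)+, rule ext)
      (simp add: algebra_simps power2_eq_square pm)
qed

text \<open>One number, at least 1, that dominates |z|, 1 + |z|^2 and 1 / Im z, so that all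
  estimates become powers of a single quantity. The factor 2 accommodates the comparison of 1 + u^2
  with |z - u|^2 in both directions.\<close>

definition uhp_height :: "complex \<Rightarrow> real" where
  "uhp_height z = 2 * (1 + (cmod z)\<^sup>2) * (1 + 1 / (Im z)\<^sup>2)"

lemma uhp_height_bounds:
  assumes "Im z > 0"
  shows "1 \<le> uhp_height z" "cmod z \<le> uhp_height z" "1 + (cmod z)\<^sup>2 \<le> uhp_height z" "1 / Im z \<le> uhp_height z"
    "2 * (1 + (cmod z)\<^sup>2) \<le> uhp_height z"
    "2 + (1 + 2 * (cmod z)\<^sup>2) / (Im z)\<^sup>2 \<le> uhp_height z"
proof -
  define s where "s = (cmod z)\<^sup>2"
  define t where "t = 1 / (Im z)\<^sup>2"
  have st: "s \<ge> 0" "t \<ge> 0" "s * t \<ge> 0" by (auto simp: s_def t_def)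
  have R: "uhp_height z = 2 + 2 * s + 2 * t + 2 * (s * t)"
    by (simp add: uhp_height_def s_def t_def algebra_simps)
  have c: "cmod z \<le> 1 + s" "1 / Im z \<le> 1 + t"
  proof -
    have *: "x \<le> 1 + x\<^sup>2" for x :: real
      using zero_le_power2[of "2 * x - 1"] by (simp add: power2_eq_square algebra_simps)
    show "cmod z \<le> 1 + s" "1 / Im z \<le> 1 + t"
      using *[of "cmod z"] *[of "1 / Im z"] by (auto simp: s_def t_def power_divide)
  qed
  show "1 \<le> uhp_height z" "cmod z \<le> uhp_height z" "1 + (cmod z)\<^sup>2 \<le> uhp_height z" "1 / Im z \<le> uhp_height z"
    using st c unfolding R s_def[symmetric] by linarith+
  show "2 * (1 + (cmod z)\<^sup>2) \<le> uhp_height z"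
    using st unfolding R s_def[symmetric] by (simp add: distrib_left)
  have "(1 + 2 * (cmod z)\<^sup>2) / (Im z)\<^sup>2 = t + 2 * (s * t)"
    by (simp add: s_def t_def add_divide_distrib)
  then show "2 + (1 + 2 * (cmod z)\<^sup>2) / (Im z)\<^sup>2 \<le> uhp_height z"
    using st unfolding R by linarith
qed

definition poly_bounded :: "real \<Rightarrow> (complex \<Rightarrow> real \<Rightarrow> complex) \<Rightarrow> bool" where
  "poly_bounded s f \<longleftrightarrow> (\<exists>C k. C \<ge> 0 \<and>
     (\<forall>z u. Im z > 0 \<longrightarrow> (1 + u\<^sup>2) powr s * cmod (f z u) \<le> C * uhp_height z ^ k))"

lemma poly_bounded_add:
  assumes "poly_bounded s f" "poly_bounded s g"
  shows "poly_bounded s (\<lambda>z u. f z u + g z u)"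
proof -
  obtain C k where C: "C \<ge> 0"
    "\<And>z u. Im z > 0 \<Longrightarrow> (1 + u\<^sup>2) powr s * cmod (f z u) \<le> C * uhp_height z ^ k"
    using assms(1) unfolding poly_bounded_def by blast
  obtain C' k' where C': "C' \<ge> 0"
    "\<And>z u. Im z > 0 \<Longrightarrow> (1 + u\<^sup>2) powr s * cmod (g z u) \<le> C' * uhp_height z ^ k'"
    using assms(2) unfolding poly_bounded_def by blast
  have "(1 + u\<^sup>2) powr s * cmod (f z u + g z u) \<le> (C + C') * uhp_height z ^ (k + k')" if z: "Im z > 0" for z u
  proof -
    have "(1 + u\<^sup>2) powr s * cmod (f z u + g z u) \<le> (1 + u\<^sup>2) powr s * (cmod (f z u) + cmod (g z u))"
      by (intro mult_left_mono norm_triangle_ineq) auto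
    also have "\<dots> \<le> C * uhp_height z ^ k + C' * uhp_height z ^ k'"
      using C(2)[OF z, of u] C'(2)[OF z, of u] by (simp add: distrib_left)
    also have "\<dots> \<le> C * uhp_height z ^ (k + k') + C' * uhp_height z ^ (k + k')"
      using C(1) C'(1) uhp_height_bounds(1)[OF z]
      by (intro add_mono mult_left_mono power_increasing) auto
    finally show ?thesis by (simp add: distrib_right)
  qed
  then show ?thesis unfolding poly_bounded_def using C(1) C'(1) by (meson add_nonneg_nonneg)
qed

lemma poly_bounded_mult:
  assumes "poly_bounded s f" "\<And>z. Im z > 0 \<Longrightarrow> cmod (c z) \<le> K * uhp_height z"
  shows "poly_bounded s (\<lambda>z u. c z * f z u)"
proof -
  obtain C k where C: "C \<ge> 0"
    "\<And>z u. Im z > 0 \<Longrightarrow> (1 + u\<^sup>2) powr s * cmod (f z u) \<le> C * uhp_height z ^ k"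
    using assms(1) unfolding poly_bounded_def by blast
  have K: "K \<ge> 0"
  proof -
    have "0 \<le> K * uhp_height \<i>" using assms(2)[of \<i>] norm_ge_zero[of "c \<i>"] by (simp del: norm_ge_zero)
    then show ?thesis using uhp_height_bounds(1)[of \<i>] by (simp add: zero_le_mult_iff)
  qed
  have "(1 + u\<^sup>2) powr s * cmod (c z * f z u) \<le> (K * C) * uhp_height z ^ Suc k" if z: "Im z > 0" for z u
  proof -
    have "(1 + u\<^sup>2) powr s * cmod (c z * f z u) = cmod (c z) * ((1 + u\<^sup>2) powr s * cmod (f z u))"
      by (simp add: norm_mult)
    also have "\<dots> \<le> (K * uhp_height z) * (C * uhp_height z ^ k)"
      using uhp_height_bounds(1)[OF z] K by (intro mult_mono assms(2) C z) auto
    finally show ?thesis by (simp add: mult_ac)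
  qed
  then show ?thesis unfolding poly_bounded_def using C(1) K by (meson mult_nonneg_nonneg)
qed

text \<open>The sign of the exponent is not known in the applications, which is why both
  \<open>r\<close> and \<open>1 / r\<close> have to be controlled.\<close>

lemma powr_le_powr_abs:
  fixes r R s :: real
  assumes "0 < r" "r \<le> R" "1 / r \<le> R"
  shows "r powr s \<le> R powr \<bar>s\<bar>"
proof (cases "s \<ge> 0")
  case True
  then show ?thesis using assms by (simp add: powr_mono2)
next
  case False
  have "r powr s = (1 / r) powr (- s)" using assms by (simp add: powr_minus_divide powr_divide)
  also have "\<dots> \<le> R powr (- s)" using assms False by (intro powr_mono2) auto
  finally show ?thesis using False by simp
qed

text \<open>With d = |z - u|, imaginary parts of exponents cost only bounded factors, since
  arguments lie within pi, and Re a + Re b = 2 Re lam. The weighted kernel is thus at most a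
  constant times r^(Re lam) d^(-p-q) with r = (1 + u^2)/d^2. Both r and 1/r are bounded by the
  height uniformly in \<open>u\<close>, and 1/d by 1 / Im z.\<close>

lemma mixed_kernel_poly_bounded:
  assumes "a + b = 2 * lam"
  shows "poly_bounded (Re lam) (mixed_kernel a b p q)"
proof -
  define c where "c = cmod (pochhammer a p) * cmod (pochhammer b q)"
  define E where "E = exp (\<bar>Im a\<bar> * pi) * exp (\<bar>Im b\<bar> * pi)"
  define n where "n = nat \<lceil>\<bar>Re lam\<bar>\<rceil>"
  have pw: "cmod (w powr (- (s + of_nat m))) \<le> cmod w powr (- Re s - real m) * exp (\<bar>Im s\<bar> * pi)"
    if "w \<noteq> 0" for w s :: complex and m :: nat
  proof -
    have "Im s * Arg w \<le> \<bar>Im s\<bar> * \<bar>Arg w\<bar>" by (simp add: abs_mult[symmetric])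
    also have "\<dots> \<le> \<bar>Im s\<bar> * pi" using Arg_bounded[of w] by (intro mult_left_mono) auto
    finally show ?thesis using that by (simp add: norm_powr_complex)
  qed
  have "(1 + u\<^sup>2) powr Re lam * cmod (mixed_kernel a b p q z u) \<le> (c * E) * uhp_height z ^ (n + (p + q))"
    if z: "Im z > 0" for z u
  proof -
    define w where "w = z - of_real u"
    define d where "d = cmod w"
    have w: "w \<noteq> 0" "cnj w \<noteq> 0" using z by (auto simp: w_def complex_eq_iff)
    have d: "d > 0" "Im z \<le> d" using w abs_Im_le_cmod[of w] by (auto simp: d_def w_def)
    have u2: "u\<^sup>2 \<le> 2 * (cmod z)\<^sup>2 + 2 * d\<^sup>2" "d\<^sup>2 \<le> 2 * (cmod z)\<^sup>2 + 2 * u\<^sup>2"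
    proof -
      have *: "x\<^sup>2 \<le> 2 * r\<^sup>2 + 2 * t\<^sup>2" if "0 \<le> x" "x \<le> r + t" for x r t :: real
      proof -
        have "x\<^sup>2 \<le> (r + t)\<^sup>2" using that by (intro power_mono) auto
        also have "\<dots> \<le> 2 * r\<^sup>2 + 2 * t\<^sup>2" using zero_le_power2[of "r - t"] by (simp add: power2_eq_square algebra_simps)
        finally show ?thesis .
      qed
      have "\<bar>u\<bar> \<le> cmod z + d" using norm_triangle_ineq4[of z w] by (simp add: w_def d_def)
      then show "u\<^sup>2 \<le> 2 * (cmod z)\<^sup>2 + 2 * d\<^sup>2" using *[of "\<bar>u\<bar>"] by simp
      have "d \<le> cmod z + \<bar>u\<bar>" using norm_triangle_ineq4[of z "of_real u"] by (simp add: w_def d_def)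
      then show "d\<^sup>2 \<le> 2 * (cmod z)\<^sup>2 + 2 * u\<^sup>2" using *[of d "cmod z" "\<bar>u\<bar>"] d by simp
    qed
    define r where "r = (1 + u\<^sup>2) / d\<^sup>2"
    have r0: "r > 0" using d(1) by (simp add: r_def add_pos_nonneg)
    have r1: "r \<le> uhp_height z"
    proof -
      have "r \<le> (1 + 2 * (cmod z)\<^sup>2 + 2 * d\<^sup>2) / d\<^sup>2"
        unfolding r_def using u2 by (intro divide_right_mono) auto
      also have "\<dots> = 2 + (1 + 2 * (cmod z)\<^sup>2) / d\<^sup>2" using d by (simp add: field_simps)
      also have "\<dots> \<le> 2 + (1 + 2 * (cmod z)\<^sup>2) / (Im z)\<^sup>2"
        using d z by (intro add_left_mono divide_left_mono power_mono mult_pos_pos) auto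
      also have "\<dots> \<le> uhp_height z" by (rule uhp_height_bounds(6)[OF z])
      finally show ?thesis .
    qed
    have r2: "1 / r \<le> uhp_height z"
    proof -
      have "d\<^sup>2 \<le> 2 * (1 + (cmod z)\<^sup>2) * (1 + u\<^sup>2)"
      proof -
        have "2 * (1 + (cmod z)\<^sup>2) * (1 + u\<^sup>2) = 2 + 2 * (cmod z)\<^sup>2 + 2 * u\<^sup>2 + 2 * ((cmod z)\<^sup>2 * u\<^sup>2)"
          by (simp add: algebra_simps)
        moreover have "0 \<le> (cmod z)\<^sup>2 * u\<^sup>2" by simp
        ultimately show ?thesis using u2(2) by linarith
      qed
      then have "1 / r \<le> 2 * (1 + (cmod z)\<^sup>2)"
        unfolding r_def by (simp add: divide_simps add_pos_nonneg) (simp add: mult_ac)?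
      then show ?thesis using uhp_height_bounds(5)[OF z] by linarith
    qed
    have R1: "uhp_height z \<ge> 1" by (rule uhp_height_bounds(1)[OF z])
    have "cmod (mixed_kernel a b p q z u) = c * (cmod (w powr (- (a + of_nat p))) * cmod (cnj w powr (- (b + of_nat q))))"
      by (simp add: mixed_kernel_def c_def norm_mult norm_power w_def)
    also have "\<dots> \<le> c * ((d powr (- Re a - real p) * exp (\<bar>Im a\<bar> * pi)) * (d powr (- Re b - real q) * exp (\<bar>Im b\<bar> * pi)))"
      using pw[OF w(1), of a p] pw[OF w(2), of b q]
      by (intro mult_left_mono mult_mono) (auto simp: d_def c_def)
    also have "\<dots> = c * E * d powr (- 2 * Re lam - real (p + q))"
    proof -
      have "Re a + Re b = 2 * Re lam" using arg_cong[OF assms, of Re] by simp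
      then have e: "- 2 * Re lam - real (p + q) = (- Re a - real p) + (- Re b - real q)" by simp
      show ?thesis unfolding e E_def powr_add by (simp only: mult_ac)
    qed
    finally have "(1 + u\<^sup>2) powr Re lam * cmod (mixed_kernel a b p q z u)
        \<le> (1 + u\<^sup>2) powr Re lam * (c * E * d powr (- 2 * Re lam - real (p + q)))"
      by (intro mult_left_mono) auto
    also have "\<dots> = (c * E) * (r powr Re lam * (1 / d) ^ (p + q))"
    proof -
      have "r powr Re lam = (1 + u\<^sup>2) powr Re lam * d powr (- 2 * Re lam)"
        using d unfolding r_def
        by (simp add: powr_divide powr_powr powr_minus_divide flip: powr_numeral)
      moreover have "d powr (- 2 * Re lam - real (p + q)) = d powr (- 2 * Re lam) * (1 / d) ^ (p + q)"
        using d by (simp add: powr_diff powr_realpow power_divide del: of_nat_add)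
      ultimately show ?thesis by (simp only: mult_ac)
    qed
    also have "\<dots> \<le> (c * E) * (uhp_height z ^ n * uhp_height z ^ (p + q))"
    proof (intro mult_left_mono mult_mono)
      have "r powr Re lam \<le> uhp_height z powr \<bar>Re lam\<bar>" by (rule powr_le_powr_abs[OF r0 r1 r2])
      also have "\<dots> \<le> uhp_height z powr real n" using R1 by (intro powr_mono) (auto simp: n_def)
      also have "\<dots> = uhp_height z ^ n" using R1 by (intro powr_realpow) auto
      finally show "r powr Re lam \<le> uhp_height z ^ n" .
      have "1 / d \<le> 1 / Im z" using d z by (intro divide_left_mono) auto
      also have "\<dots> \<le> uhp_height z" by (rule uhp_height_bounds(4)[OF z])
      finally show "(1 / d) ^ (p + q) \<le> uhp_height z ^ (p + q)" using d by (intro power_mono) auto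
    qed (use d R1 in \<open>auto simp: c_def E_def\<close>)
    finally show ?thesis by (simp add: power_add)
  qed
  moreover have "c * E \<ge> 0" by (simp add: c_def E_def)
  ultimately show ?thesis unfolding poly_bounded_def by blast
qed

lemma mixed_kernel_D_poly_bounded:
  assumes "a + b = 2 * lam"
  shows "poly_bounded (Re lam) (mixed_kernel_D a b j p q)"
proof (induction j arbitrary: p q)
  case 0
  then show ?case using mixed_kernel_poly_bounded[OF assms, of p q]
    by (simp add: poly_bounded_def)
next
  case (Suc j)
  have eq: "mixed_kernel_D a b (Suc j) p q = (\<lambda>z u.
      (- (1 + z\<^sup>2)) * mixed_kernel_D a b j (Suc p) q z u + ((- (1 + (cnj z)\<^sup>2)) * mixed_kernel_D a b j p (Suc q) z u
      + ((- ((a + 2 * of_nat p) * z + (b + 2 * of_nat q) * cnj z)) * mixed_kernel_D a b j p q z u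
      + ((- (of_nat p * (a + of_nat p - 1))) * mixed_kernel_D a b j (p - 1) q z u
      + (- (of_nat q * (b + of_nat q - 1))) * mixed_kernel_D a b j p (q - 1) z u))))"
    by (intro ext) (simp add: algebra_simps)
  have sq: "cmod (- (1 + w\<^sup>2)) \<le> 1 * uhp_height z" if "cmod w = cmod z" "Im z > 0" for w z
    using norm_triangle_ineq[of 1 "w\<^sup>2"] uhp_height_bounds(3)[OF that(2)] that(1)
    by (simp only: norm_minus_cancel norm_power norm_one mult_1)
  have lin: "cmod (- (c * z + d * cnj z)) \<le> (cmod c + cmod d) * uhp_height z" if "Im z > 0" for c d z
  proof -
    have "cmod (- (c * z + d * cnj z)) \<le> (cmod c + cmod d) * cmod z"
      using norm_triangle_ineq[of "c * z" "d * cnj z"] by (simp only: norm_minus_cancel norm_mult complex_mod_cnj distrib_right)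
    also have "\<dots> \<le> (cmod c + cmod d) * uhp_height z"
      using uhp_height_bounds(2)[OF that] by (intro mult_left_mono) auto
    finally show ?thesis .
  qed
  have const: "cmod c \<le> cmod c * uhp_height z" if "Im z > 0" for c z
    using mult_left_mono[OF uhp_height_bounds(1)[OF that], of "cmod c"] by simp
  show ?case unfolding eq
    by (intro poly_bounded_add; rule poly_bounded_mult[OF Suc.IH]) (rule sq lin const; simp)+
qed

section \<open>Smoothness of the Poisson transform and the Laplace equation\<close>

text \<open>The mean value inequality for real differentiability; the factor 2 adds the
  contributions of the two Wirtinger derivatives to the operator norm.\<close>

lemma Wirtinger_lipschitz:
  assumes "convex S" "x \<in> S" "y \<in> S" "B \<ge> 0"
    and "\<And>z. z \<in> S \<Longrightarrow> (f has_derivative (\<lambda>h. f1 z * h + f2 z * cnj h)) (at z)"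
    and "\<And>z. z \<in> S \<Longrightarrow> cmod (f1 z) \<le> B" "\<And>z. z \<in> S \<Longrightarrow> cmod (f2 z) \<le> B"
  shows "cmod (f x - f y) \<le> 2 * B * cmod (x - y)"
proof (rule differentiable_bound[OF assms(1)])
  show "(f has_derivative (\<lambda>h. f1 z * h + f2 z * cnj h)) (at z within S)" if "z \<in> S" for z
    using assms(5)[OF that] by (rule has_derivative_at_withinI)
  show "onorm (\<lambda>h. f1 z * h + f2 z * cnj h) \<le> 2 * B" if "z \<in> S" for z
  proof (rule onorm_bound)
    fix h
    have "cmod (f1 z * h + f2 z * cnj h) \<le> cmod (f1 z) * cmod h + cmod (f2 z) * cmod h"
      using norm_triangle_ineq[of "f1 z * h" "f2 z * cnj h"] by (simp add: norm_mult)
    also have "\<dots> \<le> B * cmod h + B * cmod h"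
      using assms(6,7)[OF that] by (intro add_mono mult_right_mono) auto
    finally show "cmod (f1 z * h + f2 z * cnj h) \<le> 2 * B * cmod h" by simp
  qed (use assms(4) in auto)
qed (use assms in auto)

text \<open>The radius keeps Im z at least Im z0 / 2, whence the constant 4; the constant 2 comes
  from |z| <= |z0| + Im z0 / 2 <= 2 |z0|.\<close>

lemma uhp_ball_Im:
  assumes "Im z0 > 0" "z \<in> cball z0 (Im z0 / 2)"
  shows "Im z > 0" "uhp_height z \<le> 2 * (1 + (2 * cmod z0)\<^sup>2) * (1 + 4 / (Im z0)\<^sup>2)"
proof -
  have d: "cmod (z0 - z) \<le> Im z0 / 2" using assms(2) by (simp add: dist_norm)
  then have y: "Im z0 / 2 \<le> Im z" using abs_Im_le_cmod[of "z0 - z"] by auto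
  then show "Im z > 0" using assms(1) by linarith
  have "cmod z \<le> cmod z0 + cmod (z0 - z)" using norm_triangle_ineq4[of z0 "z0 - z"] by simp
  also have "\<dots> \<le> 2 * cmod z0" using d abs_Im_le_cmod[of z0] assms(1) by auto
  finally have "(cmod z)\<^sup>2 \<le> (2 * cmod z0)\<^sup>2" by (intro power_mono) auto
  moreover have "1 / (Im z)\<^sup>2 \<le> 1 / (Im z0 / 2)\<^sup>2"
    using y assms(1) by (intro divide_left_mono power_mono) auto
  then have "1 / (Im z)\<^sup>2 \<le> 4 / (Im z0)\<^sup>2" by (simp add: power_divide)
  ultimately show "uhp_height z \<le> 2 * (1 + (2 * cmod z0)\<^sup>2) * (1 + 4 / (Im z0)\<^sup>2)"
    unfolding uhp_height_def by (intro mult_mono) auto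
qed

lemma mixed_kernel_D_locally_bounded:
  assumes "a + b = 2 * lam" "Im z0 > 0"
  obtains K where "K \<ge> 0" "\<And>z u. z \<in> cball z0 (Im z0 / 2) \<Longrightarrow>
     (1 + u\<^sup>2) powr Re lam * cmod (mixed_kernel_D a b j p q z u) \<le> K"
proof -
  obtain C k where C: "C \<ge> 0"
    "\<And>z u. Im z > 0 \<Longrightarrow> (1 + u\<^sup>2) powr Re lam * cmod (mixed_kernel_D a b j p q z u) \<le> C * uhp_height z ^ k"
    using mixed_kernel_D_poly_bounded[OF assms(1)] unfolding poly_bounded_def by blast
  let ?R = "2 * (1 + (2 * cmod z0)\<^sup>2) * (1 + 4 / (Im z0)\<^sup>2)"
  show ?thesis
  proof (rule that[of "C * ?R ^ k"])
    fix z u assume z: "z \<in> cball z0 (Im z0 / 2)"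
    note zi = uhp_ball_Im[OF assms(2) z]
    have "(1 + u\<^sup>2) powr Re lam * cmod (mixed_kernel_D a b j p q z u) \<le> C * uhp_height z ^ k"
      by (rule C(2)[OF zi(1)])
    also have "\<dots> \<le> C * ?R ^ k"
      using C(1) zi(2) uhp_height_bounds(1)[OF zi(1)] by (intro mult_left_mono power_mono) auto
    finally show "(1 + u\<^sup>2) powr Re lam * cmod (mixed_kernel_D a b j p q z u) \<le> C * ?R ^ k" .
  qed (use C(1) in auto)
qed

lemma mixed_kernel_D_lipschitz:
  assumes "a + b = 2 * lam" "Im z0 > 0"
  obtains K where "K \<ge> 0" "\<And>z u. z \<in> cball z0 (Im z0 / 2) \<Longrightarrow>
     (1 + u\<^sup>2) powr Re lam * cmod (mixed_kernel_D a b j p q z u - mixed_kernel_D a b j p q z0 u)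
       \<le> K * cmod (z - z0)"
proof -
  obtain K1 where K1: "K1 \<ge> 0" "\<And>z u. z \<in> cball z0 (Im z0 / 2) \<Longrightarrow>
     (1 + u\<^sup>2) powr Re lam * cmod (mixed_kernel_D a b j (Suc p) q z u) \<le> K1"
    using mixed_kernel_D_locally_bounded[OF assms] by blast
  obtain K2 where K2: "K2 \<ge> 0" "\<And>z u. z \<in> cball z0 (Im z0 / 2) \<Longrightarrow>
     (1 + u\<^sup>2) powr Re lam * cmod (mixed_kernel_D a b j p (Suc q) z u) \<le> K2"
    using mixed_kernel_D_locally_bounded[OF assms] by blast
  show ?thesis
  proof (rule that[of "2 * max K1 K2"])
    fix z u assume z: "z \<in> cball z0 (Im z0 / 2)"
    let ?W = "(1 + u\<^sup>2) powr Re lam"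
    have W: "?W > 0" using add_pos_nonneg[of 1 "u\<^sup>2"] by simp
    have "cmod (mixed_kernel_D a b j p q z u - mixed_kernel_D a b j p q z0 u)
        \<le> 2 * (max K1 K2 / ?W) * cmod (z - z0)"
    proof (rule Wirtinger_lipschitz[of "cball z0 (Im z0 / 2)" z z0 _ _
          "\<lambda>z. mixed_kernel_D a b j (Suc p) q z u" "\<lambda>z. mixed_kernel_D a b j p (Suc q) z u"])
      fix x assume x: "x \<in> cball z0 (Im z0 / 2)"
      show "((\<lambda>z. mixed_kernel_D a b j p q z u) has_derivative
        (\<lambda>h. mixed_kernel_D a b j (Suc p) q x u * h + mixed_kernel_D a b j p (Suc q) x u * cnj h)) (at x)"
        using uhp_ball_Im(1)[OF assms(2) x] by (intro mixed_kernel_D_has_derivative) simp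
      show "cmod (mixed_kernel_D a b j (Suc p) q x u) \<le> max K1 K2 / ?W"
        using K1(2)[OF x, of u] W by (simp add: pos_le_divide_eq mult.commute)
      show "cmod (mixed_kernel_D a b j p (Suc q) x u) \<le> max K1 K2 / ?W"
        using K2(2)[OF x, of u] W by (simp add: pos_le_divide_eq mult.commute)
    qed (use z assms(2) K1(1) W in \<open>auto simp: le_max_iff_disj\<close>)
    then show "?W * cmod (mixed_kernel_D a b j p q z u - mixed_kernel_D a b j p q z0 u)
        \<le> 2 * max K1 K2 * cmod (z - z0)" using W by (simp add: field_simps)
  qed (use K1(1) in auto)
qed

text \<open>Subtracting the linear part leaves a function whose Wirtinger derivatives are
  differences of first derivatives of the kernel. By the Lipschitz bound these are of order |z -
  z0|, and the mean value inequality contributes the second such factor.\<close>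

lemma mixed_kernel_D_taylor:
  assumes "a + b = 2 * lam" "Im z0 > 0"
  obtains K where "K \<ge> 0" "\<And>z u. z \<in> cball z0 (Im z0 / 2) \<Longrightarrow>
     (1 + u\<^sup>2) powr Re lam * cmod (mixed_kernel_D a b j p q z u - mixed_kernel_D a b j p q z0 u
        - mixed_kernel_D a b j (Suc p) q z0 u * (z - z0) - mixed_kernel_D a b j p (Suc q) z0 u * cnj (z - z0))
       \<le> K * (cmod (z - z0))\<^sup>2"
proof -
  obtain K1 where K1: "K1 \<ge> 0" "\<And>z u. z \<in> cball z0 (Im z0 / 2) \<Longrightarrow>
     (1 + u\<^sup>2) powr Re lam * cmod (mixed_kernel_D a b j (Suc p) q z u - mixed_kernel_D a b j (Suc p) q z0 u)
       \<le> K1 * cmod (z - z0)"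
    using mixed_kernel_D_lipschitz[OF assms] by blast
  obtain K2 where K2: "K2 \<ge> 0" "\<And>z u. z \<in> cball z0 (Im z0 / 2) \<Longrightarrow>
     (1 + u\<^sup>2) powr Re lam * cmod (mixed_kernel_D a b j p (Suc q) z u - mixed_kernel_D a b j p (Suc q) z0 u)
       \<le> K2 * cmod (z - z0)"
    using mixed_kernel_D_lipschitz[OF assms] by blast
  show ?thesis
  proof (rule that[of "2 * max K1 K2"])
    fix z u assume z: "z \<in> cball z0 (Im z0 / 2)"
    let ?W = "(1 + u\<^sup>2) powr Re lam"
    have W: "?W > 0" using add_pos_nonneg[of 1 "u\<^sup>2"] by simp
    \<comment> \<open>The ball is shrunk to the radius |z - z0|, so that the derivative bound at any
      of its points is expressed by |z - z0| itself.\<close>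
    define S where "S = cball z0 (cmod (z - z0))"
    have S: "S \<subseteq> cball z0 (Im z0 / 2)" "z \<in> S" "z0 \<in> S" "convex S"
      using z by (auto simp: S_def dist_norm norm_minus_commute)
    define g where "g = (\<lambda>w. mixed_kernel_D a b j p q w u
        - (mixed_kernel_D a b j (Suc p) q z0 u * w + mixed_kernel_D a b j p (Suc q) z0 u * cnj w))"
    have "cmod (g z - g z0) \<le> 2 * (max K1 K2 * cmod (z - z0) / ?W) * cmod (z - z0)"
    proof (rule Wirtinger_lipschitz[OF S(4,2,3), of _ _
          "\<lambda>z. mixed_kernel_D a b j (Suc p) q z u - mixed_kernel_D a b j (Suc p) q z0 u"
          "\<lambda>z. mixed_kernel_D a b j p (Suc q) z u - mixed_kernel_D a b j p (Suc q) z0 u"])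
      fix x assume xS: "x \<in> S"
      then have x: "x \<in> cball z0 (Im z0 / 2)" using S(1) by auto
      have xz: "cmod (x - z0) \<le> cmod (z - z0)" using xS by (simp add: S_def dist_norm norm_minus_commute)
      have le: "c * cmod (x - z0) \<le> max K1 K2 * cmod (z - z0)" if "c = K1 \<or> c = K2" for c
        using that K1(1) K2(1) xz by (intro mult_mono) auto
      show "(g has_derivative
        (\<lambda>h. (mixed_kernel_D a b j (Suc p) q x u - mixed_kernel_D a b j (Suc p) q z0 u) * h
           + (mixed_kernel_D a b j p (Suc q) x u - mixed_kernel_D a b j p (Suc q) z0 u) * cnj h)) (at x)"
      proof -
        have "(g has_derivative (\<lambda>h. (mixed_kernel_D a b j (Suc p) q x u * h + mixed_kernel_D a b j p (Suc q) x u * cnj h)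
           - (mixed_kernel_D a b j (Suc p) q z0 u * h + mixed_kernel_D a b j p (Suc q) z0 u * cnj h))) (at x)"
          unfolding g_def
          by (intro has_derivative_diff mixed_kernel_D_has_derivative)
             (use uhp_ball_Im(1)[OF assms(2) x] in \<open>auto intro!: derivative_eq_intros\<close>)
        then show ?thesis by (simp add: algebra_simps)
      qed
      show "cmod (mixed_kernel_D a b j (Suc p) q x u - mixed_kernel_D a b j (Suc p) q z0 u)
          \<le> max K1 K2 * cmod (z - z0) / ?W"
        using K1(2)[OF x, of u] le[of K1] W by (simp add: pos_le_divide_eq mult.commute)
      show "cmod (mixed_kernel_D a b j p (Suc q) x u - mixed_kernel_D a b j p (Suc q) z0 u)
          \<le> max K1 K2 * cmod (z - z0) / ?W"
        using K2(2)[OF x, of u] le[of K2] W by (simp add: pos_le_divide_eq mult.commute)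
    qed (use K1(1) W in auto)
    moreover have "g z - g z0 = mixed_kernel_D a b j p q z u - mixed_kernel_D a b j p q z0 u
        - mixed_kernel_D a b j (Suc p) q z0 u * (z - z0) - mixed_kernel_D a b j p (Suc q) z0 u * cnj (z - z0)"
      by (simp add: g_def algebra_simps)
    ultimately show "?W * cmod (mixed_kernel_D a b j p q z u - mixed_kernel_D a b j p q z0 u
        - mixed_kernel_D a b j (Suc p) q z0 u * (z - z0) - mixed_kernel_D a b j p (Suc q) z0 u * cnj (z - z0))
        \<le> 2 * max K1 K2 * (cmod (z - z0))\<^sup>2" using W by (simp add: field_simps power2_eq_square)
  qed (use K1(1) in auto)
qed

definition kernel_transform ::
  "complex \<Rightarrow> int \<Rightarrow> ((real \<Rightarrow> complex) \<Rightarrow> complex) \<Rightarrow> nat \<Rightarrow> nat \<Rightarrow> complex \<Rightarrow> complex" where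
  "kernel_transform lam l T p q z = T (mixed_kernel (lam + of_int l / 4) (lam - of_int l / 4) p q z)"

lemma distribution_on_linear:
  assumes "distribution_on lam l T"
  shows "f \<in> test_space lam l \<Longrightarrow> g \<in> test_space lam l \<Longrightarrow> T (\<lambda>x. f x + g x) = T f + T g"
    and "f \<in> test_space lam l \<Longrightarrow> T (\<lambda>x. c * f x) = c * T f"
  using assms by (auto simp: distribution_on_def)

text \<open>\<open>T\<close> is applied to the first-order remainder of the kernel, a finite linear
  combination of test functions. One seminorm of it controls \<open>T\<close>, and that seminorm is
  quadratically small in z - z0.\<close>

lemma kernel_transform_has_derivative:
  assumes T: "distribution_on lam l T" and z0: "Im z0 > 0"
  shows "(kernel_transform lam l T p q has_derivative
     (\<lambda>h. kernel_transform lam l T (Suc p) q z0 * h + kernel_transform lam l T p (Suc q) z0 * cnj h)) (at z0)"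
proof -
  define a where "a = lam + of_int l / 4"
  define b where "b = lam - of_int l / 4"
  have ab: "a + b = 2 * lam" by (simp add: a_def b_def)
  obtain M C where C: "C \<ge> 0"
    "\<And>f B. f \<in> test_space lam l \<Longrightarrow> \<forall>x. weighted_jet M lam f x \<le> B \<Longrightarrow> cmod (T f) \<le> C * B"
    using distribution_bound[OF T] by blast
  define rem where "rem j z u = mixed_kernel_D a b j p q z u - mixed_kernel_D a b j p q z0 u
        - mixed_kernel_D a b j (Suc p) q z0 u * (z - z0) - mixed_kernel_D a b j p (Suc q) z0 u * cnj (z - z0)"
    for j z u
  have "\<forall>j. \<exists>K. \<forall>z\<in>cball z0 (Im z0 / 2). \<forall>u.
     (1 + u\<^sup>2) powr Re lam * cmod (rem j z u) \<le> K * (cmod (z - z0))\<^sup>2"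
  proof
    fix j
    show "\<exists>K. \<forall>z\<in>cball z0 (Im z0 / 2). \<forall>u.
       (1 + u\<^sup>2) powr Re lam * cmod (rem j z u) \<le> K * (cmod (z - z0))\<^sup>2"
      by (rule mixed_kernel_D_taylor[OF ab z0, of j p q], unfold rem_def[symmetric]) blast
  qed
  from choice[OF this] obtain K where K: "\<And>j z u. z \<in> cball z0 (Im z0 / 2) \<Longrightarrow>
     (1 + u\<^sup>2) powr Re lam * cmod (rem j z u) \<le> K j * (cmod (z - z0))\<^sup>2"
    by blast
  note mem = mixed_kernel_test_space[of _ lam l, folded a_def b_def]
  note lin = distribution_on_linear[OF T]
  let ?G = "\<lambda>p q z. kernel_transform lam l T p q z"
  have bound: "cmod (?G p q z - ?G p q z0 - (?G (Suc p) q z0 * (z - z0) + ?G p (Suc q) z0 * cnj (z - z0)))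
      \<le> C * (\<Sum>j\<le>M. K j) * (cmod (z - z0))\<^sup>2" if z: "z \<in> cball z0 (Im z0 / 2)" for z
  proof -
    have zi: "Im z > 0" by (rule uhp_ball_Im(1)[OF z0 z])
    note mems = test_space_add[where l = l] test_space_cmult[where l = l] mem[OF zi] mem[OF z0]
    define R where "R = (\<lambda>u. mixed_kernel a b p q z u + ((-1) * mixed_kernel a b p q z0 u
       + ((- (z - z0)) * mixed_kernel a b (Suc p) q z0 u + (- cnj (z - z0)) * mixed_kernel a b p (Suc q) z0 u)))"
    have R: "R \<in> test_space lam l" unfolding R_def by (intro mems)
    have "T R = ?G p q z - ?G p q z0 - (?G (Suc p) q z0 * (z - z0) + ?G p (Suc q) z0 * cnj (z - z0))"
      unfolding R_def kernel_transform_def a_def[symmetric] b_def[symmetric]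
      by (simp only: lin mems) (simp add: algebra_simps)
    moreover have "cmod (T R) \<le> C * ((\<Sum>j\<le>M. K j) * (cmod (z - z0))\<^sup>2)"
    proof (rule C(2)[OF R], rule)
      fix u
      \<comment> \<open>The coefficients z - z0 and its conjugate are constants in \<open>u\<close>,
        so \<open>D_op\<close> passes through them and yields the Taylor remainder of the iterated
        kernel.\<close>
      have D: "(D_op lam ^^ j) R = rem j z" for j
        unfolding R_def
        by (simp only: D_op_funpow_add[where l = l] D_op_funpow_cmult[where l = l] mems
            D_op_funpow_mixed_kernel[OF zi a_def b_def] D_op_funpow_mixed_kernel[OF z0 a_def b_def])
          (auto simp: rem_def algebra_simps)
      show "weighted_jet M lam R u \<le> (\<Sum>j\<le>M. K j) * (cmod (z - z0))\<^sup>2"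
        unfolding weighted_jet_def D sum_distrib_left sum_distrib_right by (intro sum_mono K z)
    qed
    ultimately show ?thesis by (simp add: mult.assoc)
  qed
  show ?thesis
  proof (rule has_derivativeI_sandwich[of "Im z0 / 2"])
    show "Im z0 / 2 > 0" using z0 by simp
    show "bounded_linear (\<lambda>h. ?G (Suc p) q z0 * h + ?G p (Suc q) z0 * cnj h)"
      by (intro bounded_linear_add bounded_linear_const_mult bounded_linear_ident bounded_linear_cnj)
    show "((\<lambda>z. C * (\<Sum>j\<le>M. K j) * cmod (z - z0)) \<longlongrightarrow> 0) (at z0)"
      by (auto intro!: tendsto_eq_intros)
    fix z assume z: "z \<noteq> z0" "dist z z0 < Im z0 / 2"
    then have "z \<in> cball z0 (Im z0 / 2)" by (simp add: dist_commute)
    from bound[OF this]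
    show "cmod (?G p q z - ?G p q z0 - (?G (Suc p) q z0 * (z - z0) + ?G p (Suc q) z0 * cnj (z - z0))) / cmod (z - z0)
        \<le> C * (\<Sum>j\<le>M. K j) * cmod (z - z0)"
      using z(1) by (simp add: pos_divide_le_eq power2_eq_square mult.assoc)
  qed
qed

text \<open>Off the negative axis 2 ln |w| = Ln w + Ln (conj w), which splits |w|^(2b) into
  principal powers of w and conj w. The power l/2 of w in the denominator then raises b to
  a.\<close>

lemma poisson_kernel_eq:
  assumes "Im z > 0"
  shows "poisson_kernel lam l z = (\<lambda>u. of_real (Im z) powr (lam - of_int l / 4) *
     mixed_kernel (lam + of_int l / 4) (lam - of_int l / 4) 0 0 z u)"
proof
  fix u
  define w where "w = z - of_real u"
  define b where "b = lam - of_int l / 4"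
  have w: "w \<noteq> 0" "w \<notin> \<real>\<^sub>\<le>\<^sub>0" using assms by (auto simp: w_def complex_nonpos_Reals_iff)
  have "of_real (cmod w) powr (2 * b) = w powr b * cnj w powr b"
  proof -
    have "2 * Ln (of_real (cmod w)) = Ln w + Ln (cnj w)"
      using w by (simp add: Ln_of_real complex_add_cnj flip: cnj_Ln)
    then have "2 * b * Ln (of_real (cmod w)) = b * Ln w + b * Ln (cnj w)"
      by (metis distrib_left mult.assoc mult.commute)
    then show ?thesis using w by (simp add: powr_def exp_add)
  qed
  moreover have "w powr b * w powr (of_int l / 2) = w powr (lam + of_int l / 4)"
  proof -
    have e: "lam + of_int l / 4 = b + of_int l / 2" by (simp add: b_def)
    show ?thesis unfolding e powr_add ..
  qed
  ultimately have key: "of_real (cmod w) powr (2 * b) * w powr (of_int l / 2) = w powr (lam + of_int l / 4) * cnj w powr b"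
    by (simp add: mult_ac)
  have e: "2 * lam - of_int l / 2 = 2 * b" by (simp add: b_def)
  have cw: "cnj z - of_real u = cnj w" by (simp add: w_def)
  show "poisson_kernel lam l z u = of_real (Im z) powr (lam - of_int l / 4) *
     mixed_kernel (lam + of_int l / 4) (lam - of_int l / 4) 0 0 z u"
    unfolding poisson_kernel_def mixed_kernel_def cw w_def[symmetric] b_def[symmetric] e key
    by (simp only: pochhammer_0 of_nat_0 add_0_right power_0 mult_1_left powr_minus divide_inverse inverse_mult_distrib)
qed

lemma poisson_kernel_test_space:
  assumes "Im z > 0"
  shows "poisson_kernel lam l z \<in> test_space lam l"
  unfolding poisson_kernel_eq[OF assms] by (intro test_space_cmult mixed_kernel_test_space assms)

lemma poisson_transform_eq:
  assumes "distribution_on lam l T" "Im z > 0"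
  shows "poisson_transform lam l T z = of_real (Im z) powr (lam - of_int l / 4) * kernel_transform lam l T 0 0 z"
  unfolding poisson_transform_def poisson_kernel_eq[OF assms(2)] kernel_transform_def
  by (intro distribution_on_linear(2)[OF assms(1)] mixed_kernel_test_space assms)

section \<open>Partial derivatives in x and y, and the Laplace equation\<close>

definition has_partials :: "(complex \<Rightarrow> complex) \<Rightarrow> complex \<Rightarrow> complex \<Rightarrow> complex \<Rightarrow> bool" where
  "has_partials f fx fy z \<longleftrightarrow> (f has_derivative (\<lambda>h. of_real (Re h) * fx + of_real (Im h) * fy)) (at z)"

lemma has_partials_imp_deriv:
  assumes "has_partials f fx fy z"
  shows "deriv_x f z = fx" "deriv_y f z = fy"
  using frechet_derivative_at[OF assms[unfolded has_partials_def], symmetric]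
  by (auto simp: deriv_x_def deriv_y_def)

lemma has_partials_add:
  assumes "has_partials f fx fy z" "has_partials g gx gy z"
  shows "has_partials (\<lambda>z. f z + g z) (fx + gx) (fy + gy) z"
  using has_derivative_add[OF assms[unfolded has_partials_def]]
  by (simp add: has_partials_def algebra_simps)

lemma has_partials_cmult:
  assumes "has_partials f fx fy z"
  shows "has_partials (\<lambda>z. c * f z) (c * fx) (c * fy) z"
  using has_derivative_mult_right[OF assms[unfolded has_partials_def], of c]
  by (simp add: has_partials_def algebra_simps)

lemma open_uhp: "open uhp"
  unfolding uhp_def by (rule open_halfspace_Im_gt)

lemma has_partials_transform:
  assumes "has_partials g fx fy z" "z \<in> uhp" "\<And>w. w \<in> uhp \<Longrightarrow> f w = g w"
  shows "has_partials f fx fy z"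
  using has_derivative_transform_within_open[OF assms(1)[unfolded has_partials_def] open_uhp assms(2)] assms(3)
  by (simp add: has_partials_def)

text \<open>The exponent \<open>s\<close> is a parameter because d/dy lowers it by one: only with
  all \<open>s\<close>, \<open>p\<close>, \<open>q\<close> together is the span closed under both
  partial derivatives.\<close>

definition height_transform ::
  "complex \<Rightarrow> int \<Rightarrow> ((real \<Rightarrow> complex) \<Rightarrow> complex) \<Rightarrow> complex \<Rightarrow> nat \<Rightarrow> nat \<Rightarrow> complex \<Rightarrow> complex" where
  "height_transform lam l T s p q z = of_real (Im z) powr s * kernel_transform lam l T p q z"

lemma height_transform_has_partials:
  assumes T: "distribution_on lam l T" and "z \<in> uhp"
  shows "has_partials (height_transform lam l T s p q)
     (height_transform lam l T s (Suc p) q z + height_transform lam l T s p (Suc q) z)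
     (\<i> * height_transform lam l T s (Suc p) q z + (- \<i>) * height_transform lam l T s p (Suc q) z
       + s * height_transform lam l T (s - 1) p q z) z"
proof -
  have z: "Im z > 0" using assms(2) by (simp add: uhp_def)
  have "((\<lambda>z. complex_of_real (Im z)) has_derivative (\<lambda>h. of_real (Im h))) (at z)"
    by (auto intro!: derivative_eq_intros)
  then have "((\<lambda>z. complex_of_real (Im z) powr s) has_derivative
      (\<lambda>h. s * of_real (Im z) powr (s - 1) * of_real (Im h))) (at z)"
    by (rule has_derivative_complex_powr) (use z in \<open>simp add: complex_nonpos_Reals_iff\<close>)
  from has_derivative_mult[OF this kernel_transform_has_derivative[OF T z, of p q]]
  have "(height_transform lam l T s p q has_derivative
     (\<lambda>h. of_real (Im z) powr s * (kernel_transform lam l T (Suc p) q z * h + kernel_transform lam l T p (Suc q) z * cnj h)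
       + s * of_real (Im z) powr (s - 1) * of_real (Im h) * kernel_transform lam l T p q z)) (at z)"
    unfolding height_transform_def .
  moreover have "of_real (Im z) powr s * (kernel_transform lam l T (Suc p) q z * h + kernel_transform lam l T p (Suc q) z * cnj h)
       + s * of_real (Im z) powr (s - 1) * of_real (Im h) * kernel_transform lam l T p q z
     = of_real (Re h) * (height_transform lam l T s (Suc p) q z + height_transform lam l T s p (Suc q) z)
     + of_real (Im h) * (\<i> * height_transform lam l T s (Suc p) q z + (- \<i>) * height_transform lam l T s p (Suc q) z
       + s * height_transform lam l T (s - 1) p q z)" for h
  proof -
    define x where "x = Re h"
    define v where "v = Im h"
    have h: "h = of_real x + \<i> * of_real v" "cnj h = of_real x - \<i> * of_real v"
      by (auto simp: x_def v_def complex_eq_iff)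
    show ?thesis unfolding height_transform_def x_def[symmetric] v_def[symmetric] h(2)
      unfolding h(1) by (simp add: algebra_simps)
  qed
  ultimately show ?thesis unfolding has_partials_def by simp
qed

lemma smooth_on_poisson_transform:
  assumes T: "distribution_on lam l T"
  shows "smooth_on uhp (poisson_transform lam l T)"
proof -
  let ?B = "{height_transform lam l T s p q | s p q. True}"
  have "smooth_on uhp (height_transform lam l T (lam - of_int l / 4) 0 0)"
  proof (rule smooth_on_lincomb[OF open_uhp, where B = ?B])
    fix f assume "f \<in> ?B"
    then obtain s p q where f: "f = height_transform lam l T s p q" by blast
    let ?Dx = "\<lambda>z. height_transform lam l T s (Suc p) q z + height_transform lam l T s p (Suc q) z"
    let ?Dy = "\<lambda>z. \<i> * height_transform lam l T s (Suc p) q z + (- \<i>) * height_transform lam l T s p (Suc q) z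
       + s * height_transform lam l T (s - 1) p q z"
    show "\<exists>D. (\<forall>x\<in>uhp. (f has_derivative D x) (at x)) \<and> (\<forall>b\<in>Basis. lincomb ?B (\<lambda>x. D x b))"
    proof (intro exI conjI ballI)
      show "(f has_derivative (\<lambda>h. of_real (Re h) * ?Dx z + of_real (Im h) * ?Dy z)) (at z)" if "z \<in> uhp" for z
        using height_transform_has_partials[OF T that, of s p q] unfolding has_partials_def f .
      have Dx: "lincomb ?B ?Dx" by (intro lincomb_add lincomb_base) blast+
      have Dy: "lincomb ?B ?Dy" by (intro lincomb_add lincomb_scale lincomb_base) blast+
      show "lincomb ?B (\<lambda>z. of_real (Re b) * ?Dx z + of_real (Im b) * ?Dy z)" for b
        by (rule lincomb_add[OF lincomb_scale[OF Dx] lincomb_scale[OF Dy]])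
    qed
  qed (auto intro: lincomb_base)
  moreover have "C_k_on k (poisson_transform lam l T) uhp \<longleftrightarrow>
      C_k_on k (height_transform lam l T (lam - of_int l / 4) 0 0) uhp" for k
    by (rule C_k_on_cong[OF open_uhp]) (simp add: poisson_transform_eq[OF T] height_transform_def uhp_def)
  ultimately show ?thesis by (simp add: smooth_on_def)
qed

text \<open>The Euler-Poisson-Darboux equation. Since 2 i Im z = (z - u) - (conj z - u), each
  difference undoes one of the two derivatives of the mixed kernel; \<open>T\<close> is linear and
  the resulting coefficients are free of \<open>u\<close>.\<close>

lemma kernel_transform_relation:
  assumes T: "distribution_on lam l T" and z: "Im z > 0"
  shows "2 * \<i> * of_real (Im z) * kernel_transform lam l T 1 1 z =
     (lam - of_int l / 4) * kernel_transform lam l T 1 0 z - (lam + of_int l / 4) * kernel_transform lam l T 0 1 z"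
proof -
  define a where "a = lam + of_int l / 4"
  define b where "b = lam - of_int l / 4"
  note mem = mixed_kernel_test_space[OF z, of lam l, folded a_def b_def]
  have "(\<lambda>u. (2 * \<i> * of_real (Im z)) * mixed_kernel a b 1 1 z u) =
     (\<lambda>u. b * mixed_kernel a b 1 0 z u + (- a) * mixed_kernel a b 0 1 z u)"
  proof
    fix u
    have y: "2 * \<i> * of_real (Im z) = (z - of_real u) - (cnj z - of_real u)" by (simp add: complex_eq_iff)
    have "(z - of_real u) * mixed_kernel a b 1 1 z u = - a * mixed_kernel a b 0 1 z u"
      "(cnj z - of_real u) * mixed_kernel a b 1 1 z u = - b * mixed_kernel a b 1 0 z u"
      using mixed_kernel_shift(1)[of z u a b 0 1] mixed_kernel_shift(2)[of z u a b 1 0] z by auto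
    then show "(2 * \<i> * of_real (Im z)) * mixed_kernel a b 1 1 z u =
       b * mixed_kernel a b 1 0 z u + (- a) * mixed_kernel a b 0 1 z u"
      unfolding y left_diff_distrib by simp
  qed
  then have "T (\<lambda>u. (2 * \<i> * of_real (Im z)) * mixed_kernel a b 1 1 z u) =
     T (\<lambda>u. b * mixed_kernel a b 1 0 z u + (- a) * mixed_kernel a b 0 1 z u)" by simp
  then show ?thesis
    unfolding kernel_transform_def a_def[symmetric] b_def[symmetric]
    by (simp only: distribution_on_linear[OF T] test_space_cmult mem) simp
qed

lemma Laplacian_poisson_transform:
  assumes T: "distribution_on lam l T" and z: "z \<in> uhp"
  shows "Laplacian l (poisson_transform lam l T) z =
     (lam - of_int l / 4) * (1 - lam - of_int l / 4) * poisson_transform lam l T z"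
proof -
  define b where "b = lam - of_int l / 4"
  let ?Y = "height_transform lam l T" and ?F = "poisson_transform lam l T"
  let ?G = "kernel_transform lam l T"
  note hp = height_transform_has_partials[OF T]
  have F: "has_partials ?F (?Y b 1 0 w + ?Y b 0 1 w)
     (\<i> * ?Y b 1 0 w + (- \<i>) * ?Y b 0 1 w + b * ?Y (b - 1) 0 0 w) w" if "w \<in> uhp" for w
  proof (rule has_partials_transform[OF _ that])
    show "has_partials (?Y b 0 0) (?Y b 1 0 w + ?Y b 0 1 w)
       (\<i> * ?Y b 1 0 w + (- \<i>) * ?Y b 0 1 w + b * ?Y (b - 1) 0 0 w) w"
      using hp[OF that, of b 0 0] by simp
  qed (simp add: poisson_transform_eq[OF T] uhp_def b_def height_transform_def)
  note Fd = has_partials_imp_deriv[OF F]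
  have xx: "deriv_x (deriv_x ?F) z = ?Y b 2 0 z + 2 * ?Y b 1 1 z + ?Y b 0 2 z"
  proof -
    from has_partials_imp_deriv(1)[OF has_partials_transform[OF
        has_partials_add[OF hp[OF z, of b 1 0] hp[OF z, of b 0 1]] z Fd(1)]]
    show ?thesis by (simp add: numeral_2_eq_2)
  qed
  have yy: "deriv_y (deriv_y ?F) z = b * (b - 1) * ?Y (b - 2) 0 0 z
     + 2 * \<i> * b * (?Y (b - 1) 1 0 z - ?Y (b - 1) 0 1 z) - (?Y b 2 0 z - 2 * ?Y b 1 1 z + ?Y b 0 2 z)"
  proof -
    have "has_partials (\<lambda>z. \<i> * ?Y b 1 0 z + (- \<i>) * ?Y b 0 1 z + b * ?Y (b - 1) 0 0 z)
      (\<i> * (?Y b (Suc 1) 0 z + ?Y b 1 (Suc 0) z) + (- \<i>) * (?Y b (Suc 0) 1 z + ?Y b 0 (Suc 1) z)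
         + b * (?Y (b - 1) (Suc 0) 0 z + ?Y (b - 1) 0 (Suc 0) z))
      (\<i> * (\<i> * ?Y b (Suc 1) 0 z + (- \<i>) * ?Y b 1 (Suc 0) z + b * ?Y (b - 1) 1 0 z)
       + (- \<i>) * (\<i> * ?Y b (Suc 0) 1 z + (- \<i>) * ?Y b 0 (Suc 1) z + b * ?Y (b - 1) 0 1 z)
       + b * (\<i> * ?Y (b - 1) (Suc 0) 0 z + (- \<i>) * ?Y (b - 1) 0 (Suc 0) z + (b - 1) * ?Y (b - 1 - 1) 0 0 z)) z"
      by (intro has_partials_add has_partials_cmult hp z)
    from has_partials_imp_deriv(2)[OF has_partials_transform[OF this z Fd(2)]]
    have "deriv_y (deriv_y ?F) z =
      \<i> * (\<i> * ?Y b (Suc 1) 0 z + (- \<i>) * ?Y b 1 (Suc 0) z + b * ?Y (b - 1) 1 0 z)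
       + (- \<i>) * (\<i> * ?Y b (Suc 0) 1 z + (- \<i>) * ?Y b 0 (Suc 1) z + b * ?Y (b - 1) 0 1 z)
       + b * (\<i> * ?Y (b - 1) (Suc 0) 0 z + (- \<i>) * ?Y (b - 1) 0 (Suc 0) z + (b - 1) * ?Y (b - 1 - 1) 0 0 z)"
      by simp
    moreover have "b - 1 - 1 = b - 2" by simp
    ultimately show ?thesis
      by (simp only: numeral_2_eq_2 One_nat_def) (simp add: algebra_simps)
  qed
  define y where "y = complex_of_real (Im z)"
  \<comment> \<open>\<open>Q\<close> is y^(b-2), the lowest power that occurs, so that all three
    exponents become polynomial multiples of it.\<close>
  define Q where "Q = y powr b / y\<^sup>2"
  have y0: "y \<noteq> 0" using z by (simp add: y_def uhp_def)
  have Y: "?Y b p q z = Q * y * y * ?G p q z" "?Y (b - 1) p q z = Q * y * ?G p q z" "?Y (b - 2) p q z = Q * ?G p q z" for p q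
    using y0 by (simp_all add: height_transform_def y_def[symmetric] Q_def powr_diff power2_eq_square)
  have rel: "2 * \<i> * (y * ?G 1 1 z) = b * ?G 1 0 z - (b + of_int l / 2) * ?G 0 1 z"
    using kernel_transform_relation[OF T, of z] z by (simp add: uhp_def y_def b_def mult.assoc)
  have "Laplacian l ?F z = 2 * \<i> * y * (Q * y * y) * (2 * \<i> * (y * ?G 1 1 z)) - b * (b - 1) * (Q * y * y) * ?G 0 0 z
       - 2 * \<i> * b * (Q * y * y) * y * (?G 1 0 z - ?G 0 1 z)
     + \<i> * of_int l * y * (Q * y * y) * ?G 0 1 z - of_int l / 2 * b * (Q * y * y) * ?G 0 0 z"
    unfolding Laplacian_def y_def[symmetric] xx yy Fd[OF z] Y power2_eq_square by (simp add: algebra_simps)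
  \<comment> \<open>Substituting the Euler-Poisson-Darboux equation for the mixed second derivative
    cancels both first-order terms; only multiples of the undifferentiated transform remain.\<close>
  also have "\<dots> = b * (1 - b - of_int l / 2) * (Q * y * y * ?G 0 0 z)"
    unfolding rel by (simp add: algebra_simps)
  also have "Q * y * y * ?G 0 0 z = ?F z"
    using poisson_transform_eq[OF T, of z] z y0 by (simp add: Q_def y_def b_def uhp_def power2_eq_square)
  also have "b * (1 - b - of_int l / 2) = (lam - of_int l / 4) * (1 - lam - of_int l / 4)"
    by (simp add: b_def field_simps)
  finally show ?thesis .
qed

section \<open>Equivariance\<close>

lemma csqrt_quadrants:
  shows "Im w > 0 \<Longrightarrow> Re (csqrt w) > 0 \<and> Im (csqrt w) > 0"
    and "Im w < 0 \<Longrightarrow> Re (csqrt w) > 0 \<and> Im (csqrt w) < 0"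
    and "Im w \<ge> 0 \<Longrightarrow> Re (csqrt w) \<ge> 0 \<and> Im (csqrt w) \<ge> 0"
proof -
  define v where "v = csqrt w"
  have "v\<^sup>2 = w" by (simp add: v_def)
  then have "Im w = 2 * (Re v * Im v)" by (auto simp: power2_eq_square)
  moreover have "0 < Re v \<or> Re v = 0 \<and> 0 \<le> Im v" unfolding v_def by (rule csqrt_principal)
  ultimately show "Im w > 0 \<Longrightarrow> Re (csqrt w) > 0 \<and> Im (csqrt w) > 0"
    "Im w < 0 \<Longrightarrow> Re (csqrt w) > 0 \<and> Im (csqrt w) < 0"
    "Im w \<ge> 0 \<Longrightarrow> Re (csqrt w) \<ge> 0 \<and> Im (csqrt w) \<ge> 0"
    unfolding v_def[symmetric] by (auto simp: zero_less_mult_iff mult_less_0_iff zero_le_mult_iff)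
qed

text \<open>Squares determine the product up to sign. A root in the open first quadrant times a
  nonzero one in the closed first quadrant has positive imaginary part, which fixes the
  sign.\<close>

lemma csqrt_mult_eqI_upper:
  assumes "Im w1 > 0" "Im w2 \<ge> 0" "w2 \<noteq> 0" "K\<^sup>2 = w1 * w2" "Im K > 0"
  shows "csqrt w1 * csqrt w2 = K"
proof -
  have "(csqrt w1 * csqrt w2)\<^sup>2 = K\<^sup>2" by (simp add: power_mult_distrib assms(4))
  then have "csqrt w1 * csqrt w2 = K \<or> csqrt w1 * csqrt w2 = - K" by (simp add: power2_eq_iff)
  moreover have "Im (csqrt w1 * csqrt w2) > 0"
  proof -
    have 1: "Re (csqrt w1) > 0" "Im (csqrt w1) > 0" using csqrt_quadrants(1)[OF assms(1)] by blast+
    have 2: "Re (csqrt w2) \<ge> 0" "Im (csqrt w2) \<ge> 0" using csqrt_quadrants(3)[OF assms(2)] by blast+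
    have "csqrt w2 \<noteq> 0" using assms(3) by simp
    then have "Re (csqrt w2) > 0 \<or> Im (csqrt w2) > 0" using 2 by (auto simp: complex_eq_iff less_le simp del: csqrt.sel)
    then show ?thesis using 1 2
      by (auto intro: add_pos_nonneg add_nonneg_pos simp del: csqrt.sel)
  qed
  ultimately show ?thesis using assms(5) by fastforce
qed

text \<open>Here the roots lie in the first and the fourth quadrant, so it is the real part of the
  product whose sign is known.\<close>

lemma csqrt_mult_eqI_lower:
  assumes "Im w1 > 0" "Im w2 < 0" "K\<^sup>2 = w1 * w2" "Re K > 0"
  shows "csqrt w1 * csqrt w2 = K"
proof -
  have "(csqrt w1 * csqrt w2)\<^sup>2 = K\<^sup>2" by (simp add: power_mult_distrib assms(3))
  then have "csqrt w1 * csqrt w2 = K \<or> csqrt w1 * csqrt w2 = - K" by (simp add: power2_eq_iff)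
  moreover have "Re (csqrt w1 * csqrt w2) > 0"
  proof -
    have 1: "Re (csqrt w1) > 0" "Im (csqrt w1) > 0" using csqrt_quadrants(1)[OF assms(1)] by blast+
    have 2: "Re (csqrt w2) > 0" "Im (csqrt w2) < 0" using csqrt_quadrants(2)[OF assms(2)] by blast+
    have "Re (csqrt w1) * Re (csqrt w2) > 0" "Im (csqrt w1) * Im (csqrt w2) < 0"
      using 1 2 by (auto simp: mult_pos_neg simp del: csqrt.sel)
    then show ?thesis by (simp del: csqrt.sel)
  qed
  ultimately show ?thesis using assms(4) by fastforce
qed

section \<open>The action on the half-plane and on the kernel\<close>

lemma aut_factor_Im: "Im (aut_factor g z) = g$2$1 * Im z"
  by (simp add: aut_factor_def)

lemma aut_factor_nonzero:
  assumes "det g = 1" "z \<in> uhp"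
  shows "aut_factor g z \<noteq> 0"
proof
  assume *: "aut_factor g z = 0"
  then have "g$2$1 = 0" using aut_factor_Im[of g z] assms(2) by (simp add: uhp_def)
  moreover from this have "g$2$2 = 0" using * by (simp add: aut_factor_def)
  ultimately show False using assms(1) by (simp add: det_2)
qed

lemma Im_moebius_act:
  assumes "det g = 1" "z \<in> uhp"
  shows "Im (moebius_act g z) = Im z / (cmod (aut_factor g z))\<^sup>2"
proof -
  define a b c d where "a = g$1$1" "b = g$1$2" "c = g$2$1" "d = g$2$2"
  have det: "a * d - b * c = 1" using assms(1) by (simp add: det_2 a_b_c_d_def)
  have "Im (moebius_act g z) = (Im (of_real a * z + of_real b) * Re (aut_factor g z)
      - Re (of_real a * z + of_real b) * Im (aut_factor g z)) / (cmod (aut_factor g z))\<^sup>2"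
    unfolding moebius_act_def Im_divide cmod_power2 a_b_c_d_def ..
  also have "Im (of_real a * z + of_real b) * Re (aut_factor g z)
      - Re (of_real a * z + of_real b) * Im (aut_factor g z) = (a * d - b * c) * Im z"
    by (simp add: aut_factor_def flip: a_b_c_d_def) (simp add: algebra_simps)
  finally show ?thesis by (simp add: det)
qed

lemma moebius_act_uhp:
  assumes "det g = 1" "z \<in> uhp"
  shows "moebius_act g z \<in> uhp"
  using Im_moebius_act[OF assms] aut_factor_nonzero[OF assms] assms(2)
  by (simp add: uhp_def)

lemma mp_root_mp_elt:
  assumes "det g = 1" "\<xi> ^ 4 = 1"
  shows "mp_root (mp_elt g \<xi>) = \<xi>"
  unfolding mp_root_def
proof (rule the_equality)
  show "\<xi> ^ 4 = 1 \<and> mp_elt g \<xi> = mp_elt (fst (mp_elt g \<xi>)) \<xi>"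
    using assms(2) by (simp add: mp_elt_def)
  fix \<eta> assume "\<eta> ^ 4 = 1 \<and> mp_elt g \<xi> = mp_elt (fst (mp_elt g \<xi>)) \<eta>"
  then have "snd (mp_elt g \<xi>) \<i> = snd (mp_elt g \<eta>) \<i>" by (simp add: mp_elt_def)
  moreover have "\<i> \<in> uhp" by (simp add: uhp_def)
  ultimately show "\<eta> = \<xi>"
    using aut_factor_nonzero[OF assms(1), of \<i>] by (simp add: mp_elt_def)
qed

text \<open>Complex \<open>powr\<close> is not multiplicative, but integer powers of square roots
  and powers of positive reals are. In this form the kernel can be merged with the metaplectic
  factor.\<close>

lemma poisson_kernel_csqrt:
  assumes "Im z > 0"
  shows "poisson_kernel lam l z u = of_real (Im z) powr (lam - of_int l / 4) *
     of_real (cmod (z - of_real u)) powr (- 2 * (lam - of_int l / 4)) * csqrt (z - of_real u) powi (- l)"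
proof -
  define w where "w = z - of_real u"
  have w: "w \<noteq> 0" using assms by (auto simp: w_def complex_eq_iff)
  have 1: "w powr (of_int l / 2) = csqrt w powi l"
    unfolding csqrt_exp_Ln[OF w] exp_power_int using w by (simp add: powr_def)
  have 2: "- 2 * (lam - of_int l / 4) = - (2 * lam - of_int l / 2)" by simp
  show ?thesis unfolding poisson_kernel_def w_def[symmetric] 1 2 powr_minus power_int_minus
    by (simp only: divide_inverse inverse_mult_distrib mult.assoc)
qed

lemma of_real_powr_mult:
  assumes "r > 0" "s > 0"
  shows "complex_of_real (r * s) powr a = of_real r powr a * of_real s powr a"
  using assms by (simp add: powr_times_real)

lemma of_real_powr_sqrt:
  assumes "r > 0"
  shows "complex_of_real (sqrt r) powi m = of_real r powr (of_int m / 2)"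
proof -
  have "complex_of_real (sqrt r) = exp (of_real (ln r / 2))"
    using assms by (simp add: exp_of_real ln_sqrt[symmetric])
  then show ?thesis using assms by (simp only: exp_power_int powr_def) (simp add: Ln_of_real)
qed

text \<open>Im gz contributes |cz+d|^(-2b), which is absorbed into the modulus of (gz - x)(cz + d);
  the remaining dependence on branches is confined to one product of square roots.\<close>

lemma poisson_kernel_moebius:
  assumes g: "det g = 1" and z: "z \<in> uhp"
  shows "poisson_kernel lam l (moebius_act g z) x * (\<xi> * csqrt (aut_factor g z)) powi (- l) =
     of_real (Im z) powr (lam - of_int l / 4) *
     of_real (cmod ((moebius_act g z - of_real x) * aut_factor g z)) powr (- 2 * (lam - of_int l / 4)) *
     (csqrt (moebius_act g z - of_real x) * csqrt (aut_factor g z)) powi (- l) * \<xi> powi (- l)"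
proof -
  define b where "b = lam - of_int l / 4"
  define j where "j = cmod (aut_factor g z)"
  have j: "j > 0" using aut_factor_nonzero[OF g z] by (simp add: j_def)
  have y: "Im z > 0" using z by (simp add: uhp_def)
  have y': "Im (moebius_act g z) > 0" using moebius_act_uhp[OF g z] by (simp add: uhp_def)
  define d where "d = cmod (moebius_act g z - of_real x)"
  have "moebius_act g z - of_real x \<noteq> 0" using y' by (auto simp: complex_eq_iff)
  then have d: "d > 0" by (simp add: d_def)
  have "of_real (Im z / j\<^sup>2) powr b = of_real (Im z) powr b * of_real j powr (- 2 * b)"
  proof -
    have "complex_of_real (Im z / j\<^sup>2) = of_real (Im z * (inverse j * inverse j))"
      by (simp add: power2_eq_square divide_inverse)
    also have "\<dots> powr b = of_real (Im z) powr b * (of_real (inverse j) powr b * of_real (inverse j) powr b)"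
      using y j by (subst of_real_powr_mult, simp, simp, subst of_real_powr_mult) auto
    also have "of_real (inverse j) powr b * of_real (inverse j) powr b = of_real j powr (- 2 * b)"
      using j by (simp add: powr_def Ln_of_real ln_inverse exp_add[symmetric] mult.assoc del: of_real_inverse)
    finally show ?thesis .
  qed
  moreover have "of_real (d * j) powr (- 2 * b) = of_real d powr (- 2 * b) * of_real j powr (- 2 * b)"
    using d j by (rule of_real_powr_mult)
  ultimately show ?thesis
    unfolding poisson_kernel_csqrt[OF y'] Im_moebius_act[OF g z] norm_mult power_int_mult_distrib
      b_def[symmetric] j_def[symmetric] d_def[symmetric] by (simp only: mult_ac)
qed

text \<open>All cases of the definition of \<open>pi_act\<close> amount to one identity: up to the sign fixed by the
  quadrants of the square roots, $\sqrt{gz-x}\,\sqrt{cz+d}$ is $\sqrt{|t|}\,\sqrt{z-g^{-1}x}$ times 1 or $\pm i$.\<close>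

lemma pi_act_poisson_kernel:
  assumes g: "det g = 1" and \<xi>: "\<xi> ^ 4 = 1" and z: "z \<in> uhp"
  shows "pi_act lam l (mp_elt g \<xi>) (poisson_kernel lam l z) =
     (\<lambda>x. (\<xi> * csqrt (aut_factor g z)) powi (- l) * poisson_kernel lam l (moebius_act g z) x)"
proof
  fix x
  define a b c d where "a = g$1$1" "b = g$1$2" "c = g$2$1" "d = g$2$2"
  define t where "t = - c * x + a"
  define be where "be = lam - of_int l / 4"
  define w1 where "w1 = moebius_act g z - of_real x"
  define w2 where "w2 = aut_factor g z"
  \<comment> \<open>Chosen so that \<open>\<kappa> * \<xi>\<close> is the base of the power -l in
    each case of \<open>pi_act\<close>. Its square is the sign of \<open>t\<close> when
    \<open>t\<close> is nonzero.\<close>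
  define \<kappa> where "\<kappa> = (if t > 0 then 1 else if t < 0 then (if c \<ge> 0 then \<i> else - \<i>) else if c < 0 then 1 else \<i>)"
  have det: "a * d - b * c = 1" using g by (simp add: det_2 a_b_c_d_def)
  have y: "Im z > 0" using z by (simp add: uhp_def)
  have w2: "w2 \<noteq> 0" "Im w2 = c * Im z" "w2 = of_real c * z + of_real d"
    using aut_factor_nonzero[OF g z] by (auto simp: w2_def aut_factor_Im a_b_c_d_def aut_factor_def)
  have w1: "Im w1 > 0" using moebius_act_uhp[OF g z] by (simp add: w1_def uhp_def)
  have w12: "w1 * w2 = of_real t * z - of_real (d * x - b)"
  proof -
    have "w1 * w2 = (of_real a * z + of_real b) - of_real x * w2"
      using w2(1) unfolding w1_def moebius_act_def w2_def[symmetric] left_diff_distrib a_b_c_d_def by simp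
    then show ?thesis by (simp add: w2(3) t_def algebra_simps)
  qed
  \<comment> \<open>Im w2 has the sign of c, so c >= 0 calls for the criterion by imaginary part and
    c < 0 for the one by real part. The case distinction on c in \<open>pi_act\<close> has this
    origin.\<close>
  have key: "csqrt w1 * csqrt w2 = K" if "K\<^sup>2 = w1 * w2" "c \<ge> 0 \<Longrightarrow> Im K > 0" "c < 0 \<Longrightarrow> Re K > 0" for K
    using csqrt_mult_eqI_upper[OF w1 _ w2(1) that(1)] csqrt_mult_eqI_lower[OF w1 _ that(1)] that(2,3) y w2(2)
    by (cases "c \<ge> 0") (auto simp: mult_neg_pos)
  have rhs: "(\<xi> * csqrt (aut_factor g z)) powi (- l) * poisson_kernel lam l (moebius_act g z) x =
     of_real (Im z) powr be * of_real (cmod (w1 * w2)) powr (- 2 * be) * (csqrt w1 * csqrt w2) powi (- l) * \<xi> powi (- l)"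
    using poisson_kernel_moebius[OF g z, of lam l x \<xi>] unfolding w1_def w2_def be_def by (simp add: mult.commute)
  \<comment> \<open>The factor sqrt r from the product of roots, raised to -l, supplies the
    difference between the exponents -2 be and -2 lam.\<close>
  have comb: "of_real r powr (- 2 * be) * complex_of_real (sqrt r) powi (- l) = of_real r powr (- 2 * lam)" if "r > 0" for r
  proof -
    have "- 2 * lam = - 2 * be + of_int (- l) / 2" by (simp add: be_def)
    then show ?thesis unfolding of_real_powr_sqrt[OF that] by (simp only: powr_add)
  qed
  show "pi_act lam l (mp_elt g \<xi>) (poisson_kernel lam l z) x =
     (\<xi> * csqrt (aut_factor g z)) powi (- l) * poisson_kernel lam l (moebius_act g z) x"
  proof (cases "t = 0")
    case False
    define v where "v = z - of_real ((d * x - b) / t)"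
    have v: "Im v > 0" "v \<noteq> 0" using y by (auto simp: v_def complex_eq_iff)
    have vt: "w1 * w2 = of_real t * v"
    proof -
      have "complex_of_real (d * x - b) = of_real t * of_real ((d * x - b) / t)"
        unfolding of_real_mult[symmetric] using False by simp
      then show ?thesis unfolding w12 v_def by (simp only: right_diff_distrib)
    qed
    have q: "Re (csqrt v) > 0" "Im (csqrt v) > 0" using csqrt_quadrants(1)[OF v(1)] by blast+
    have S: "csqrt w1 * csqrt w2 = \<kappa> * (of_real (sqrt \<bar>t\<bar>) * csqrt v)"
    proof (rule key)
      have "(of_real (sqrt \<bar>t\<bar>))\<^sup>2 = complex_of_real \<bar>t\<bar>" by (simp flip: of_real_power)
      moreover have "\<kappa>\<^sup>2 * of_real \<bar>t\<bar> = of_real t" using False by (auto simp: \<kappa>_def)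
      ultimately show "(\<kappa> * (of_real (sqrt \<bar>t\<bar>) * csqrt v))\<^sup>2 = w1 * w2"
        unfolding power_mult_distrib vt by (simp add: mult.assoc[symmetric])
    qed (use False q in \<open>auto simp: \<kappa>_def simp del: csqrt.sel\<close>)
    have "pi_act lam l (mp_elt g \<xi>) (poisson_kernel lam l z) x =
       of_real \<bar>t\<bar> powr (- 2 * lam) * poisson_kernel lam l z ((d * x - b) / t) * (\<kappa> * \<xi>) powi (- l)"
      using False unfolding pi_act_def mp_root_mp_elt[OF g \<xi>] Let_def
      by (auto simp: mp_elt_def \<kappa>_def t_def a_b_c_d_def)
    also have "\<dots> = of_real \<bar>t\<bar> powr (- 2 * lam) * (of_real (Im z) powr be * of_real (cmod v) powr (- 2 * be) *
        csqrt v powi (- l)) * (\<kappa> powi (- l) * \<xi> powi (- l))"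
      unfolding poisson_kernel_csqrt[OF y] v_def be_def power_int_mult_distrib ..
    also have "\<dots> = of_real (Im z) powr be * of_real (cmod (w1 * w2)) powr (- 2 * be) *
        (csqrt w1 * csqrt w2) powi (- l) * \<xi> powi (- l)"
    proof -
      have "of_real (cmod (w1 * w2)) powr (- 2 * be) = of_real \<bar>t\<bar> powr (- 2 * be) * of_real (cmod v) powr (- 2 * be)"
        unfolding vt norm_mult norm_of_real using False v(2) by (intro of_real_powr_mult) auto
      moreover have "\<bar>t\<bar> > 0" using False by simp
      note comb[OF this, symmetric]
      ultimately show ?thesis unfolding S power_int_mult_distrib by (simp only: mult_ac)
    qed
    finally show ?thesis unfolding rhs .
  next
    case True
    then have c0: "c \<noteq> 0" using det by (auto simp: t_def)
    \<comment> \<open>Here x is the image of infinity under g; the linear expression for w1 w2 loses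
      its z-term, and det = 1 determines the constant.\<close>
    have m: "w1 * w2 = - of_real (1 / c)"
    proof -
      have "(d * x - b) * c = 1" using True det by (simp add: t_def algebra_simps)
      then have "d * x - b = 1 / c" using c0 by (simp add: field_simps)
      then show ?thesis by (simp add: w12 True)
    qed
    have S: "csqrt w1 * csqrt w2 = \<kappa> * of_real (sqrt (inverse \<bar>c\<bar>))"
    proof (rule key)
      have "(of_real (sqrt (inverse \<bar>c\<bar>)))\<^sup>2 = complex_of_real (inverse \<bar>c\<bar>)" by (simp flip: of_real_power)
      then show "(\<kappa> * of_real (sqrt (inverse \<bar>c\<bar>)))\<^sup>2 = w1 * w2"
        unfolding power_mult_distrib m using True by (auto simp: \<kappa>_def divide_inverse)
    qed (use True c0 in \<open>auto simp: \<kappa>_def\<close>)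
    \<comment> \<open>The preimage of x is infinity, so the value comes from the extension;
      \<open>mixed_kernel_inf\<close> with p = q = 0 equals 1 at 0.\<close>
    have ext: "f_inf_ext lam l (poisson_kernel lam l z) 0 = of_real (Im z) powr be"
    proof -
      have "smooth_ext_f_inf lam l (poisson_kernel lam l z)
         (\<lambda>x. of_real (Im z) powr be * mixed_kernel_inf (lam + of_int l / 4) (lam - of_int l / 4) 0 0 z x)"
        using smooth_ext_mixed_kernel[OF y, of lam l 0 0]
        unfolding poisson_kernel_eq[OF y] smooth_ext_f_inf_def be_def
        by (auto simp: f_inf_cmult intro!: smooth_on_mult smooth_on_const)
      from f_inf_ext_eq[OF this] show ?thesis by (simp add: mixed_kernel_inf_def)
    qed
    have "pi_act lam l (mp_elt g \<xi>) (poisson_kernel lam l z) x =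
       of_real \<bar>c\<bar> powr (2 * lam) * of_real (Im z) powr be * (\<kappa> * \<xi>) powi (- l)"
      using True unfolding pi_act_def mp_root_mp_elt[OF g \<xi>] Let_def ext
      by (auto simp: mp_elt_def \<kappa>_def t_def a_b_c_d_def)
    also have "of_real \<bar>c\<bar> powr (2 * lam) = of_real (inverse \<bar>c\<bar>) powr (- 2 * lam)"
      using c0 by (simp add: powr_def Ln_of_real ln_inverse del: of_real_inverse)
    also have "\<dots> = of_real (inverse \<bar>c\<bar>) powr (- 2 * be) * complex_of_real (sqrt (inverse \<bar>c\<bar>)) powi (- l)"
      using c0 by (intro comb[symmetric]) simp
    finally have pi: "pi_act lam l (mp_elt g \<xi>) (poisson_kernel lam l z) x =
       of_real (inverse \<bar>c\<bar>) powr (- 2 * be) * complex_of_real (sqrt (inverse \<bar>c\<bar>)) powi (- l) *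
       of_real (Im z) powr be * (\<kappa> * \<xi>) powi (- l)" .
    have n: "cmod (w1 * w2) = inverse \<bar>c\<bar>" unfolding m by (simp add: norm_divide divide_inverse norm_inverse)
    show ?thesis unfolding rhs n S pi unfolding power_int_mult_distrib by (simp only: mult_ac)
  qed
qed

section \<open>Cocycle relation and inverses in the metaplectic group\<close>

lemma aut_factor_mult:
  assumes "aut_factor h z \<noteq> 0"
  shows "aut_factor (g ** h) z = aut_factor g (moebius_act h z) * aut_factor h z"
proof -
  define u where "u = aut_factor h z"
  have "aut_factor g (moebius_act h z) * u =
      of_real (g$2$1) * (of_real (h$1$1) * z + of_real (h$1$2)) + of_real (g$2$2) * u"
    using assms unfolding aut_factor_def[of g] moebius_act_def u_def[symmetric] by (simp add: distrib_right)
  then show ?thesis unfolding u_def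
    by (simp add: aut_factor_def matrix_matrix_mult_def sum_2 algebra_simps)
qed

lemma moebius_act_mult:
  assumes "aut_factor h z \<noteq> 0"
  shows "moebius_act (g ** h) z = moebius_act g (moebius_act h z)"
proof -
  define u where "u = aut_factor h z"
  have "(of_real (g$1$1) * moebius_act h z + of_real (g$1$2)) * u =
      of_real (g$1$1) * (of_real (h$1$1) * z + of_real (h$1$2)) + of_real (g$1$2) * u"
    using assms unfolding moebius_act_def u_def[symmetric] by (simp add: distrib_right)
  also have "\<dots> = of_real ((g ** h)$1$1) * z + of_real ((g ** h)$1$2)"
    unfolding u_def by (simp add: aut_factor_def matrix_matrix_mult_def sum_2 algebra_simps)
  finally show ?thesis
    using assms unfolding moebius_act_def[of "g ** h"] moebius_act_def[of g] aut_factor_mult[OF assms]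
    by (metis nonzero_mult_divide_mult_cancel_right u_def)
qed

lemma aut_factor_mat_1: "aut_factor (mat 1) z = 1"
  and moebius_act_mat_1: "moebius_act (mat 1) z = z"
  by (simp_all add: aut_factor_def moebius_act_def mat_def)

definition adj2 :: "real^2^2 \<Rightarrow> real^2^2" where
  "adj2 g = vector [vector [g$2$2, - g$1$2], vector [- g$2$1, g$1$1]]"

lemma adj2_mult:
  assumes "det g = 1"
  shows "adj2 g ** g = mat 1" "g ** adj2 g = mat 1" "det (adj2 g) = 1"
  using assms by (auto simp: adj2_def vec_eq_iff forall_2 matrix_matrix_mult_def sum_2 mat_def det_2 algebra_simps)

lemma moebius_act_adj2:
  assumes "det g = 1" "z \<in> uhp"
  shows "moebius_act (adj2 g) (moebius_act g z) = z" "moebius_act g (moebius_act (adj2 g) z) = z"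
    "aut_factor (adj2 g) (moebius_act g z) = inverse (aut_factor g z)"
proof -
  note nz = aut_factor_nonzero[OF assms] aut_factor_nonzero[OF adj2_mult(3)[OF assms(1)] assms(2)]
  show "moebius_act (adj2 g) (moebius_act g z) = z" "moebius_act g (moebius_act (adj2 g) z) = z"
    using moebius_act_mult[OF nz(1), of "adj2 g"] moebius_act_mult[OF nz(2), of g]
    by (simp_all add: adj2_mult[OF assms(1)] moebius_act_mat_1)
  show "aut_factor (adj2 g) (moebius_act g z) = inverse (aut_factor g z)"
    using aut_factor_mult[OF nz(1), of "adj2 g"] nz(1)
    by (simp add: adj2_mult[OF assms(1)] aut_factor_mat_1 field_simps)
qed

text \<open>The principal root commutes with inversion off the negative axis. The factor cz + d lies
  on that axis only if c = 0 and d < 0, where one root is a positive multiple of i for each of the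
  two numbers.\<close>

lemma csqrt_aut_factor_inverse:
  assumes "det g = 1" "z \<in> uhp"
  shows "csqrt (inverse (aut_factor g z)) * csqrt (aut_factor g z) =
    (if g$2$1 = 0 \<and> g$2$2 < 0 then - 1 else 1)"
proof (cases "aut_factor g z \<in> \<real>\<^sub>\<le>\<^sub>0")
  case False
  then have "\<not> (g$2$1 = 0 \<and> g$2$2 < 0)" by (auto simp: aut_factor_def complex_nonpos_Reals_iff)
  then show ?thesis using False aut_factor_nonzero[OF assms] by (auto simp: csqrt_inverse)
next
  case True
  then have "Im (aut_factor g z) = 0" by (simp add: complex_nonpos_Reals_iff)
  then have c: "g$2$1 = 0" using assms(2) by (simp add: aut_factor_Im uhp_def)
  then have w: "aut_factor g z = of_real (g$2$2)" by (simp add: aut_factor_def)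
  then have d: "g$2$2 < 0" using True aut_factor_nonzero[OF assms] by (auto simp: complex_nonpos_Reals_iff less_le)
  have "csqrt (of_real (inverse (g$2$2))) * csqrt (of_real (g$2$2)) = - of_real (sqrt \<bar>inverse (g$2$2)\<bar> * sqrt \<bar>g$2$2\<bar>)"
    unfolding csqrt_of_real' using d by (simp add: algebra_simps)
  also have "sqrt \<bar>inverse (g$2$2)\<bar> * sqrt \<bar>g$2$2\<bar> = 1" using d by (simp flip: real_sqrt_mult)
  finally show ?thesis using c d by (simp add: w)
qed

text \<open>If c = 0 the factor cz + d is constant; otherwise it is never real on the half-plane and
  the principal root is holomorphic along it.\<close>

lemma mp_elt_carrier:
  assumes "det g = 1" "\<xi> ^ 4 = 1"
  shows "mp_elt g \<xi> \<in> carrier Gtilde"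
proof -
  have "(\<lambda>z. \<xi> * csqrt (aut_factor g z)) holomorphic_on uhp"
  proof (cases "g$2$1 = 0")
    case True
    then show ?thesis by (simp add: aut_factor_def)
  next
    case False
    have "(csqrt \<circ> aut_factor g) holomorphic_on uhp"
    proof (rule holomorphic_on_compose_gen[OF _ holomorphic_on_csqrt])
      show "aut_factor g holomorphic_on uhp" unfolding aut_factor_def by (intro holomorphic_intros)
      show "aut_factor g ` uhp \<subseteq> - \<real>\<^sub>\<le>\<^sub>0"
        using False aut_factor_Im by (fastforce simp: uhp_def complex_nonpos_Reals_iff)
    qed
    then have "(\<lambda>z. csqrt (aut_factor g z)) holomorphic_on uhp" by (simp add: o_def)
    then show ?thesis by (rule holomorphic_on_mult[OF holomorphic_on_const])
  qed
  then have "restrict (\<lambda>z. \<xi> * csqrt (aut_factor g z)) uhp holomorphic_on uhp"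
    by (simp cong: holomorphic_cong)
  moreover have "(\<xi> * csqrt w) ^ 4 = w\<^sup>2" for w
  proof -
    have "(\<xi> * csqrt w) ^ 4 = \<xi> ^ 4 * ((csqrt w)\<^sup>2)\<^sup>2" by (simp only: power_mult_distrib power_mult[symmetric]) simp
    then show ?thesis by (simp add: assms(2))
  qed
  ultimately show ?thesis using assms(1) by (simp add: Gtilde_def mp_elt_def)
qed

text \<open>The root of the inverse is the inverse root, corrected by the sign \<delta> where the
  principal root fails to commute with inversion. Uniqueness of the inverse is read off pointwise: g
  maps the half-plane onto itself, so the product relation determines the second component
  everywhere.\<close>

lemma inv_mp_elt:
  assumes g: "det g = 1" and \<xi>: "\<xi> ^ 4 = 1"
  obtains \<xi>' where "\<xi>' ^ 4 = 1" "inv\<^bsub>Gtilde\<^esub> (mp_elt g \<xi>) = mp_elt (adj2 g) \<xi>'"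
    "\<And>z. z \<in> uhp \<Longrightarrow> (\<xi>' * csqrt (aut_factor (adj2 g) (moebius_act g z))) * (\<xi> * csqrt (aut_factor g z)) = 1"
proof -
  define \<delta> where "\<delta> = (if g$2$1 = 0 \<and> g$2$2 < 0 then - 1 else 1 :: complex)"
  define \<xi>' where "\<xi>' = \<delta> * inverse \<xi>"
  have \<xi>0: "\<xi> \<noteq> 0" using \<xi> by auto
  have \<xi>'4: "\<xi>' ^ 4 = 1" by (simp add: \<xi>'_def \<delta>_def power_mult_distrib power_inverse \<xi>)
  have rel: "(\<xi>' * csqrt (aut_factor (adj2 g) (moebius_act g z))) * (\<xi> * csqrt (aut_factor g z)) = 1"
    if "z \<in> uhp" for z
  proof -
    have "(\<xi>' * csqrt (aut_factor (adj2 g) (moebius_act g z))) * (\<xi> * csqrt (aut_factor g z))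
       = \<delta> * (inverse \<xi> * \<xi>) * (csqrt (inverse (aut_factor g z)) * csqrt (aut_factor g z))"
      unfolding moebius_act_adj2(3)[OF g that] \<xi>'_def by (simp only: mult_ac)
    also have "\<dots> = \<delta> * \<delta>" using \<xi>0 unfolding csqrt_aut_factor_inverse[OF g that] \<delta>_def[symmetric] by simp
    finally show ?thesis by (simp add: \<delta>_def split: if_splits)
  qed
  note g' = adj2_mult[OF g]
  have "inv\<^bsub>Gtilde\<^esub> (mp_elt g \<xi>) = mp_elt (adj2 g) \<xi>'"
    unfolding m_inv_def
  proof (rule the_equality)
    have "mp_elt g \<xi> \<otimes>\<^bsub>Gtilde\<^esub> mp_elt (adj2 g) \<xi>' = \<one>\<^bsub>Gtilde\<^esub>"
    proof -
      have "(\<xi> * csqrt (aut_factor g (moebius_act (adj2 g) z))) * (\<xi>' * csqrt (aut_factor (adj2 g) z)) = 1"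
        if "z \<in> uhp" for z
        using rel[of "moebius_act (adj2 g) z"] moebius_act_uhp[OF g'(3) that] moebius_act_adj2(2)[OF g that]
        by (simp add: mult.commute)
      then show ?thesis using moebius_act_uhp[OF g'(3)]
        by (auto simp: Gtilde_def mp_elt_def g' fun_eq_iff)
    qed
    moreover have "mp_elt (adj2 g) \<xi>' \<otimes>\<^bsub>Gtilde\<^esub> mp_elt g \<xi> = \<one>\<^bsub>Gtilde\<^esub>"
      using rel moebius_act_uhp[OF g] by (auto simp: Gtilde_def mp_elt_def g' fun_eq_iff)
    ultimately show "mp_elt (adj2 g) \<xi>' \<in> carrier Gtilde \<and>
        mp_elt g \<xi> \<otimes>\<^bsub>Gtilde\<^esub> mp_elt (adj2 g) \<xi>' = \<one>\<^bsub>Gtilde\<^esub> \<and>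
        mp_elt (adj2 g) \<xi>' \<otimes>\<^bsub>Gtilde\<^esub> mp_elt g \<xi> = \<one>\<^bsub>Gtilde\<^esub>"
      using mp_elt_carrier[OF g'(3) \<xi>'4] by blast
  next
    fix y assume y: "y \<in> carrier Gtilde \<and> mp_elt g \<xi> \<otimes>\<^bsub>Gtilde\<^esub> y = \<one>\<^bsub>Gtilde\<^esub> \<and>
        y \<otimes>\<^bsub>Gtilde\<^esub> mp_elt g \<xi> = \<one>\<^bsub>Gtilde\<^esub>"
    obtain h \<psi> where y_eq: "y = (h, \<psi>)" by (cases y)
    have "h ** g = mat 1" and e: "restrict (\<lambda>z. \<psi> (moebius_act g z) * snd (mp_elt g \<xi>) z) uhp = restrict (\<lambda>z. 1) uhp"
      using y by (auto simp: y_eq Gtilde_def mp_elt_def)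
    then have h: "h = adj2 g" by (metis g'(2) matrix_mul_assoc matrix_mul_lid matrix_mul_rid)
    have "\<psi> w = \<xi>' * csqrt (aut_factor (adj2 g) w)" if "w \<in> uhp" for w
    proof -
      define z where "z = moebius_act (adj2 g) w"
      have z: "z \<in> uhp" "moebius_act g z = w"
        unfolding z_def by (rule moebius_act_uhp[OF g'(3) that], rule moebius_act_adj2(2)[OF g that])
      have "\<psi> w * (\<xi> * csqrt (aut_factor g z)) = 1"
        using fun_cong[OF e, of z] z by (simp add: mp_elt_def)
      moreover have "(\<xi>' * csqrt (aut_factor (adj2 g) w)) * (\<xi> * csqrt (aut_factor g z)) = 1"
        using rel[OF z(1)] z(2) by simp
      ultimately show ?thesis by (metis mult_right_cancel zero_neq_one mult_zero_right)
    qed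
    moreover have "\<psi> \<in> extensional uhp" using y by (simp add: y_eq Gtilde_def)
    ultimately have "\<psi> = restrict (\<lambda>w. \<xi>' * csqrt (aut_factor (adj2 g) w)) uhp"
      by (auto simp: fun_eq_iff extensional_def)
    then show "y = mp_elt (adj2 g) \<xi>'" by (simp add: y_eq h mp_elt_def)
  qed
  with that \<xi>'4 rel show ?thesis by blast
qed

text \<open>\<open>pi_star\<close> acts through the inverse element, which carries the kernel at gz
  back to the kernel at z. So k F(gz) is F(z) times the automorphy factor of the inverse at gz, and
  that factor cancels against the one in \<open>slash\<close>. The eigenvalue k thereby ends up on
  the other side, hence the inverse character.\<close>

lemma slash_poisson_transform:
  assumes T: "distribution_on lam l T" and g: "det g = 1" and \<xi>: "\<xi> ^ 4 = 1" and "k \<noteq> 0"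
    and aut: "\<And>f. f \<in> test_space lam l \<Longrightarrow> pi_star lam l (mp_elt g \<xi>) T f = k * T f"
    and z: "z \<in> uhp"
  shows "slash l (poisson_transform lam l T) (mp_elt g \<xi>) z = inverse k * poisson_transform lam l T z"
proof -
  obtain \<xi>' where \<xi>': "\<xi>' ^ 4 = 1" "inv\<^bsub>Gtilde\<^esub> (mp_elt g \<xi>) = mp_elt (adj2 g) \<xi>'"
    "\<And>z. z \<in> uhp \<Longrightarrow> (\<xi>' * csqrt (aut_factor (adj2 g) (moebius_act g z))) * (\<xi> * csqrt (aut_factor g z)) = 1"
    using inv_mp_elt[OF g \<xi>] by blast
  define w where "w = moebius_act g z"
  define \<phi> where "\<phi> = \<xi> * csqrt (aut_factor g z)"
  have w: "w \<in> uhp" unfolding w_def by (rule moebius_act_uhp[OF g z])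
  then have wi: "Im w > 0" and zi: "Im z > 0" using z by (auto simp: uhp_def)
  have "pi_act lam l (mp_elt (adj2 g) \<xi>') (poisson_kernel lam l w) =
     (\<lambda>x. (\<xi>' * csqrt (aut_factor (adj2 g) w)) powi (- l) * poisson_kernel lam l (moebius_act (adj2 g) w) x)"
    by (rule pi_act_poisson_kernel[OF adj2_mult(3)[OF g] \<xi>'(1) w])
  also have "moebius_act (adj2 g) w = z" unfolding w_def by (rule moebius_act_adj2(1)[OF g z])
  finally have kF: "k * poisson_transform lam l T w = (\<xi>' * csqrt (aut_factor (adj2 g) w)) powi (- l) * poisson_transform lam l T z"
    using aut[OF poisson_kernel_test_space[OF wi]]
      distribution_on_linear(2)[OF T poisson_kernel_test_space[OF zi]]
    by (simp add: pi_star_def \<xi>'(2) poisson_transform_def)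
  have m1: "(\<xi>' * csqrt (aut_factor (adj2 g) w)) powi (- l) * \<phi> powi (- l) = 1"
    using \<xi>'(3)[OF z] by (simp add: w_def \<phi>_def flip: power_int_mult_distrib)
  have "k * (poisson_transform lam l T w * \<phi> powi (- l)) = (k * poisson_transform lam l T w) * \<phi> powi (- l)"
    by simp
  also have "\<dots> = ((\<xi>' * csqrt (aut_factor (adj2 g) w)) powi (- l) * \<phi> powi (- l)) * poisson_transform lam l T z"
    unfolding kF by (simp only: mult_ac)
  finally have "k * (poisson_transform lam l T w * \<phi> powi (- l)) = poisson_transform lam l T z"
    unfolding m1 by simp
  moreover have "slash l (poisson_transform lam l T) (mp_elt g \<xi>) z = poisson_transform lam l T w * \<phi> powi (- l)"
    using z by (simp add: slash_def mp_elt_def w_def \<phi>_def)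
  ultimately show ?thesis using \<open>k \<noteq> 0\<close> by (simp add: field_simps)
qed

section \<open>The congruence subgroup\<close>

lemma real_mat_nth: "real_mat A $ i $ j = of_int (A $ i $ j)"
  by (simp add: real_mat_def)

lemma det_real_mat: "det (real_mat A) = of_int (det A)"
  by (simp add: det_2 real_mat_nth)

lemma Gamma0_coprime:
  assumes "A \<in> Gamma0 N"
  shows "coprime (A$2$1) (A$2$2)" "coprime (A$2$2) (int N)"
proof -
  have det: "A$1$1 * A$2$2 - A$1$2 * A$2$1 = 1" and N: "int N dvd A$2$1"
    using assms by (auto simp: Gamma0_def det_2)
  show c: "coprime (A$2$1) (A$2$2)"
    by (rule coprimeI) (metis det dvd_diff dvd_mult)
  show "coprime (A$2$2) (int N)"
    using coprime_divisors[OF N dvd_refl c] by (simp add: coprime_commute)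
qed

text \<open>Coprimality excludes the value 0 of each Legendre symbol; this makes the factor in
  \<open>Gamma0_tilde\<close> a fourth root of unity for odd \<open>l\<close>.\<close>

lemma shimura_symbol_cases:
  assumes "coprime c d"
  shows "shimura_symbol c d \<in> {1, - 1}"
proof -
  have "(\<Prod>p\<in>#M. Legendre c p) \<in> {1, - 1}" if "\<forall>p\<in>#M. prime p \<and> p dvd d" for M
    using that
  proof (induction M)
    case (add p M)
    have "\<not> p dvd c" using add.prems assms by (metis coprime_common_divisor not_prime_unit union_single_eq_member)
    then have "Legendre c p \<in> {1, - 1}" by (auto simp: Legendre_def cong_0_iff)
    with add show ?case by auto
  qed simp
  from this[of "prime_factorization \<bar>d\<bar>"] have "(\<Prod>p\<in>#prime_factorization \<bar>d\<bar>. Legendre c p) \<in> {1, - 1}"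
    by (auto simp: in_prime_factors_iff)
  then show ?thesis by (auto simp: shimura_symbol_def)
qed

lemma Gamma0_tilde_elim:
  assumes "\<gamma> \<in> Gamma0_tilde l N"
  obtains A \<xi> where "A \<in> Gamma0 N" "\<xi> ^ 4 = 1" "\<gamma> = mp_elt (real_mat A) \<xi>"
proof (cases "even l")
  case True
  then obtain A \<xi> where A: "A \<in> Gamma0 N" "\<xi> \<in> {1, - 1}" "\<gamma> = mp_elt (real_mat A) \<xi>"
    using assms by (auto simp: Gamma0_tilde_def)
  then have "\<xi> ^ 4 = 1" by auto
  with A that show ?thesis by blast
next
  case False
  then obtain A where A: "A \<in> Gamma0 N"
    "\<gamma> = mp_elt (real_mat A) (inverse (eps (A$2$2)) * of_int (shimura_symbol (A$2$1) (A$2$2)))"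
    using assms by (auto simp: Gamma0_tilde_def)
  have "(inverse (eps (A$2$2)) * of_int (shimura_symbol (A$2$1) (A$2$2))) ^ 4 = 1"
    using shimura_symbol_cases[OF Gamma0_coprime(1)[OF A(1)]]
    by (auto simp: eps_def power_mult_distrib power_inverse)
  with A that show ?thesis by blast
qed

lemma Gamma0_tilde_lift:
  assumes "A \<in> Gamma0 N"
  shows "\<exists>\<xi>. mp_elt (real_mat A) \<xi> \<in> Gamma0_tilde l N"
  using assms by (cases "even l") (auto simp: Gamma0_tilde_def)

lemma char_tilde_mp_elt: "char_tilde chi (mp_elt (real_mat A) \<xi>) = chi (A$2$2)"
  by (simp add: char_tilde_def mp_elt_def real_mat_nth)

lemma slash_poisson_transform_Gamma0:
  assumes T: "distribution_on lam l T" and aut: "automorphic_dist lam l N chi T"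
    and chi: "dirichlet_char N chi" and \<gamma>: "\<gamma> \<in> Gamma0_tilde l N" and z: "z \<in> uhp"
  shows "slash l (poisson_transform lam l T) \<gamma> z = inverse (char_tilde chi \<gamma>) * poisson_transform lam l T z"
proof -
  obtain A \<xi> where A: "A \<in> Gamma0 N" "\<xi> ^ 4 = 1" "\<gamma> = mp_elt (real_mat A) \<xi>"
    using Gamma0_tilde_elim[OF \<gamma>] by blast
  have "chi (A$2$2) \<noteq> 0" using chi Gamma0_coprime(2)[OF A(1)] by (auto simp: dirichlet_char_def)
  then have "char_tilde chi \<gamma> \<noteq> 0" by (simp add: A(3) char_tilde_mp_elt)
  moreover have "det (real_mat A) = 1" using A(1) by (simp add: det_real_mat Gamma0_def)
  ultimately show ?thesis
    using aut \<gamma> slash_poisson_transform[OF T _ A(2), of "real_mat A" "char_tilde chi \<gamma>" z] z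
    unfolding A(3)[symmetric] by (auto simp: automorphic_dist_def)
qed

section \<open>Growth at the cusps\<close>

lemma kernel_transform_growth:
  assumes T: "distribution_on lam l T"
  obtains C k where "C \<ge> 0" "\<And>z. z \<in> uhp \<Longrightarrow> cmod (kernel_transform lam l T 0 0 z) \<le> C * uhp_height z ^ k"
proof -
  define a where "a = lam + of_int l / 4"
  define b where "b = lam - of_int l / 4"
  have ab: "a + b = 2 * lam" by (simp add: a_def b_def)
  obtain M C where C: "C \<ge> 0"
    "\<And>f B. f \<in> test_space lam l \<Longrightarrow> \<forall>x. weighted_jet M lam f x \<le> B \<Longrightarrow> cmod (T f) \<le> C * B"
    using distribution_bound[OF T] by blast
  have "\<forall>j. \<exists>D k. D \<ge> 0 \<and> (\<forall>z u. Im z > 0 \<longrightarrow>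
      (1 + u\<^sup>2) powr Re lam * cmod (mixed_kernel_D a b j 0 0 z u) \<le> D * uhp_height z ^ k)"
    using mixed_kernel_D_poly_bounded[OF ab] unfolding poly_bounded_def by blast
  then obtain D k where D: "\<And>j. D j \<ge> 0" "\<And>j z u. Im z > 0 \<Longrightarrow>
      (1 + u\<^sup>2) powr Re lam * cmod (mixed_kernel_D a b j 0 0 z u) \<le> D j * uhp_height z ^ k j"
    by metis
  have "cmod (kernel_transform lam l T 0 0 z) \<le> C * (\<Sum>j\<le>M. D j) * uhp_height z ^ (\<Sum>j\<le>M. k j)" if "z \<in> uhp" for z
  proof -
    have z: "Im z > 0" using that by (simp add: uhp_def)
    have "cmod (T (mixed_kernel a b 0 0 z)) \<le> C * ((\<Sum>j\<le>M. D j) * uhp_height z ^ (\<Sum>j\<le>M. k j))"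
    proof (rule C(2), unfold a_def b_def, rule mixed_kernel_test_space[OF z], fold a_def b_def, rule)
      fix u
      show "weighted_jet M lam (mixed_kernel a b 0 0 z) u \<le> (\<Sum>j\<le>M. D j) * uhp_height z ^ (\<Sum>j\<le>M. k j)"
        unfolding weighted_jet_def D_op_funpow_mixed_kernel[OF z a_def b_def] sum_distrib_left sum_distrib_right
      proof (intro sum_mono)
        fix j assume j: "j \<in> {..M}"
        have "(1 + u\<^sup>2) powr Re lam * cmod (mixed_kernel_D a b j 0 0 z u) \<le> D j * uhp_height z ^ k j"
          by (rule D(2)[OF z])
        also have "\<dots> \<le> D j * uhp_height z ^ (\<Sum>j\<le>M. k j)"
          using D(1) uhp_height_bounds(1)[OF z] j
          by (intro mult_left_mono power_increasing member_le_sum) auto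
        finally show "(1 + u\<^sup>2) powr Re lam * cmod (mixed_kernel_D a b j 0 0 z u) \<le> D j * uhp_height z ^ (\<Sum>j\<le>M. k j)" .
      qed
    qed
    then show ?thesis by (simp add: kernel_transform_def a_def b_def mult.assoc)
  qed
  moreover have "C * (\<Sum>j\<le>M. D j) \<ge> 0" using C(1) D(1) by (simp add: sum_nonneg)
  ultimately show ?thesis using that by blast
qed

text \<open>The prefactor is a power of Im z with exponent of unknown sign; both Im z and 1 / Im z
  are at most the height.\<close>

lemma poisson_transform_growth:
  assumes T: "distribution_on lam l T"
  obtains C k where "C \<ge> 0" "\<And>z. z \<in> uhp \<Longrightarrow> cmod (poisson_transform lam l T z) \<le> C * uhp_height z ^ k"
proof -
  obtain C k where C: "C \<ge> 0" "\<And>z. z \<in> uhp \<Longrightarrow> cmod (kernel_transform lam l T 0 0 z) \<le> C * uhp_height z ^ k"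
    using kernel_transform_growth[OF T] by blast
  define s where "s = Re (lam - of_int l / 4)"
  define n where "n = nat \<lceil>\<bar>s\<bar>\<rceil>"
  have "cmod (poisson_transform lam l T z) \<le> C * uhp_height z ^ (n + k)" if "z \<in> uhp" for z
  proof -
    have z: "Im z > 0" using that by (simp add: uhp_def)
    have R: "uhp_height z \<ge> 1" by (rule uhp_height_bounds(1)[OF z])
    have "Im z \<le> uhp_height z" using uhp_height_bounds(2)[OF z] abs_Im_le_cmod[of z] by linarith
    then have "Im z powr s \<le> uhp_height z powr \<bar>s\<bar>"
      by (intro powr_le_powr_abs z uhp_height_bounds(4)[OF z])
    also have "\<dots> \<le> uhp_height z powr real n" using R by (intro powr_mono) (auto simp: n_def)
    also have "\<dots> = uhp_height z ^ n" using R by (intro powr_realpow) auto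
    finally have "Im z powr s * cmod (kernel_transform lam l T 0 0 z) \<le> uhp_height z ^ n * (C * uhp_height z ^ k)"
      using R by (intro mult_mono C that) auto
    moreover have "cmod (poisson_transform lam l T z) = Im z powr s * cmod (kernel_transform lam l T 0 0 z)"
      unfolding poisson_transform_eq[OF T z] norm_mult using z by (simp add: norm_powr_real_powr s_def)
    ultimately show ?thesis by (simp add: power_add mult_ac)
  qed
  then show ?thesis using that C(1) by blast
qed

lemma cmod_slash_mp_elt:
  assumes "z \<in> uhp" "cmod \<xi> = 1"
  shows "cmod (slash l F (mp_elt g \<xi>) z) = cmod (F (moebius_act g z)) * sqrt (cmod (aut_factor g z)) powi (- l)"
  using assms by (simp add: slash_def mp_elt_def norm_mult norm_power_int norm_csqrt del: csqrt.sel)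

definition trans_mat :: "real \<Rightarrow> real^2^2" where
  "trans_mat t = vector [vector [1, t], vector [0, 1]]"

lemma trans_mat_act: "aut_factor (trans_mat t) z = 1" "moebius_act (trans_mat t) z = z + of_real t"
  by (simp_all add: aut_factor_def moebius_act_def trans_mat_def)

text \<open>The translation by N, conjugated by A, lies in Gamma0(N) with lower right entry
  congruent to 1, so the character is trivial on it. Its metaplectic root has modulus 1 and
  disappears from the absolute value.\<close>

lemma slash_poisson_transform_periodic:
  assumes T: "distribution_on lam l T" and aut: "automorphic_dist lam l N chi T"
    and chi: "dirichlet_char N chi" and A: "det A = 1" and z: "z \<in> uhp"
  shows "cmod (slash l (poisson_transform lam l T) (mp_elt (real_mat A) 1) (z + of_nat N)) =
    cmod (slash l (poisson_transform lam l T) (mp_elt (real_mat A) 1) z)"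
proof -
  define G where "G = real_mat A"
  define a b c d where "a = A$1$1" "b = A$1$2" "c = A$2$1" "d = A$2$2"
  \<comment> \<open>A times the translation by N times the inverse of A, that is, the identity plus
    N times the column (a, c) times the row (-c, a).\<close>
  define B :: "int^2^2" where "B = vector [vector [1 - int N * a * c, int N * a * a], vector [- int N * c * c, 1 + int N * a * c]]"
  let ?F = "poisson_transform lam l T"
  have det: "a * d - b * c = 1" using A by (simp add: det_2 a_b_c_d_def)
  have B: "B \<in> Gamma0 N" by (simp add: Gamma0_def B_def det_2 algebra_simps)
  have G1: "det G = 1" using A by (simp add: G_def det_real_mat)
  have "real_mat B ** G = G ** trans_mat (real N)"
  proof -
    have 1: "(1 - int N * a * c) * a + int N * a * a * c = a" "(- int N * c * c) * a + (1 + int N * a * c) * c = c"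
      by (simp_all add: algebra_simps)
    have "(1 - int N * a * c) * b + int N * a * a * d = int N * a * (a * d - b * c) + b"
      "(- int N * c * c) * b + (1 + int N * a * c) * d = int N * c * (a * d - b * c) + d"
      by (simp_all add: algebra_simps)
    then have 2: "(1 - int N * a * c) * b + int N * a * a * d = a * int N + b"
      "(- int N * c * c) * b + (1 + int N * a * c) * d = c * int N + d"
      unfolding det by simp_all
    note eqs = 1[THEN arg_cong[of _ _ real_of_int]] 2[THEN arg_cong[of _ _ real_of_int]]
    show ?thesis
      using eqs by (simp add: vec_eq_iff forall_2 matrix_matrix_mult_def sum_2 real_mat_nth G_def B_def trans_mat_def
          flip: a_b_c_d_def)
  qed
  define w where "w = moebius_act G z"
  have zN: "z + of_nat N \<in> uhp" using z by (simp add: uhp_def)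
  have w: "w \<in> uhp" unfolding w_def by (rule moebius_act_uhp[OF G1 z])
  have nz: "aut_factor G z \<noteq> 0" "aut_factor (trans_mat (real N)) z \<noteq> 0"
    using aut_factor_nonzero[OF G1 z] by (auto simp: trans_mat_act)
  note eq = \<open>real_mat B ** G = G ** trans_mat (real N)\<close>
  have m: "moebius_act (real_mat B) w = moebius_act G (z + of_nat N)"
    using moebius_act_mult[OF nz(1), of "real_mat B"] moebius_act_mult[OF nz(2), of G]
    by (simp add: eq w_def trans_mat_act)
  have f: "aut_factor (real_mat B) w * aut_factor G z = aut_factor G (z + of_nat N)"
    using aut_factor_mult[OF nz(1), of "real_mat B"] aut_factor_mult[OF nz(2), of G]
    by (simp add: eq w_def trans_mat_act)
  obtain \<xi> where \<xi>: "mp_elt (real_mat B) \<xi> \<in> Gamma0_tilde l N" using Gamma0_tilde_lift[OF B] by blast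
  \<comment> \<open>Supplies a fourth root of unity for the lifted element without a split on the
    parity of \<open>l\<close>; the matrix found with it must agree with \<open>B\<close> over the
    reals.\<close>
  obtain B' \<xi>' where B': "\<xi>' ^ 4 = 1" "mp_elt (real_mat B) \<xi> = mp_elt (real_mat B') \<xi>'"
    using Gamma0_tilde_elim[OF \<xi>] by blast
  then have "real_mat B = real_mat B'" by (simp add: mp_elt_def)
  then have eqB: "mp_elt (real_mat B) \<xi> = mp_elt (real_mat B) \<xi>'" using B'(2) by simp
  have n1: "cmod \<xi>' = 1" using power_eq_1_iff[OF B'(1)] by simp
  have "chi (1 + int N * a * c) = 1"
  proof -
    have "[1 + int N * a * c = 1] (mod int N)" by (simp add: cong_iff_dvd_diff)
    then show ?thesis using chi unfolding dirichlet_char_def by metis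
  qed
  then have "char_tilde chi (mp_elt (real_mat B) \<xi>) = 1" by (simp add: char_tilde_mp_elt B_def)
  then have "slash l ?F (mp_elt (real_mat B) \<xi>') w = ?F w"
    using slash_poisson_transform_Gamma0[OF T aut chi \<xi> w] by (simp add: eqB)
  from arg_cong[OF this, of cmod]
  have "cmod (?F w) = cmod (?F (moebius_act G (z + of_nat N))) * sqrt (cmod (aut_factor (real_mat B) w)) powi (- l)"
    unfolding cmod_slash_mp_elt[OF w n1] m by simp
  then show ?thesis
    unfolding G_def[symmetric] cmod_slash_mp_elt[OF z norm_one] cmod_slash_mp_elt[OF zN norm_one] w_def[symmetric]
      f[symmetric] norm_mult real_sqrt_mult power_int_mult_distrib by simp
qed

text \<open>On the strip 0 <= Re z <= N with Im z > 1, the modulus of z is at most (N+1) Im z, so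
  the height of gz and the weight factor are bounded by powers of Im z. Periodicity of the modulus
  carries the bound to all real parts.\<close>

lemma slash_poisson_transform_growth:
  assumes "N > 0" and T: "distribution_on lam l T" and aut: "automorphic_dist lam l N chi T"
    and chi: "dirichlet_char N chi" and A: "det A = 1"
  shows "\<exists>C K \<nu>::real. C > 0 \<and> K > 0 \<and> \<nu> > 0 \<and> (\<forall>z. Im z > K \<longrightarrow>
     cmod (slash l (poisson_transform lam l T) (mp_elt (real_mat A) 1) z) < C * Im z powr \<nu>)"
proof -
  define G where "G = real_mat A"
  define s where "s z = cmod (slash l (poisson_transform lam l T) (mp_elt G 1) z)" for z
  define a b c d where "a = A$1$1" "b = A$1$2" "c = A$2$1" "d = A$2$2"
  have det: "a * d - b * c = 1" using A by (simp add: det_2 a_b_c_d_def)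
  have G1: "det G = 1" using A by (simp add: G_def det_real_mat)
  obtain C0 k where C0: "C0 \<ge> 0"
    "\<And>z. z \<in> uhp \<Longrightarrow> cmod (poisson_transform lam l T z) \<le> C0 * uhp_height z ^ k"
    using poisson_transform_growth[OF T] by blast
  define n where "n = nat \<bar>l\<bar>"
  define L where "L = (1 + \<bar>real_of_int a\<bar> + \<bar>real_of_int b\<bar> + \<bar>real_of_int c\<bar> + \<bar>real_of_int d\<bar>) * (real N + 1)"
  have L: "L \<ge> 1" unfolding L_def using mult_mono[of 1 "1 + \<bar>real_of_int a\<bar> + \<bar>real_of_int b\<bar> + \<bar>real_of_int c\<bar> + \<bar>real_of_int d\<bar>" 1 "real N + 1"] by simp
  \<comment> \<open>The factor 8 L^6 comes from the height of gz, and L^n from the power of the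
    automorphy factor.\<close>
  define C where "C = C0 * (8 * L ^ 6) ^ k * L ^ n"
  have strip: "s z \<le> C * Im z ^ (6 * k + n)" if y: "Im z > 1" and x: "0 \<le> Re z" "Re z \<le> real N" for z
  proof -
    define y where "y = Im z"
    have z: "z \<in> uhp" using y by (simp add: uhp_def)
    have y1: "y > 1" using y by (simp add: y_def)
    have "cmod z \<le> real N + y" using cmod_le[of z] x y by (simp add: y_def)
    also have "\<dots> \<le> (real N + 1) * y" using y1 mult_left_mono[of 1 y "real N"] by (simp add: algebra_simps)
    finally have zb: "cmod z \<le> (real N + 1) * y" .
    have lin: "cmod (of_int p * z + of_int q) \<le> L * y"
      if "\<bar>real_of_int p\<bar> + \<bar>real_of_int q\<bar> \<le> 1 + \<bar>real_of_int a\<bar> + \<bar>real_of_int b\<bar> + \<bar>real_of_int c\<bar> + \<bar>real_of_int d\<bar>" for p q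
    proof -
      have one: "1 \<le> (real N + 1) * y" using y1 mult_mono[of 1 "real N + 1" 1 y] by simp
      have "cmod (of_int p * z + of_int q) \<le> \<bar>real_of_int p\<bar> * cmod z + \<bar>real_of_int q\<bar> * 1"
        using norm_triangle_ineq[of "of_int p * z" "of_int q"] by (simp add: norm_mult)
      also have "\<dots> \<le> \<bar>real_of_int p\<bar> * ((real N + 1) * y) + \<bar>real_of_int q\<bar> * ((real N + 1) * y)"
        using zb one by (intro add_mono mult_left_mono) auto
      also have "\<dots> = (\<bar>real_of_int p\<bar> + \<bar>real_of_int q\<bar>) * ((real N + 1) * y)" by (simp add: algebra_simps)
      also have "\<dots> \<le> L * y" unfolding L_def mult.assoc using that y1 by (intro mult_right_mono) auto
      finally show ?thesis .
    qed
    define j where "j = cmod (aut_factor G z)"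
    have aG: "aut_factor G z = of_int c * z + of_int d"
      by (simp add: aut_factor_def G_def real_mat_nth a_b_c_d_def)
    have jL: "j \<le> L * y" unfolding j_def aG by (rule lin) simp
    \<comment> \<open>Integrality enters here: either c = 0 and d = 1 or -1, or |c| >= 1 and the
      imaginary part of cz + d already exceeds 1 in modulus.\<close>
    have j1: "j \<ge> 1"
    proof (cases "c = 0")
      case True
      then have "\<bar>d\<bar> = 1" using det by (metis abs_zmult_eq_1 diff_0_right mult.commute mult_zero_right abs_1)
      then show ?thesis unfolding j_def aG using True by simp
    next
      case False
      then have "1 \<le> \<bar>real_of_int c\<bar>" by linarith
      then have "1 * 1 \<le> \<bar>real_of_int c\<bar> * y" using y1 by (intro mult_mono) auto
      also have "\<dots> = \<bar>Im (aut_factor G z)\<bar>" using y1 by (simp add: aG abs_mult y_def)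
      also have "\<dots> \<le> j" unfolding j_def by (rule abs_Im_le_cmod)
      finally show ?thesis by simp
    qed
    define w where "w = moebius_act G z"
    have w: "w \<in> uhp" unfolding w_def by (rule moebius_act_uhp[OF G1 z])
    have wL: "cmod w \<le> L * y"
    proof -
      have "cmod w = cmod (of_int a * z + of_int b) / j"
        by (simp add: w_def moebius_act_def norm_divide j_def G_def real_mat_nth a_b_c_d_def)
      also have "\<dots> \<le> cmod (of_int a * z + of_int b)" using j1 by (simp add: divide_le_eq_1 mult_le_cancel_left1 divide_le_eq)
      also have "\<dots> \<le> L * y" by (rule lin) simp
      finally show ?thesis .
    qed
    have Ly: "L * y \<ge> 1" using L y1 mult_mono[of 1 L 1 y] by simp
    have iw: "1 / Im w \<le> (L * y)\<^sup>2"
    proof -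
      have "1 / Im w = j\<^sup>2 / y" using Im_moebius_act[OF G1 z] by (simp add: w_def j_def y_def)
      also have "\<dots> \<le> j\<^sup>2 / 1" using y1 by (intro divide_left_mono) auto
      also have "\<dots> \<le> (L * y)\<^sup>2" using jL j1 by (simp add: power_mono)
      finally show ?thesis .
    qed
    \<comment> \<open>The exponent 6 is 2 + 4: two from |w|^2 and four from 1 / (Im w)^2.\<close>
    have R: "uhp_height w \<le> 8 * (L * y) ^ 6"
    proof -
      have iw0: "0 < Im w" using w by (simp add: uhp_def)
      have "1 + (cmod w)\<^sup>2 \<le> 2 * (L * y)\<^sup>2"
        using power_mono[OF wL, of 2] one_le_power[OF Ly, of 2] by simp
      moreover have "1 + 1 / (Im w)\<^sup>2 \<le> 2 * ((L * y)\<^sup>2)\<^sup>2"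
        using power_mono[OF iw, of 2] iw0 one_le_power[OF one_le_power[OF Ly, of 2], of 2] by (simp add: power_divide)
      ultimately have "uhp_height w \<le> 2 * (2 * (L * y)\<^sup>2) * (2 * ((L * y)\<^sup>2)\<^sup>2)"
        unfolding uhp_height_def by (intro mult_mono) auto
      also have "\<dots> = 8 * (L * y) ^ 6" by (simp add: power_mult[symmetric] power_add[symmetric])
      finally show ?thesis .
    qed
    \<comment> \<open>For l >= 0 the factor is at most 1 because j >= 1; for l < 0 it is a positive
      power of sqrt j, and sqrt j <= j <= L y.\<close>
    have J: "sqrt j powi (- l) \<le> (L * y) ^ n"
    proof -
      have s1: "1 \<le> sqrt j" using j1 by simp
      have "sqrt j powi (- l) \<le> sqrt j ^ n"
      proof (cases "l \<ge> 0")
        case True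
        have "sqrt j powi (- l) = inverse (sqrt j ^ nat l)" using True by (simp add: power_int_def power_inverse)
        also have "\<dots> \<le> 1" using s1 by (intro inverse_le_1_iff[THEN iffD2]) (simp add: one_le_power)
        also have "\<dots> \<le> sqrt j ^ n" using s1 by (rule one_le_power)
        finally show ?thesis .
      next
        case False
        then show ?thesis by (simp add: power_int_def n_def)
      qed
      also have "\<dots> \<le> (L * y) ^ n"
      proof (rule power_mono)
        have "sqrt j \<le> sqrt j * sqrt j" using s1 mult_left_mono[of 1 "sqrt j" "sqrt j"] by linarith
        also have "\<dots> = j" using j1 by simp
        finally show "sqrt j \<le> L * y" using jL by linarith
      qed (use s1 in simp)
      finally show ?thesis .
    qed
    have "s z = cmod (poisson_transform lam l T w) * sqrt j powi (- l)"
      unfolding s_def cmod_slash_mp_elt[OF z norm_one] w_def j_def ..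
    also have "\<dots> \<le> (C0 * uhp_height w ^ k) * (L * y) ^ n"
      using C0(1) j1 uhp_height_bounds(1)[of w] w by (intro mult_mono C0 w J) (auto simp: uhp_def)
    also have "\<dots> \<le> (C0 * (8 * (L * y) ^ 6) ^ k) * (L * y) ^ n"
      using C0(1) R Ly uhp_height_bounds(1)[of w] w
      by (intro mult_right_mono mult_left_mono power_mono) (auto simp: uhp_def)
    also have "\<dots> = C * y ^ (6 * k + n)"
      unfolding C_def power_mult_distrib power_add power_mult[of y 6 k] by (simp only: mult_ac)
    finally show ?thesis by (simp add: y_def)
  qed
  have per1: "s (z + of_nat N) = s z" if "z \<in> uhp" for z
    unfolding s_def G_def by (rule slash_poisson_transform_periodic[OF T aut chi A that])
  have per: "s (z + of_int m * of_nat N) = s z" if "z \<in> uhp" for z m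
  proof (induction m rule: int_induct[where k = 0])
    case (step1 i)
    have "z + of_int i * of_nat N \<in> uhp" using that by (simp add: uhp_def)
    from per1[OF this] step1 show ?case by (simp add: algebra_simps)
  next
    case (step2 i)
    have "z + of_int (i - 1) * of_nat N \<in> uhp" using that by (simp add: uhp_def)
    from per1[OF this] step2 show ?case by (simp add: algebra_simps)
  qed simp
  have C: "C \<ge> 0" using C0(1) L by (simp add: C_def)
  \<comment> \<open>\<open>C\<close> and the exponent 6 k + n may both be 0. Raising each by one
    makes the constant and the exponent positive and the inequality strict.\<close>
  have "s z < (C + 1) * Im z powr real (6 * k + n + 1)" if y: "Im z > 1" for z
  proof -
    define m where "m = - \<lfloor>Re z / real N\<rfloor>"
    define z' where "z' = z + of_int m * of_nat N"
    have N: "real N > 0" using \<open>N > 0\<close> by simp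
    have "Re z' = (Re z / real N - of_int \<lfloor>Re z / real N\<rfloor>) * real N"
      using N by (simp add: z'_def m_def field_simps)
    also have "\<dots> = frac (Re z / real N) * real N" by (simp add: frac_def)
    finally have x: "0 \<le> Re z'" "Re z' \<le> real N"
      using N frac_ge_0[of "Re z / real N"] frac_lt_1[of "Re z / real N"]
      by (auto simp: mult_left_le_one_le less_imp_le)
    have i: "Im z' = Im z" by (simp add: z'_def)
    have "s z = s z'" using per[of z m] y by (simp add: z'_def uhp_def)
    also have "\<dots> \<le> C * Im z ^ (6 * k + n)" using strip[of z'] x y i by simp
    also have "\<dots> \<le> C * Im z ^ (6 * k + n + 1)"
      using C y by (intro mult_left_mono power_increasing) auto
    also have "\<dots> < (C + 1) * Im z ^ (6 * k + n + 1)" using y by (intro mult_strict_right_mono) auto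
    also have "Im z ^ (6 * k + n + 1) = Im z powr real (6 * k + n + 1)" using y by (intro powr_realpow[symmetric]) auto
    finally show ?thesis .
  qed
  then show ?thesis using C unfolding s_def G_def
    by (intro exI[of _ "C + 1"] exI[of _ 1] exI[of _ "real (6 * k + n + 1)"]) auto
qed

theorem theorem1p9:
  fixes lam :: complex and l :: int and N :: nat
    and chi :: "int \<Rightarrow> complex" and T :: "(real \<Rightarrow> complex) \<Rightarrow> complex"
  assumes "N > 0"
    and "odd l \<Longrightarrow> 4 dvd N"
    and "dirichlet_char N chi"
    and "distribution_on lam l T"
    and "automorphic_dist lam l N chi T"
  shows "Maass_form l N (\<lambda>d. inverse (chi d))
           ((lam - of_int l / 4) * (1 - lam - of_int l / 4)) (poisson_transform lam l T)"
  unfolding Maass_form_def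
proof (intro conjI ballI allI impI)
  show "smooth_on uhp (poisson_transform lam l T)"
    by (rule smooth_on_poisson_transform[OF assms(4)])
  show "slash l (poisson_transform lam l T) \<gamma> z =
      char_tilde (\<lambda>d. inverse (chi d)) \<gamma> * poisson_transform lam l T z"
    if "\<gamma> \<in> Gamma0_tilde l N" "z \<in> uhp" for \<gamma> z
    using slash_poisson_transform_Gamma0[OF assms(4,5,3) that] by (simp add: char_tilde_def)
  show "Laplacian l (poisson_transform lam l T) z =
      (lam - of_int l / 4) * (1 - lam - of_int l / 4) * poisson_transform lam l T z" if "z \<in> uhp" for z
    by (rule Laplacian_poisson_transform[OF assms(4) that])
  show "\<exists>C K \<nu>::real. C > 0 \<and> K > 0 \<and> \<nu> > 0 \<and> (\<forall>z. Im z > K \<longrightarrow>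
      cmod (slash l (poisson_transform lam l T) (mp_elt (real_mat A) 1) z) < C * Im z powr \<nu>)"
    if "det A = 1" for A
    by (rule slash_poisson_transform_growth[OF assms(1,4,5,3) that])
qed

end
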